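(* Let $k$ be a field, $A=k[v^{\pm1},w^{\pm1}]$ the Laurent polynomial ring in two variables, $\mathfrak p=(v-1,w-1)A$, and let $r$ be a positive integer. (1) A unit of $A$ is of the form $cv^\alpha w^\beta$ with $c\in k^\times$ and $\alpha,\beta\in\mathbb Z$. If $u$ is a unit of $A$ and $\varphi$ is an $r$-nct, then $u\varphi$ is also an $r$-nct. Let $\xi:A\to A$ be a $k$-algebra isomorphism with $\xi(\mathfrak p)=\mathfrak p$. Then there exists $(a_{ij})\in \mathrm{GL}(2,\mathbb Z)$ such that $\xi(v)=v^{a_{11}}w^{a_{12}}$ and $\xi(w)=v^{a_{21}}w^{a_{22}}$. If $\varphi$ is an $r$-nct, then so is $\xi(\varphi)$. (2) Assume that $\varphi$ is an $r$-nct over $k$. (a) We have $$\mathfrak p^r\cap\Bigl(\bigoplus_{(\alpha,\beta)\in P_\varphi\cap\mathbb Z^2}k\,v^\alpha w^\beta\Bigr)=k\varphi.$$ (b) The number of elements of $P_\varphi\cap\mathbb Z^2$ is at most $\frac{r(r+1)}{2}+1$. (c) If $\zeta$ is a reducible element of $A$ contained in $\mathfrak p^r$, then $P_\varphi$ does not contain $N_\zeta$. In particular, if $r\ge2$, $P_\varphi$ does not contain $r+1$ lattice points lying on a line. (3) Assume that $\varphi$ is an $r$-nct over $k$. Then there exists $c\in k^\times$ such that all the coefficients of $c\varphi$ lie in the prime field of $k$. (4) If $\varphi$ is an $r$-nct over $k$, then $\varphi\notin\mathfrak p^{r+1}$. (5) Assume that $\varphi$ is an $r$-nct over $k$ and let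 $L/k$ be a field extension. Then $\varphi$ is also an $r$-nct over $L$. (6) Let $NCT_r$ be the set of $r$-ncts over $k$. Consider the equivalence relation $\sim$ on $NCT_r$ generated by $\varphi\sim u\varphi$ for units $u$ of $A$ and $\varphi\sim\xi(\varphi)$ for $k$-algebra isomorphisms $\xi:A\to A$ with $\xi(\mathfrak p)=\mathfrak p$. Then the quotient set $NCT_r/\!\sim$ is a non-empty finite set for each $r$.
   Context: For $\varphi=\sum c_{(\alpha,\beta)}v^\alpha w^\beta\in A=k[v^{\pm1},w^{\pm1}]$ put $N_\varphi=\{(\alpha,\beta)\in\mathbb Z^2\mid c_{(\alpha,\beta)}\neq0\}$ and let $P_\varphi\subset\mathbb R^2$ be the convex hull of $N_\varphi$ (the Newton polygon; it may be degenerate, with area $0$). For a positive integer $r$, $\varphi$ is called an $r$-nct over $k$ (equation of a negative curve with multiplicity $r$ over $k$) if: (i) $\varphi$ is irreducible in $A$ and $\varphi\in(v-1,w-1)^rA$; and (ii) $2|P_\varphi|<r^2$, where $|P_\varphi|$ is the area of $P_\varphi$. A reducible element of $A$ is a nonzero element that is a product of two non-units. Lattice points are points of $\mathbb Z^2$. *)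

theory Defs
  imports
    "HOL-Analysis.Analysis"
    "HOL-Library.Poly_Mapping"
    "HOL-Computational_Algebra.Factorial_Ring"
begin

text \<open>
  The Laurent polynomial ring \<open>k[v\<^sup>\<plusminus>\<^sup>1, w\<^sup>\<plusminus>\<^sup>1]\<close> is the group algebra of \<open>\<int> \<times> \<int>\<close> over \<open>k\<close>,
  i.e. the finitely supported functions \<open>\<int> \<times> \<int> \<Rightarrow> k\<close> with convolution as product.
\<close>

type_synonym 'k laurent = "(int \<times> int) \<Rightarrow>\<^sub>0 'k"

definition laurent_monom :: "int \<times> int \<Rightarrow> ('k::field) laurent" where
  "laurent_monom m = Poly_Mapping.single m 1"

definition laurent_const :: "'k::field \<Rightarrow> 'k laurent" where
  "laurent_const c = Poly_Mapping.single 0 c"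

definition var_v :: "('k::field) laurent" where
  "var_v = laurent_monom (1, 0)"

definition var_w :: "('k::field) laurent" where
  "var_w = laurent_monom (0, 1)"


text \<open>
  An ideal of a commutative ring \<open>A\<close> is an \<open>A\<close>-submodule of \<open>A\<close>; so the ideal generated by \<open>S\<close>
  is the span of \<open>S\<close> in \<open>A\<close>, viewed as a module over itself.
\<close>

definition ideal_gen :: "'a::comm_ring_1 set \<Rightarrow> 'a set" where
  "ideal_gen S = module.span (*) S"

definition ideal_mult :: "'a::comm_ring_1 set \<Rightarrow> 'a set \<Rightarrow> 'a set" where
  "ideal_mult I J = ideal_gen {a * b | a b. a \<in> I \<and> b \<in> J}"

primrec ideal_power :: "'a::comm_ring_1 set \<Rightarrow> nat \<Rightarrow> 'a set" where
  "ideal_power I 0 = UNIV"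
| "ideal_power I (Suc n) = ideal_mult I (ideal_power I n)"

definition ideal_p :: "('k::field) laurent set" where
  "ideal_p = ideal_gen {var_v - 1, var_w - 1}"

lemma module_times: "module ((*) :: 'a::comm_ring_1 \<Rightarrow> 'a \<Rightarrow> 'a)"
  by standard (simp_all add: algebra_simps)

definition laurent_scale :: "'k::field \<Rightarrow> 'k laurent \<Rightarrow> 'k laurent" where
  "laurent_scale c f = laurent_const c * f"

lemma module_laurent_scale: "module (laurent_scale :: 'k::field \<Rightarrow> _)"
  by standard
    (simp_all add: laurent_scale_def laurent_const_def algebra_simps single_add mult_single
      flip: mult.assoc)


definition lattice_point :: "int \<times> int \<Rightarrow> real \<times> real" where
  "lattice_point m = (real_of_int (fst m), real_of_int (snd m))"

definition newton_polygon :: "('k::field) laurent \<Rightarrow> (real \<times> real) set" where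
  "newton_polygon f = convex hull (lattice_point ` Poly_Mapping.keys f)"

definition newton_lattice_points :: "('k::field) laurent \<Rightarrow> (int \<times> int) set" where
  "newton_lattice_points f = {m. lattice_point m \<in> newton_polygon f}"

definition is_nct :: "nat \<Rightarrow> ('k::field) laurent \<Rightarrow> bool" where
  "is_nct r f \<longleftrightarrow>
     irreducible f \<and> f \<in> ideal_power ideal_p r \<and>
     2 * measure lebesgue (newton_polygon f) < (real r)\<^sup>2"

definition is_reducible :: "'a::comm_ring_1 \<Rightarrow> bool" where
  "is_reducible z \<longleftrightarrow> z \<noteq> 0 \<and> (\<exists>a b. z = a * b \<and> \<not> a dvd 1 \<and> \<not> b dvd 1)"


definition is_ring_hom :: "('a::comm_ring_1 \<Rightarrow> 'b::comm_ring_1) \<Rightarrow> bool" where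
  "is_ring_hom h \<longleftrightarrow>
     h 1 = 1 \<and> (\<forall>x y. h (x + y) = h x + h y) \<and> (\<forall>x y. h (x * y) = h x * h y)"

definition p_preserving_iso :: "(('k::field) laurent \<Rightarrow> 'k laurent) \<Rightarrow> bool" where
  "p_preserving_iso \<xi> \<longleftrightarrow>
     is_ring_hom \<xi> \<and> (\<forall>c. \<xi> (laurent_const c) = laurent_const c) \<and> bij \<xi> \<and>
     \<xi> ` ideal_p = ideal_p"

definition is_subfield :: "'k::field set \<Rightarrow> bool" where
  "is_subfield K \<longleftrightarrow>
     0 \<in> K \<and> 1 \<in> K \<and>
     (\<forall>x\<in>K. \<forall>y\<in>K. x + y \<in> K \<and> x * y \<in> K) \<and>
     (\<forall>x\<in>K. - x \<in> K \<and> inverse x \<in> K)"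

definition prime_field :: "'k::field set" where
  "prime_field = \<Inter> {K. is_subfield K}"


definition NCT :: "nat \<Rightarrow> ('k::field) laurent set" where
  "NCT r = {f. is_nct r f}"

definition nct_step :: "nat \<Rightarrow> (('k::field) laurent \<times> 'k laurent) set" where
  "nct_step r =
     {(f, g). f \<in> NCT r \<and> g \<in> NCT r \<and>
        ((\<exists>u. u dvd 1 \<and> g = u * f) \<or> (\<exists>\<xi>. p_preserving_iso \<xi> \<and> g = \<xi> f))}"

text \<open>
  Since \<open>nct_step r\<close> is contained in \<open>NCT r \<times> NCT r\<close>, the intersection below ranges over a
  non-empty family; it is the equivalence relation on \<open>NCT r\<close> generated by the steps.
\<close>

definition nct_equiv :: "nat \<Rightarrow> (('k::field) laurent \<times> 'k laurent) set" where
  "nct_equiv r = \<Inter> {E. equiv (NCT r) E \<and> nct_step r \<subseteq> E}"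

end

theory Submission
  imports Defs "Berlekamp_Zassenhaus.Unique_Factorization_Poly"
begin

text \<open>
  The heart of the matter is uniqueness: if \<open>\<phi>\<close> is an \<open>r\<close>-nct with Newton polygon \<open>P\<close>, every
  element \<open>\<psi>\<close> of \<open>\<pp>\<^sup>r\<close> supported in \<open>P\<close> is a multiple of \<open>\<phi>\<close>
  (\<open>nct_unique_in_newton_polygon\<close>). Otherwise \<open>\<phi>\<close> and \<open>\<psi>\<close> would have no common factor, since
  \<open>\<phi>\<close> is prime, and would meet at \<open>(1, 1)\<close> with multiplicity at least \<open>r\<^sup>2\<close>, whereas in the
  whole torus there are at most \<open>2 |P|\<close> common zeros; but \<open>2 |P| < r\<^sup>2\<close>. In place of intersection
  theory, this inequality is proved by counting dimensions (\<open>order_square_le_area\<close>): one compares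
  the spaces of Laurent polynomials supported in dilates of \<open>P\<close> with the subspace
  \<open>\<phi>\<^sup>n V + \<psi>\<^sup>n V\<close>, where \<open>V\<close> consists of elements of high order, and obtains the area of \<open>P\<close>
  as the limit of lattice point counts. Degenerate polygons belong to binomials \<open>x\<^sup>m (x\<^sup>d - 1)\<close>, up
  to scalars.

  Uniqueness gives the statements on linear systems directly: the bound on lattice points by the
  expected dimension of the linear system, the exclusion of reducible elements, and in particular
  of \<open>x\<^sup>m (x\<^sup>d - 1)\<^sup>r\<close>, which is supported in \<open>r + 1\<close> points of a line.

  Membership in \<open>\<pp>\<^sup>r\<close> means that the Taylor coefficients at \<open>(1, 1)\<close> of degree below \<open>r\<close> vanish,
  and these are linear forms with integer coefficients (\<open>pow_p_iff_taylor\<close>). Hence one-dimensional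
  linear systems are defined over the prime field. Applied to \<open>\<phi>\<close> this gives its field of
  definition; applied to the factors of \<open>\<phi>\<close> over a larger field, it shows that these are defined
  over \<open>k\<close>, so \<open>\<phi>\<close> stays irreducible. If \<open>\<phi>\<close> vanished at \<open>(1, 1)\<close> to order
  \<open>r + 1\<close>, its logarithmic derivatives would be multiples of \<open>\<phi>\<close>, and \<open>\<phi>\<close> would be a single term
  or, up to a unit, a power whose exponent is the characteristic.

  An automorphism that preserves \<open>\<pp>\<close> maps monomials to monomials with coefficient \<open>1\<close>, so it comes
  from a matrix; matrices in \<open>GL(2, \<int>)\<close> preserve lattice point counts, hence areas.

  Existence: for \<open>r \<ge> 2\<close> the lattice points of the quadrilateral with corners \<open>(0, 0)\<close>, \<open>(1, 2)\<close>,
  \<open>(r - 1, r)\<close>, \<open>(r, 1)\<close>, of double area \<open>r\<^sup>2 - 1\<close>, exceed the number of conditions by one. A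
  nonzero element of \<open>\<pp>\<^sup>r\<close> supported there must involve both ends of the edge from \<open>(0, 0)\<close> to
  \<open>(r, 1)\<close>, because without either of them the points form a staircase, on which the conditions are
  independent (\<open>staircase_pow_p_eq_0\<close>); a primitive edge of this kind forces irreducibility.
  Finiteness: a largest triangle with vertices in the support has bounded area, so its Hermite
  normal form has bounded entries and the whole support is moved into a box that depends only on
  \<open>r\<close>; and an \<open>r\<close>-nct is determined by its support up to a scalar.
\<close>

section \<open>Laurent polynomials\<close>

abbreviation coef :: "'k::field laurent \<Rightarrow> int \<times> int \<Rightarrow> 'k" where
  "coef \<equiv> Poly_Mapping.lookup"

abbreviation supp :: "'k::field laurent \<Rightarrow> (int \<times> int) set" where
  "supp \<equiv> Poly_Mapping.keys"

abbreviation term_of :: "int \<times> int \<Rightarrow> 'k::field \<Rightarrow> 'k laurent" where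
  "term_of \<equiv> Poly_Mapping.single"

lemma sum_terms: "(\<Sum>m\<in>supp f. term_of m (coef f m)) = f"
proof (rule poly_mapping_eqI)
  fix k
  have "(\<Sum>m\<in>supp f. if m = k then coef f m else 0) = coef f k"
    by (simp add: sum.delta in_keys_iff)
  then show "coef (\<Sum>m\<in>supp f. term_of m (coef f m)) k = coef f k"
    by (simp add: lookup_sum lookup_single when_def)
qed

lemma laurent_induct [case_names zero monomial add]:
  assumes "P 0" "\<And>m c. P (term_of m c)" "\<And>f g. P f \<Longrightarrow> P g \<Longrightarrow> P (f + g)"
  shows "P f"
proof -
  have "P (\<Sum>m\<in>A. term_of m (coef f m))" if "finite A" for A
    using that by (induction A) (auto intro: assms)
  then show ?thesis using sum_terms[of f] by (metis finite_keys)
qed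

lemma coef_term_mult: "coef (term_of a c * f) m = c * coef f (m - a)"
proof (induction f rule: laurent_induct)
  case (monomial b d)
  show ?case by (auto simp: mult_single lookup_single when_def)
qed (simp_all add: algebra_simps lookup_add)

lemma supp_term_mult: "c \<noteq> 0 \<Longrightarrow> supp (term_of a c * f) = (+) a ` supp f"
proof -
  assume c: "c \<noteq> 0"
  have "m \<in> supp (term_of a c * f) \<longleftrightarrow> m - a \<in> supp f" for m
    using c by (simp add: in_keys_iff coef_term_mult)
  then show ?thesis
    by (force simp: image_iff)
qed

lemma coef_mult:
  assumes "finite A" "supp f \<subseteq> A"
  shows "coef (f * g) m = (\<Sum>a\<in>A. coef f a * coef g (m - a))"
proof -
  have "f * g = (\<Sum>a\<in>supp f. term_of a (coef f a) * g)"
    by (simp add: sum_terms flip: sum_distrib_right)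
  then have "coef (f * g) m = (\<Sum>a\<in>supp f. coef f a * coef g (m - a))"
    by (simp add: lookup_sum coef_term_mult)
  also have "\<dots> = (\<Sum>a\<in>A. coef f a * coef g (m - a))"
    by (rule sum.mono_neutral_left) (use assms in \<open>auto simp: in_keys_iff\<close>)
  finally show ?thesis .
qed

lemma supp_mult: "supp (f * g) \<subseteq> {a + b | a b. a \<in> supp f \<and> b \<in> supp g}"
  by (rule keys_mult)

lemma laurent_scale_eq: "laurent_scale c f = term_of 0 c * f"
  by (simp add: laurent_scale_def laurent_const_def)

lemma coef_scale [simp]: "coef (laurent_scale c f) m = c * coef f m"
  by (simp add: laurent_scale_eq coef_term_mult)

lemma supp_scale [simp]: "c \<noteq> 0 \<Longrightarrow> supp (laurent_scale c f) = supp f"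
  by (auto simp: in_keys_iff)

lemma scale_mult_left: "laurent_scale c f * g = laurent_scale c (f * g)"
  by (simp add: laurent_scale_def mult.assoc)

lemma scale_mult_right: "f * laurent_scale c g = laurent_scale c (f * g)"
  by (simp add: laurent_scale_def mult.left_commute)

lemma term_eq_scale_monom: "term_of m c = laurent_scale c (laurent_monom m)"
  by (simp add: laurent_scale_eq laurent_monom_def mult_single)

lemma monom_mult: "laurent_monom a * laurent_monom b = laurent_monom (a + b)"
  by (simp add: laurent_monom_def mult_single)

lemma monom_0: "laurent_monom 0 = 1"
  by (simp add: laurent_monom_def)

lemma supp_monom [simp]: "supp (laurent_monom m :: 'k::field laurent) = {m}"
  by (simp add: laurent_monom_def)

lemma coef_monom: "coef (laurent_monom m) n = (if n = m then 1 else 0)"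
  by (simp add: laurent_monom_def lookup_single when_def)

lemma monom_power: "laurent_monom (a, b) ^ n = laurent_monom (int n * a, int n * b)"
proof (induction n)
  case 0
  show ?case using monom_0 by (simp add: zero_prod_def)
next
  case (Suc n)
  then show ?case by (simp add: monom_mult algebra_simps)
qed

lemma supp_eq_empty_iff: "supp f = {} \<longleftrightarrow> f = 0"
  by simp

text \<open>
  An additive functional, with ties broken lexicographically (in the direction of the sign of
  \<open>s\<close>), totally orders the group of exponents.
\<close>

definition lex_less :: "(int \<times> int \<Rightarrow> real) \<Rightarrow> int \<Rightarrow> int \<times> int \<Rightarrow> int \<times> int \<Rightarrow> bool" where
  "lex_less ell s x y \<longleftrightarrow>
     ell x < ell y \<or> ell x = ell y \<and> (s * fst x < s * fst y \<or> fst x = fst y \<and> s * snd x < s * snd y)"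

definition additive_on_lattice :: "(int \<times> int \<Rightarrow> real) \<Rightarrow> bool" where
  "additive_on_lattice ell \<longleftrightarrow> (\<forall>x y. ell (x + y) = ell x + ell y)"

lemma lex_less_irrefl: "\<not> lex_less ell s x x"
  by (simp add: lex_less_def)

lemma lex_less_trans: "lex_less ell s x y \<Longrightarrow> lex_less ell s y z \<Longrightarrow> lex_less ell s x z"
  by (auto simp: lex_less_def)

lemma lex_less_total: "s \<noteq> 0 \<Longrightarrow> x \<noteq> y \<Longrightarrow> lex_less ell s x y \<or> lex_less ell s y x"
  by (auto simp: lex_less_def prod_eq_iff mult_less_cancel_left not_less_iff_gr_or_eq)

lemma lex_less_add:
  "additive_on_lattice ell \<Longrightarrow> lex_less ell s (x + z) (y + z) \<longleftrightarrow> lex_less ell s x y"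
  unfolding lex_less_def additive_on_lattice_def by (simp only: fst_add snd_add distrib_left add_less_cancel_right add_right_cancel)

lemma lex_less_add2:
  assumes "additive_on_lattice ell" "lex_less ell s x x'" "y = y' \<or> lex_less ell s y y'"
  shows "lex_less ell s (x + y) (x' + y')"
  using assms lex_less_add[of ell s x y x'] lex_less_add[of ell s y x' y']
  by (metis add.commute lex_less_trans)

lemma finite_has_lex_max:
  assumes "finite A" "A \<noteq> {}" "s \<noteq> 0"
  obtains a where "a \<in> A" "\<And>x. x \<in> A \<Longrightarrow> x \<noteq> a \<Longrightarrow> lex_less ell s x a"
proof -
  have "\<exists>a\<in>A. \<forall>x\<in>A. x \<noteq> a \<longrightarrow> lex_less ell s x a"
    using assms(1,2)
  proof (induction A rule: finite_ne_induct)
    case (insert x F)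
    then obtain a where a: "a \<in> F" "\<forall>x\<in>F. x \<noteq> a \<longrightarrow> lex_less ell s x a" by blast
    show ?case
    proof (cases "lex_less ell s x a")
      case True then show ?thesis using a by auto
    next
      case False
      then have "lex_less ell s a x" using lex_less_total[OF assms(3), of x a ell] a insert by auto
      then show ?thesis using a by (metis insert_iff lex_less_trans)
    qed
  qed auto
  then show ?thesis using that by blast
qed

text \<open>
  For a total order compatible with addition, the product of the two largest terms cannot be
  cancelled by the other products.
\<close>

lemma leading_term:
  assumes ell: "additive_on_lattice ell" and s: "s \<noteq> 0" and "f \<noteq> 0" "g \<noteq> 0"
  obtains a b where "a \<in> supp f" "b \<in> supp g"
    "\<And>x. x \<in> supp f \<Longrightarrow> x \<noteq> a \<Longrightarrow> lex_less ell s x a"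
    "\<And>x. x \<in> supp g \<Longrightarrow> x \<noteq> b \<Longrightarrow> lex_less ell s x b"
    "a + b \<in> supp (f * g)"
    "\<And>x. x \<in> supp (f * g) \<Longrightarrow> x \<noteq> a + b \<Longrightarrow> lex_less ell s x (a + b)"
proof -
  obtain a where a: "a \<in> supp f" "\<And>x. x \<in> supp f \<Longrightarrow> x \<noteq> a \<Longrightarrow> lex_less ell s x a"
    using finite_has_lex_max[of "supp f" s ell] assms by auto
  obtain b where b: "b \<in> supp g" "\<And>x. x \<in> supp g \<Longrightarrow> x \<noteq> b \<Longrightarrow> lex_less ell s x b"
    using finite_has_lex_max[of "supp g" s ell] assms by auto
  have less: "lex_less ell s (x + y) (a + b)"
    if "x \<in> supp f" "y \<in> supp g" "(x, y) \<noteq> (a, b)" for x y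
  proof (cases "x = a")
    case True
    then show ?thesis using that b(2)[of y] lex_less_add2[OF ell, of s y b x a]
      by (simp add: add.commute)
  next
    case False
    then show ?thesis using that a(2)[of x] b(2)[of y] lex_less_add2[OF ell, of s x a y b] by auto
  qed
  have "coef f x * coef g (a + b - x) = 0" if "x \<in> supp f" "x \<noteq> a" for x
  proof (rule ccontr)
    assume "\<not> ?thesis"
    then have "a + b - x \<in> supp g" by (auto simp: in_keys_iff)
    then have "lex_less ell s (x + (a + b - x)) (a + b)" using less[of x "a + b - x"] that by auto
    then show False by (simp add: lex_less_irrefl)
  qed
  then have "coef (f * g) (a + b) = coef f a * coef g (a + b - a)"
    unfolding coef_mult[OF finite_keys order_refl]
    using sum.remove[OF finite_keys a(1), of "\<lambda>x. coef f x * coef g (a + b - x)"]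
    by (simp add: sum.neutral)
  then have ab: "a + b \<in> supp (f * g)"
    using a b by (simp add: in_keys_iff)
  have "lex_less ell s z (a + b)" if z: "z \<in> supp (f * g)" "z \<noteq> a + b" for z
  proof -
    obtain x y where "z = x + y" "x \<in> supp f" "y \<in> supp g"
      using subsetD[OF supp_mult z(1)] by blast
    then show ?thesis using less[of x y] z by auto
  qed
  then show ?thesis using that a b ab by blast
qed

lemma additive_const_zero: "additive_on_lattice (\<lambda>_. 0)"
  by (simp add: additive_on_lattice_def)

lemma laurent_mult_eq_0_iff: "(f :: 'k::field laurent) * g = 0 \<longleftrightarrow> f = 0 \<or> g = 0"
proof -
  have False if "f \<noteq> 0" "g \<noteq> 0" "f * g = 0"
    by (rule leading_term[OF additive_const_zero, of 1 f g]) (use that in auto)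
  then show ?thesis by auto
qed

lemma laurent_mult_cancel: "(f :: 'k::field laurent) \<noteq> 0 \<Longrightarrow> f * a = f * b \<longleftrightarrow> a = b"
  using laurent_mult_eq_0_iff[of f "a - b"] by (simp add: right_diff_distrib)

lemma laurent_power_eq_0_iff: "(f :: 'k::field laurent) ^ n = 0 \<longleftrightarrow> f = 0 \<and> n > 0"
  by (induction n) (auto simp: laurent_mult_eq_0_iff)

lemma support_function_mult:
  assumes "additive_on_lattice ell" "f \<noteq> 0" "g \<noteq> 0"
  obtains a b where "a \<in> supp f" "b \<in> supp g" "a + b \<in> supp (f * g)"
    "\<And>x. x \<in> supp f \<Longrightarrow> ell x \<le> ell a" "\<And>x. x \<in> supp g \<Longrightarrow> ell x \<le> ell b"
  by (rule leading_term[OF assms(1), of 1 f g])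
     (use assms in \<open>auto simp: lex_less_def\<close>, (metis less_eq_real_def)+)

lemma term_unit: "c \<noteq> 0 \<Longrightarrow> term_of m c dvd (1 :: 'k::field laurent)"
  by (rule dvdI[of _ _ "term_of (- m) (inverse c)"]) (simp add: mult_single)

text \<open>
  If \<open>u u' = 1\<close>, then for the same total order the largest exponents of \<open>u\<close> and \<open>u'\<close> add up to
  \<open>0\<close>, and so do the smallest; hence the largest and the smallest exponent of \<open>u\<close> coincide.
\<close>

lemma laurent_unit_iff: "(u :: 'k::field laurent) dvd 1 \<longleftrightarrow> (\<exists>m. supp u = {m})"
proof
  assume "u dvd 1"
  then obtain u' where u': "u * u' = 1" by (metis dvdE)
  then have nz: "u \<noteq> 0" "u' \<noteq> 0" by auto
  have ord: "lex_less (\<lambda>_. 0) (- 1) x y \<longleftrightarrow> lex_less (\<lambda>_. 0) 1 y x" for x y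
    by (auto simp: lex_less_def)
  obtain a b where ab: "a \<in> supp u" "b \<in> supp u'" "a + b \<in> supp (u * u')"
    "\<And>x. x \<in> supp u \<Longrightarrow> x \<noteq> a \<Longrightarrow> lex_less (\<lambda>_. 0) 1 x a"
    "\<And>x. x \<in> supp u' \<Longrightarrow> x \<noteq> b \<Longrightarrow> lex_less (\<lambda>_. 0) 1 x b"
    by (rule leading_term[OF additive_const_zero, of 1 u u']) (use nz in auto)
  obtain a' b' where ab': "a' \<in> supp u" "b' \<in> supp u'" "a' + b' \<in> supp (u * u')"
    "\<And>x. x \<in> supp u \<Longrightarrow> x \<noteq> a' \<Longrightarrow> lex_less (\<lambda>_. 0) (- 1) x a'"
    by (rule leading_term[OF additive_const_zero, of "- 1" u u']) (use nz in auto)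
  have sum: "a + b = 0" "a' + b' = 0" using ab ab' u' by auto
  have "a' = a"
  proof (rule ccontr)
    assume "a' \<noteq> a"
    then have "lex_less (\<lambda>_. 0) 1 (a' + b') (a + b)"
      using ab ab' lex_less_add2[OF additive_const_zero, of 1 a' a b' b] by blast
    then show False using sum by (simp add: lex_less_irrefl)
  qed
  then have "x = a" if "x \<in> supp u" for x
    using ab(4)[OF that] ab'(4)[OF that] by (metis lex_less_irrefl lex_less_trans ord)
  then show "\<exists>m. supp u = {m}" using ab(1) by blast
next
  assume "\<exists>m. supp u = {m}"
  then obtain m where m: "supp u = {m}" by blast
  then have "u = term_of m (coef u m)" "coef u m \<noteq> 0"
    using sum_terms[of u] by (auto simp: in_keys_iff)
  then show "u dvd 1" by (metis term_unit)
qed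

lemma laurent_unit_eq_term: "(u :: 'k::field laurent) dvd 1 \<longleftrightarrow> (\<exists>c m. c \<noteq> 0 \<and> u = term_of m c)"
proof
  assume "u dvd 1"
  then obtain m where m: "supp u = {m}" by (auto simp: laurent_unit_iff)
  then have "u = term_of m (coef u m)" "coef u m \<noteq> 0"
    using sum_terms[of u] by (auto simp: in_keys_iff)
  then show "\<exists>c m. c \<noteq> 0 \<and> u = term_of m c" by blast
qed (auto simp: term_unit)

section \<open>Powers of the ideal\<close>

interpretation ideal: Modules.module "(*) :: 'a::comm_ring_1 \<Rightarrow> 'a \<Rightarrow> 'a"
  by (rule module_times)

\<comment> \<open>reverses associativity, and so loops with associativity rewriting\<close>
declare ideal.scale_scale [simp del]

interpretation laurent: vector_space "laurent_scale :: 'k::field \<Rightarrow> _"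
  using module_laurent_scale by (simp add: module_iff_vector_space)

abbreviation pow_p :: "nat \<Rightarrow> 'k::field laurent set" where
  "pow_p \<equiv> ideal_power ideal_p"

lemma ideal_gen_pair: "ideal_gen {x, y} = {x * a + y * b | a b. True}" for x y :: "'a::comm_ring_1"
proof -
  have "z \<in> ideal_gen {x, y} \<longleftrightarrow> (\<exists>a b. z = x * a + y * b)" for z
  proof -
    have "z \<in> ideal_gen {x, y} \<longleftrightarrow> (\<exists>a b. z - a * x - b * y = 0)"
      by (simp add: ideal_gen_def ideal.span_breakdown_eq ideal.span_empty)
    also have "\<dots> \<longleftrightarrow> (\<exists>a b. z = x * a + y * b)"
      by (simp add: algebra_simps diff_eq_eq)
    finally show ?thesis .
  qed
  then show ?thesis by blast
qed

lemma ideal_p_iff: "f \<in> ideal_p \<longleftrightarrow> (\<exists>a b. f = (var_v - 1) * a + (var_w - 1) * b)"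
  by (simp add: ideal_p_def ideal_gen_pair)

lemma pow_p_subspace: "ideal.subspace (pow_p n)"
  by (cases n) (simp_all add: ideal.subspace_UNIV ideal_mult_def ideal_gen_def ideal.subspace_span)

lemma pow_p_add: "f \<in> pow_p n \<Longrightarrow> g \<in> pow_p n \<Longrightarrow> f + g \<in> pow_p n"
  using pow_p_subspace ideal.subspace_add by blast

lemma pow_p_diff: "f \<in> pow_p n \<Longrightarrow> g \<in> pow_p n \<Longrightarrow> f - g \<in> pow_p n"
  using pow_p_subspace ideal.subspace_diff by blast

lemma pow_p_0: "0 \<in> pow_p n"
  using pow_p_subspace ideal.subspace_0 by blast

lemma pow_p_mult_left: "f \<in> pow_p n \<Longrightarrow> g * f \<in> pow_p n"
  using pow_p_subspace ideal.subspace_scale by blast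

lemma pow_p_mult_right: "f \<in> pow_p n \<Longrightarrow> f * g \<in> pow_p n"
  using pow_p_mult_left by (metis mult.commute)

lemma pow_p_scale: "f \<in> pow_p n \<Longrightarrow> laurent_scale c f \<in> pow_p n"
  by (simp add: laurent_scale_def pow_p_mult_left)

text \<open>
  The two generators suffice: a product of an element of the ideal with one of the \<open>n\<close>-th power
  is regrouped along the generators. All inductions on the power go through this form.
\<close>

lemma pow_p_Suc_iff: "f \<in> pow_p (Suc n) \<longleftrightarrow>
  (\<exists>a b. f = (var_v - 1) * a + (var_w - 1) * b \<and> a \<in> pow_p n \<and> b \<in> pow_p n)"
proof -
  define R :: "'a laurent set" where
    "R = {f. \<exists>a b. f = (var_v - 1) * a + (var_w - 1) * b \<and> a \<in> pow_p n \<and> b \<in> pow_p n}"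
  have RI: "f \<in> R" if "f = (var_v - 1) * a + (var_w - 1) * b" "a \<in> pow_p n" "b \<in> pow_p n"
    for f a b using that by (auto simp: R_def)
  have RE: "\<exists>a b. f = (var_v - 1) * a + (var_w - 1) * b \<and> a \<in> pow_p n \<and> b \<in> pow_p n" if "f \<in> R"
    for f using that by (simp add: R_def)
  have sub: "ideal.subspace R"
  proof (rule ideal.subspaceI)
    show "0 \<in> R" by (rule RI[of _ 0 0]) (simp_all add: pow_p_0)
  next
    fix x y assume xy: "x \<in> R" "y \<in> R"
    obtain a b where x: "x = (var_v - 1) * a + (var_w - 1) * b" "a \<in> pow_p n" "b \<in> pow_p n"
      using RE[OF xy(1)] by blast
    obtain a' b' where y: "y = (var_v - 1) * a' + (var_w - 1) * b'" "a' \<in> pow_p n" "b' \<in> pow_p n"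
      using RE[OF xy(2)] by blast
    show "x + y \<in> R"
      by (rule RI[of _ "a + a'" "b + b'"])
         (simp only: x(1) y(1) distrib_left ac_simps, simp_all only: x y pow_p_add)
  next
    fix c x assume xR: "x \<in> R"
    obtain a b where x: "x = (var_v - 1) * a + (var_w - 1) * b" "a \<in> pow_p n" "b \<in> pow_p n"
      using RE[OF xR] by blast
    show "c * x \<in> R"
      by (rule RI[of _ "c * a" "c * b"])
         (simp only: x(1) distrib_left ac_simps, simp_all only: x pow_p_mult_left)
  qed
  have "{a * b | a b. a \<in> ideal_p \<and> b \<in> pow_p n} \<subseteq> R"
  proof
    fix z assume "z \<in> {a * b | a b. a \<in> ideal_p \<and> b \<in> (pow_p n :: 'a laurent set)}"
    then obtain d c where d: "z = d * c" "d \<in> ideal_p" "c \<in> pow_p n" by blast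
    from d(2) obtain a b where ab: "d = (var_v - 1) * a + (var_w - 1) * b"
      unfolding ideal_p_iff by blast
    show "z \<in> R"
      by (rule RI[of _ "a * c" "b * c"])
         (simp only: d(1) ab distrib_right mult.assoc, simp_all only: d pow_p_mult_left)
  qed
  from ideal.span_minimal[OF this sub] have 1: "pow_p (Suc n) \<subseteq> R"
    by (simp add: ideal_mult_def ideal_gen_def)
  have *: "var_v - 1 \<in> ideal_p" "var_w - 1 \<in> ideal_p"
    unfolding ideal_p_def ideal_gen_def by (rule ideal.span_base, simp)+
  have "z \<in> pow_p (Suc n)" if zR: "z \<in> R" for z
  proof -
    obtain a b where z: "z = (var_v - 1) * a + (var_w - 1) * b" "a \<in> pow_p n" "b \<in> pow_p n"
      using RE[OF zR] by blast
    have "(var_v - 1) * a \<in> {a * b | a b. a \<in> ideal_p \<and> b \<in> pow_p n}"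
      "(var_w - 1) * b \<in> {a * b | a b. a \<in> ideal_p \<and> b \<in> pow_p n}"
      by (rule CollectI, intro exI conjI, rule refl, rule *, rule z)+
    then show ?thesis
      unfolding ideal_power.simps ideal_mult_def ideal_gen_def z(1)
      by (rule ideal.span_add[OF ideal.span_base ideal.span_base])
  qed
  with 1 have "pow_p (Suc n) = R" by blast
  then show ?thesis by (simp add: R_def)
qed

lemma pow_p_SucE:
  assumes "f \<in> pow_p (Suc n)"
  obtains a b where "f = (var_v - 1) * a + (var_w - 1) * b" "a \<in> pow_p n" "b \<in> pow_p n"
  using assms by (auto simp only: pow_p_Suc_iff)

lemma pow_p_1: "pow_p (Suc 0) = ideal_p"
proof (rule Set.set_eqI)
  fix f :: "'a laurent"
  show "f \<in> pow_p (Suc 0) \<longleftrightarrow> f \<in> ideal_p"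
    unfolding pow_p_Suc_iff ideal_p_iff by simp
qed

lemma pow_p_mult: "f \<in> pow_p m \<Longrightarrow> g \<in> pow_p n \<Longrightarrow> f * g \<in> pow_p (m + n)"
proof (induction m arbitrary: f)
  case 0 then show ?case by (simp add: pow_p_mult_left)
next
  case (Suc m)
  from Suc.prems(1) obtain a b where
    f: "f = (var_v - 1) * a + (var_w - 1) * b" "a \<in> pow_p m" "b \<in> pow_p m"
    by (rule pow_p_SucE)
  have "f * g = (var_v - 1) * (a * g) + (var_w - 1) * (b * g)"
    unfolding f(1) by (simp only: distrib_right mult.assoc)
  with Suc.IH[OF f(2) Suc.prems(2)] Suc.IH[OF f(3) Suc.prems(2)] show ?case
    by (auto simp only: add_Suc pow_p_Suc_iff)
qed

lemma pow_p_power: "f \<in> pow_p m \<Longrightarrow> f ^ n \<in> pow_p (m * n)"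
proof (induction n)
  case (Suc n)
  then show ?case using pow_p_mult[of f m "f ^ n" "m * n"] by simp
qed simp

lemma pow_p_Suc_subset: "pow_p (Suc n) \<subseteq> pow_p n"
proof
  fix f :: "'a laurent" assume "f \<in> pow_p (Suc n)"
  then obtain a b where "f = (var_v - 1) * a + (var_w - 1) * b" "a \<in> pow_p n" "b \<in> pow_p n"
    by (rule pow_p_SucE)
  then show "f \<in> pow_p n" by (simp add: pow_p_add pow_p_mult_left)
qed

lemma pow_p_antimono: "m \<le> n \<Longrightarrow> pow_p n \<subseteq> pow_p m"
  by (induction n rule: dec_induct) (simp, metis pow_p_Suc_subset subset_trans)

section \<open>Taylor coefficients\<close>

text \<open>
  The binomial coefficient \<open>m (m - 1) \<dots> (m - i + 1) / i!\<close> for an integer \<open>m\<close> of either sign, written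
  through binomial coefficients of natural numbers, so that it is visibly an integer.
\<close>

definition ibinom :: "int \<Rightarrow> nat \<Rightarrow> int" where
  "ibinom m i = (if m \<ge> 0 then int (nat m choose i)
                 else (- 1) ^ i * int ((nat (- m - 1) + i) choose i))"

lemma ibinom_0 [simp]: "ibinom m 0 = 1"
  by (simp add: ibinom_def)

lemma ibinom_nat [simp]: "ibinom (int n) i = int (n choose i)"
  by (simp add: ibinom_def)

lemma ibinom_zero: "ibinom 0 i = (if i = 0 then 1 else 0)"
  by (cases i) (simp_all add: ibinom_def)

lemma ibinom_pascal: "ibinom (m + 1) (Suc i) = ibinom m (Suc i) + ibinom m i"
proof -
  consider "m \<ge> 0" | "m = - 1" | "m \<le> - 2"
    by linarith
  then show ?thesis
  proof cases
    case 1
    define n where "n = nat m"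
    have "m = int n" "m + 1 = int (Suc n)" using 1 by (simp_all add: n_def)
    then show ?thesis by (simp only: ibinom_nat) simp
  next
    case 2 then show ?thesis by (simp add: ibinom_def)
  next
    case 3
    define n where "n = nat (- m - 2)"
    have "m + 1 < 0" "nat (- (m + 1) - 1) = n" "nat (- m - 1) = Suc n" "m < 0"
      using 3 by (auto simp: n_def)
    then show ?thesis by (simp add: ibinom_def algebra_simps)
  qed
qed

text \<open>
  The rule \<open>m C(m, i) = (i + 1) C(m, i + 1) + i C(m, i)\<close> describes how the operator \<open>v d/dv\<close> acts on
  Taylor coefficients.
\<close>

lemma ibinom_times: "m * ibinom m i = int (Suc i) * ibinom m (Suc i) + int i * ibinom m i"
proof (cases "m \<ge> 0")
  case True
  then obtain n where n: "m = int n" by (metis nonneg_int_cases)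
  have "n * (n choose i) = Suc i * (n choose Suc i) + i * (n choose i)"
  proof (cases "i \<le> n")
    case True
    have "Suc i * (n choose Suc i) = (n - i) * (n choose i)"
      by (simp only: binomial_absorption binomial_absorb_comp)
    then show ?thesis using True by (simp flip: add_mult_distrib)
  qed (simp add: binomial_eq_0)
  then have "int n * int (n choose i) = int (Suc i) * int (n choose Suc i) + int i * int (n choose i)"
    by (simp only: flip: of_nat_mult of_nat_add)
  then show ?thesis by (simp only: n ibinom_nat)
next
  case False
  define n where "n = nat (- m - 1)"
  have m: "m = - (int n + 1)" using False by (simp add: n_def)
  have *: "Suc i * ((n + Suc i) choose Suc i) = (n + i + 1) * ((n + i) choose i)"
    using binomial_absorption[of i "n + Suc i"] by simp
  define s :: int where "s = (- 1) ^ i"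
  define b c where "b = int ((n + i) choose i)" and "c = int ((n + Suc i) choose Suc i)"
  have e: "ibinom m i = s * b" "ibinom m (Suc i) = - (s * c)"
    using False by (simp_all add: ibinom_def s_def b_def c_def n_def)
  have "int (Suc i) * c = (int n + int i + 1) * b"
    unfolding b_def c_def of_nat_mult[symmetric] * by (simp add: distrib_right)
  then have key: "m * b = - (int (Suc i) * c) + int i * b"
    by (simp only: m) (simp add: algebra_simps)
  have "m * (s * b) = s * (m * b)" by (simp only: mult.left_commute)
  also have "\<dots> = int (Suc i) * (- (s * c)) + int i * (s * b)"
    by (simp only: key distrib_left mult_minus_right mult.left_commute)
  finally show ?thesis unfolding e .
qed

text \<open>
  The coefficient of \<open>(v - 1)\<^sup>i (w - 1)\<^sup>j\<close> in the expansion at \<open>(1, 1)\<close>: a Hasse derivative, so no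
  factorials are divided by.
\<close>

definition taylor :: "nat \<Rightarrow> nat \<Rightarrow> 'k::field laurent \<Rightarrow> 'k" where
  "taylor i j f = (\<Sum>m\<in>supp f. coef f m * of_int (ibinom (fst m) i * ibinom (snd m) j))"

lemma taylor_superset:
  assumes "finite A" "supp f \<subseteq> A"
  shows "taylor i j f = (\<Sum>m\<in>A. coef f m * of_int (ibinom (fst m) i * ibinom (snd m) j))"
  unfolding taylor_def
  by (rule sum.mono_neutral_left) (use assms in \<open>auto simp: in_keys_iff\<close>)

lemma taylor_add: "taylor i j (f + g) = taylor i j f + taylor i j g"
proof -
  have "supp (f + g) \<subseteq> supp f \<union> supp g" by (rule keys_add)
  then show ?thesis
    by (simp add: taylor_superset[of "supp f \<union> supp g"] lookup_add distrib_right sum.distrib)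
qed

lemma taylor_scale: "taylor i j (laurent_scale c f) = c * taylor i j f"
  by (cases "c = 0") (simp_all add: taylor_def sum_distrib_left mult.assoc)

lemma taylor_0 [simp]: "taylor i j 0 = 0"
  by (simp add: taylor_def)

lemma taylor_term: "taylor i j (term_of m c) = c * of_int (ibinom (fst m) i * ibinom (snd m) j)"
  by (subst taylor_superset[of "{m}"]) simp_all

lemma taylor_uminus: "taylor i j (- f) = - taylor i j f"
  using taylor_add[of i j f "- f"] by (simp add: eq_neg_iff_add_eq_0 add.commute)

lemma taylor_diff: "taylor i j (f - g) = taylor i j f - taylor i j g"
  using taylor_add[of i j f "- g"] by (simp add: taylor_uminus)

lemma taylor_sum: "taylor i j (\<Sum>x\<in>A. f x) = (\<Sum>x\<in>A. taylor i j (f x))"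
  by (induction A rule: infinite_finite_induct) (simp_all add: taylor_add)

lemma taylor_v: "taylor i j ((var_v - 1) * f) = (if i = 0 then 0 else taylor (i - 1) j f)"
proof (induction f rule: laurent_induct)
  case (monomial m c)
  have *: "(var_v - 1) * term_of m c = term_of (m + (1, 0)) c - term_of m c"
    by (simp add: left_diff_distrib var_v_def laurent_monom_def mult_single add.commute)
  show ?case
    unfolding * taylor_diff taylor_term
    by (cases i; cases m) (simp_all add: ibinom_pascal algebra_simps)
qed (simp_all add: taylor_add distrib_left)

lemma taylor_w: "taylor i j ((var_w - 1) * f) = (if j = 0 then 0 else taylor i (j - 1) f)"
proof (induction f rule: laurent_induct)
  case (monomial m c)
  have *: "(var_w - 1) * term_of m c = term_of (m + (0, 1)) c - term_of m c"
    by (simp add: left_diff_distrib var_w_def laurent_monom_def mult_single add.commute)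
  show ?case
    unfolding * taylor_diff taylor_term
    by (cases j; cases m) (simp_all add: ibinom_pascal algebra_simps)
qed (simp_all add: taylor_add distrib_left)

lemma taylor_pow_p: "f \<in> pow_p n \<Longrightarrow> i + j < n \<Longrightarrow> taylor i j f = 0"
proof (induction n arbitrary: f i j)
  case (Suc n)
  from Suc.prems(1) obtain a b where "f = (var_v - 1) * a + (var_w - 1) * b" "a \<in> pow_p n" "b \<in> pow_p n"
    by (rule pow_p_SucE)
  then show ?case using Suc by (auto simp: taylor_add taylor_v taylor_w)
qed simp

abbreviation local_monom :: "nat \<Rightarrow> nat \<Rightarrow> 'k::field laurent" where
  "local_monom i j \<equiv> (var_v - 1) ^ i * (var_w - 1) ^ j"

lemma taylor_local_monom: "taylor i j (local_monom a b) = (if i = a \<and> j = b then 1 else 0)"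
proof (induction a arbitrary: i)
  case 0
  show ?case
  proof (induction b arbitrary: j)
    case 0
    have "taylor i j (term_of 0 1 :: 'a laurent) = (if i = 0 \<and> j = 0 then 1 else 0)"
      by (simp only: taylor_term) (simp add: ibinom_zero)
    then show ?case by simp
  next
    case (Suc b)
    then show ?case by (auto simp: taylor_w)
  qed
next
  case (Suc a)
  then show ?case by (auto simp: taylor_v mult.assoc)
qed

lemma monom_diff_1_in_ideal_p: "laurent_monom m - 1 \<in> (ideal_p :: 'k::field laurent set)"
proof -
  let ?P = "pow_p (Suc 0) :: 'k laurent set"
  have add: "laurent_monom (a + b) - 1 \<in> ?P"
    if "laurent_monom a - 1 \<in> ?P" "laurent_monom b - 1 \<in> ?P" for a b
  proof -
    have "laurent_monom (a + b) - 1 =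
      laurent_monom a * (laurent_monom b - 1) + (laurent_monom a - 1 :: 'k laurent)"
      by (simp add: right_diff_distrib monom_mult)
    then show ?thesis by (simp only: pow_p_add pow_p_mult_left that)
  qed
  have neg: "laurent_monom (- a) - 1 \<in> ?P"
    if "laurent_monom a - 1 \<in> ?P" for a
  proof -
    have "laurent_monom (- a) - 1 = (- laurent_monom (- a)) * (laurent_monom a - 1 :: 'k laurent)"
      by (simp add: right_diff_distrib monom_mult monom_0)
    then show ?thesis by (simp only: pow_p_mult_left that)
  qed
  have e: "laurent_monom (1, 0) - 1 \<in> ?P"
     "laurent_monom (0, 1) - 1 \<in> ?P"
    unfolding pow_p_1 ideal_p_iff var_v_def[symmetric] var_w_def[symmetric]
    by (metis mult_1_right mult_zero_right add_0_right add_0_left)+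
  have z: "laurent_monom 0 - 1 \<in> ?P"
    by (simp only: monom_0 diff_self pow_p_0)
  have v: "laurent_monom (x, 0) - 1 \<in> ?P" for x
  proof (induction x rule: int_induct[of _ 0])
    case base then show ?case using z by (simp only: zero_prod_def)
  next
    case (step1 i) then show ?case using add[OF step1(2) e(1)] by (simp only: add_Pair add_0_right)
  next
    case (step2 i) then show ?case using add[OF step2(2) neg[OF e(1)]]
      by (simp only: add_Pair uminus_Pair minus_zero add_0_right diff_conv_add_uminus)
  qed
  have w: "laurent_monom (0, y) - 1 \<in> ?P" for y
  proof (induction y rule: int_induct[of _ 0])
    case base then show ?case using z by (simp only: zero_prod_def)
  next
    case (step1 i) then show ?case using add[OF step1(2) e(2)] by (simp only: add_Pair add_0_right)
  next
    case (step2 i) then show ?case using add[OF step2(2) neg[OF e(2)]]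
      by (simp only: add_Pair uminus_Pair minus_zero add_0_right diff_conv_add_uminus)
  qed
  show ?thesis using add[OF v w, of "fst m" "snd m"] by (simp only: add_Pair add_0_right add_0_left prod.collapse pow_p_1)
qed

lemma constant_plus_ideal_p: "\<exists>c. f - term_of 0 c \<in> ideal_p"
proof (induction f rule: laurent_induct)
  case zero
  then show ?case by (rule exI[of _ 0]) (use pow_p_0[of "Suc 0"] in \<open>simp only: pow_p_1 single_zero diff_self\<close>)
next
  case (monomial m c)
  have "term_of m c - term_of 0 c = laurent_scale c (laurent_monom m - 1)"
    by (simp add: laurent_scale_eq laurent_monom_def mult_single right_diff_distrib)
  then show ?case
    by (metis monom_diff_1_in_ideal_p pow_p_1 pow_p_scale)
next
  case (add f g)
  then obtain c d where "f - term_of 0 c \<in> ideal_p" "g - term_of 0 d \<in> ideal_p" by blast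
  then have "(f - term_of 0 c) + (g - term_of 0 d) \<in> ideal_p" using pow_p_add pow_p_1 by metis
  then have "f + g - term_of 0 (c + d) \<in> ideal_p" by (simp add: single_add algebra_simps)
  then show ?case ..
qed

definition jets :: "nat \<Rightarrow> 'k::field laurent set" where
  "jets n = laurent.span {local_monom i j | i j. i + j < n}"

lemma jets_mult:
  assumes "g \<in> jets n"
  shows "(var_v - 1) * g \<in> jets (Suc n)" "(var_w - 1) * g \<in> jets (Suc n)"
proof -
  have "(var_v - 1) * g \<in> jets (Suc n) \<and> (var_w - 1) * g \<in> jets (Suc n)"
    using assms unfolding jets_def
  proof (induction g rule: laurent.span_induct_alt)
    case base then show ?case by (simp add: laurent.span_zero)
  next
    case (step c x y)
    then obtain i j where x: "x = local_monom i j" and ij: "i + j < n" by blast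
    have xv: "(var_v - 1) * x = local_monom (Suc i) j" and xw: "(var_w - 1) * x = local_monom i (Suc j)"
      unfolding x by (simp_all only: power_Suc ac_simps)
    have ij': "Suc i + j < Suc n" "i + Suc j < Suc n" using ij by auto
    have "(var_v - 1) * x \<in> laurent.span {local_monom i j |i j. i + j < Suc n}"
      unfolding xv by (intro laurent.span_base CollectI exI conjI, rule refl, rule ij')
    moreover have "(var_w - 1) * x \<in> laurent.span {local_monom i j |i j. i + j < Suc n}"
      unfolding xw by (intro laurent.span_base CollectI exI conjI, rule refl, rule ij')
    ultimately show ?case using step
      by (simp only: distrib_left scale_mult_right laurent.span_add laurent.span_scale)
  qed
  then show "(var_v - 1) * g \<in> jets (Suc n)" "(var_w - 1) * g \<in> jets (Suc n)" by auto
qed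

text \<open>
  Split off the value at \<open>(1, 1)\<close>; the rest is \<open>(v - 1) a + (w - 1) b\<close>, and induction applies to
  \<open>a\<close> and \<open>b\<close>.
\<close>

lemma jets_approximate: "\<exists>g\<in>jets n. f - g \<in> pow_p n"
proof (induction n arbitrary: f)
  case 0 then show ?case by (auto simp: jets_def intro: laurent.span_zero)
next
  case (Suc n)
  obtain c where "f - term_of 0 c \<in> ideal_p" using constant_plus_ideal_p by blast
  then obtain a b where ab: "f - term_of 0 c = (var_v - 1) * a + (var_w - 1) * b"
    unfolding ideal_p_iff by blast
  obtain g where g: "g \<in> jets n" "a - g \<in> pow_p n" using Suc by blast
  obtain h where h: "h \<in> jets n" "b - h \<in> pow_p n" using Suc by blast
  define q where "q = term_of 0 c + ((var_v - 1) * g + (var_w - 1) * h)"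
  have "(1 :: 'a laurent) \<in> {local_monom i j | i j. i + j < Suc n}"
    by (rule CollectI, rule exI[of _ 0], rule exI[of _ 0]) simp
  then have "laurent_scale c 1 \<in> jets (Suc n)"
    unfolding jets_def by (intro laurent.span_scale laurent.span_base)
  then have "term_of 0 c \<in> jets (Suc n)" by (simp add: laurent_scale_eq)
  then have "q \<in> jets (Suc n)"
    using jets_mult[OF g(1)] jets_mult[OF h(1)] unfolding q_def jets_def by (intro laurent.span_add)
  moreover have "f - q = (var_v - 1) * (a - g) + (var_w - 1) * (b - h)"
  proof -
    have "f - q = (f - term_of 0 c) - ((var_v - 1) * g + (var_w - 1) * h)"
      by (simp only: q_def diff_diff_add)
    then show ?thesis unfolding ab right_diff_distrib[of "var_v - 1"] right_diff_distrib[of "var_w - 1"]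
      by (simp only: add_diff_add)
  qed
  then have "f - q \<in> pow_p (Suc n)" unfolding pow_p_Suc_iff using g(2) h(2) by blast
  ultimately show ?case by blast
qed

lemma finite_pairs_below [simp]: "finite {(i, j). i + j < (n::nat)}"
  by (rule finite_subset[of _ "{..n} \<times> {..n}"]) auto

lemma jets_eq_taylor_sum:
  assumes "g \<in> jets n"
  shows "g = (\<Sum>(i,j)\<in>{(i,j). i + j < n}. laurent_scale (taylor i j g) (local_monom i j))"
  using assms unfolding jets_def
proof (induction g rule: laurent.span_induct_alt)
  case base then show ?case by (simp add: sum.neutral case_prod_beta)
next
  case (step c x y)
  then obtain a b where x: "x = local_monom a b" "a + b < n" by blast
  have "(\<Sum>(i,j)\<in>{(i,j). i + j < n}. laurent_scale (taylor i j x) (local_monom i j)) =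
    (\<Sum>p\<in>{(i,j). i + j < n}. if p = (a, b) then x else 0)"
    by (rule sum.cong) (auto simp: x taylor_local_monom split: if_splits)
  also have "\<dots> = x" using x by (subst sum.delta) auto
  finally have 1: "x = (\<Sum>(i,j)\<in>{(i,j). i + j < n}. laurent_scale (taylor i j x) (local_monom i j))" ..
  have "(\<Sum>(i,j)\<in>{(i,j). i + j < n}. laurent_scale (taylor i j (laurent_scale c x + y)) (local_monom i j)) =
    laurent_scale c (\<Sum>(i,j)\<in>{(i,j). i + j < n}. laurent_scale (taylor i j x) (local_monom i j)) +
    (\<Sum>(i,j)\<in>{(i,j). i + j < n}. laurent_scale (taylor i j y) (local_monom i j))"
    by (simp add: taylor_add taylor_scale laurent.scale_left_distrib laurent.scale_sum_right sum.distrib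
        case_prod_beta)
  then show ?case using 1 step.IH by simp
qed

text \<open>
  Modulo the \<open>n\<close>-th power every element is a truncated expansion, which its Taylor coefficients
  determine. These are linear in the element, with integer coefficients: this is what makes
  dimension counts and changes of the base field possible.
\<close>

lemma pow_p_iff_taylor: "f \<in> pow_p n \<longleftrightarrow> (\<forall>i j. i + j < n \<longrightarrow> taylor i j f = 0)"
proof
  assume *: "\<forall>i j. i + j < n \<longrightarrow> taylor i j f = 0"
  obtain g where g: "g \<in> jets n" "f - g \<in> pow_p n" using jets_approximate by blast
  have "taylor i j g = 0" if "i + j < n" for i j
    using taylor_pow_p[OF g(2) that] * that by (simp add: taylor_diff)
  then have "g = 0" by (subst jets_eq_taylor_sum[OF g(1)]) (auto intro!: sum.neutral)
  then show "f \<in> pow_p n" using g by simp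
qed (use taylor_pow_p in blast)

section \<open>The order of vanishing is additive\<close>

lemma leading_form:
  assumes "f \<in> pow_p a"
  shows "f - (\<Sum>i\<le>a. laurent_scale (taylor i (a - i) f) (local_monom i (a - i))) \<in> pow_p (Suc a)"
proof -
  have "taylor k l (\<Sum>i\<le>a. laurent_scale (taylor i (a - i) f) (local_monom i (a - i))) = taylor k l f"
    if "k + l < Suc a" for k l
  proof -
    have "taylor k l (\<Sum>i\<le>a. laurent_scale (taylor i (a - i) f) (local_monom i (a - i))) =
      (\<Sum>i\<le>a. if i = k then (if l = a - k then taylor k l f else 0) else 0)"
      unfolding taylor_sum by (rule sum.cong) (auto simp: taylor_scale taylor_local_monom)
    also have "\<dots> = (if l = a - k then taylor k l f else 0)"
      using that by simp
    also have "\<dots> = taylor k l f"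
    proof (cases "l = a - k")
      case False
      then have "k + l < a" using that by linarith
      then show ?thesis using taylor_pow_p[OF assms] by simp
    qed simp
    finally show ?thesis .
  qed
  then show ?thesis unfolding pow_p_iff_taylor by (simp add: taylor_diff)
qed

lemma local_monom_mult: "local_monom a b * local_monom c d = local_monom (a + c) (b + d)"
  by (simp only: power_add ac_simps)

text \<open>
  The leading forms at \<open>(1, 1)\<close> are homogeneous polynomials in \<open>v - 1\<close> and \<open>w - 1\<close>; the product of
  their lowest terms in \<open>v - 1\<close> cannot be cancelled.
\<close>

lemma order_mult_less:
  assumes f: "f \<in> pow_p a" "f \<notin> pow_p (Suc a)" and g: "g \<in> pow_p b" "g \<notin> pow_p (Suc b)"
  shows "f * g \<notin> pow_p (Suc (a + b))"
proof
  assume fg: "f * g \<in> pow_p (Suc (a + b))"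
  define c where "c i = taylor i (a - i) f" for i
  define d where "d i = taylor i (b - i) g" for i
  define F where "F = (\<Sum>i\<le>a. laurent_scale (c i) (local_monom i (a - i)))"
  define G where "G = (\<Sum>i\<le>b. laurent_scale (d i) (local_monom i (b - i)))"
  have fF: "f - F \<in> pow_p (Suc a)" using leading_form[OF f(1)] by (simp add: F_def c_def)
  have gG: "g - G \<in> pow_p (Suc b)" using leading_form[OF g(1)] by (simp add: G_def d_def)
  have F: "F \<in> pow_p a"
    using pow_p_diff[OF f(1), of "f - F"] fF pow_p_Suc_subset by auto
  have "F \<noteq> 0" "G \<noteq> 0" using fF gG f(2) g(2) by auto
  then have "\<exists>i\<le>a. c i \<noteq> 0" "\<exists>i\<le>b. d i \<noteq> 0"
    unfolding F_def G_def by (metis (no_types, lifting) atMost_iff laurent.scale_zero_left sum.neutral)+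
  define I where "I = (LEAST i. i \<le> a \<and> c i \<noteq> 0)"
  define J where "J = (LEAST i. i \<le> b \<and> d i \<noteq> 0)"
  have I: "I \<le> a" "c I \<noteq> 0" "\<And>i. i \<le> a \<Longrightarrow> c i \<noteq> 0 \<Longrightarrow> I \<le> i"
    using LeastI_ex[OF \<open>\<exists>i\<le>a. c i \<noteq> 0\<close>] Least_le[of "\<lambda>i. i \<le> a \<and> c i \<noteq> 0"] by (auto simp: I_def)
  have J: "J \<le> b" "d J \<noteq> 0" "\<And>i. i \<le> b \<Longrightarrow> d i \<noteq> 0 \<Longrightarrow> J \<le> i"
    using LeastI_ex[OF \<open>\<exists>i\<le>b. d i \<noteq> 0\<close>] Least_le[of "\<lambda>i. i \<le> b \<and> d i \<noteq> 0"] by (auto simp: J_def)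
  have "f * g - F * G = (f - F) * g + F * (g - G)" by (simp add: algebra_simps)
  moreover have "(f - F) * g \<in> pow_p (Suc (a + b))" "F * (g - G) \<in> pow_p (Suc (a + b))"
    using pow_p_mult[OF fF g(1)] pow_p_mult[OF F gG] by simp_all
  ultimately have "f * g - F * G \<in> pow_p (Suc (a + b))" by (simp only: pow_p_add)
  from pow_p_diff[OF fg this] have FG: "F * G \<in> pow_p (Suc (a + b))" by simp
  have "F * G = (\<Sum>i\<le>a. \<Sum>j\<le>b. laurent_scale (c i * d j) (local_monom (i + j) (a - i + (b - j))))"
    unfolding F_def G_def sum_product scale_mult_left scale_mult_right local_monom_mult
    by (simp add: mult.commute)
  then have "taylor (I + J) (a + b - (I + J)) (F * G) =
    (\<Sum>i\<le>a. \<Sum>j\<le>b. c i * d j * (if I + J = i + j \<and> a + b - (I + J) = a - i + (b - j) then 1 else 0))"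
    by (simp only: taylor_sum taylor_scale taylor_local_monom)
  also have "\<dots> = (\<Sum>i\<le>a. \<Sum>j\<le>b. if i = I \<and> j = J then c I * d J else 0)"
  proof (intro sum.cong refl)
    fix i j assume ij: "i \<in> {..a}" "j \<in> {..b}"
    then show "c i * d j * (if I + J = i + j \<and> a + b - (I + J) = a - i + (b - j) then 1 else 0) =
        (if i = I \<and> j = J then c I * d J else 0)"
      using I(1,2) J(1,2) I(3)[of i] J(3)[of j] by (cases "c i = 0 \<or> d j = 0") auto
  qed
  also have "\<dots> = (\<Sum>i\<le>a. if i = I then c I * d J else 0)"
    using J(1) by (intro sum.cong refl) (auto simp: if_distrib cong: if_cong)
  also have "\<dots> = c I * d J" using I(1) by simp
  finally show False using taylor_pow_p[OF FG, of "I + J" "a + b - (I + J)"] I J by simp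
qed

text \<open>
  Additivity of the order at \<open>(1, 1)\<close>, in the form in which it is applied to factorizations.
\<close>

lemma pow_p_mult_split:
  assumes "f * g \<in> pow_p r"
  obtains a b where "a + b = r" "f \<in> pow_p a" "g \<in> pow_p b"
proof -
  define a where "a = (GREATEST a. a \<le> r \<and> f \<in> pow_p a)"
  have ex: "0 \<le> r \<and> f \<in> pow_p 0" by simp
  have a: "a \<le> r" "f \<in> pow_p a"
    using GreatestI_nat[of "\<lambda>a. a \<le> r \<and> f \<in> pow_p a", OF ex, of r] by (auto simp: a_def)
  have a_max: "k \<le> a" if "k \<le> r" "f \<in> pow_p k" for k
    using Greatest_le_nat[of "\<lambda>a. a \<le> r \<and> f \<in> pow_p a" k r] that by (auto simp: a_def)
  have "g \<in> pow_p (r - a)"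
  proof (cases "a = r")
    case False
    then have fa: "f \<notin> pow_p (Suc a)" using a_max[of "Suc a"] a(1) by auto
    define b where "b = (GREATEST b. b \<le> r - a \<and> g \<in> pow_p b)"
    have ex: "0 \<le> r - a \<and> g \<in> pow_p 0" by simp
    have b: "b \<le> r - a" "g \<in> pow_p b"
      using GreatestI_nat[of "\<lambda>b. b \<le> r - a \<and> g \<in> pow_p b", OF ex, of "r - a"] by (auto simp: b_def)
    have b_max: "k \<le> b" if "k \<le> r - a" "g \<in> pow_p k" for k
      using Greatest_le_nat[of "\<lambda>b. b \<le> r - a \<and> g \<in> pow_p b" k "r - a"] that by (auto simp: b_def)
    have "b = r - a"
    proof (rule ccontr)
      assume "b \<noteq> r - a"
      then have "b < r - a" using b(1) by simp
      then have "g \<notin> pow_p (Suc b)" using b_max[of "Suc b"] by auto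
      from order_mult_less[OF a(2) fa b(2) this] have "f * g \<notin> pow_p (Suc (a + b))" .
      moreover have "Suc (a + b) \<le> r" using \<open>b < r - a\<close> by simp
      ultimately show False using assms pow_p_antimono by blast
    qed
    then show ?thesis using b by simp
  qed simp
  then show ?thesis using that[of a "r - a"] a by simp
qed

section \<open>Irreducible elements are prime\<close>

text \<open>
  The inclusion of the factorial ring \<open>k[v][w]\<close>, as iterated univariate polynomials, into the
  Laurent polynomials, in two steps.
\<close>

definition emb1 :: "'k::field poly \<Rightarrow> 'k laurent" where
  "emb1 p = poly (map_poly laurent_const p) var_v"

definition emb :: "'k::field poly poly \<Rightarrow> 'k laurent" where
  "emb F = poly (map_poly emb1 F) var_w"

lemma emb1_pCons: "emb1 (pCons a p) = laurent_const a + var_v * emb1 p"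
  by (cases "a = 0 \<and> p = 0") (auto simp: emb1_def map_poly_pCons laurent_const_def)

lemma emb_pCons: "emb (pCons p F) = emb1 p + var_w * emb F"
  by (cases "p = 0 \<and> F = 0") (auto simp: emb_def map_poly_pCons emb1_def)

lemma emb1_0: "emb1 0 = 0" and emb_0: "emb 0 = 0"
  by (simp_all add: emb1_def emb_def)

lemma laurent_const_add: "laurent_const (a + b) = laurent_const a + laurent_const b"
  and laurent_const_mult: "laurent_const (a * b) = laurent_const a * laurent_const b"
  and laurent_const_0: "laurent_const 0 = 0" and laurent_const_1: "laurent_const 1 = 1"
  by (simp_all add: laurent_const_def single_add mult_single)

lemma emb1_add: "emb1 (p + q) = emb1 p + emb1 q"
  by (induction p q rule: poly_induct2) (simp_all add: emb1_0 emb1_pCons laurent_const_add distrib_left)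

lemma emb1_smult: "emb1 (smult c q) = laurent_const c * emb1 q"
  by (induction q) (simp_all add: emb1_0 emb1_pCons laurent_const_mult distrib_left mult.left_commute)

lemma emb1_mult: "emb1 (p * q) = emb1 p * emb1 q"
  by (induction p)
     (simp_all add: emb1_0 emb1_pCons emb1_add emb1_smult distrib_right laurent_const_0 mult.assoc)

lemma emb_add: "emb (F + G) = emb F + emb G"
  by (induction F G rule: poly_induct2) (simp_all add: emb_0 emb_pCons emb1_add distrib_left)

lemma emb_smult: "emb (smult c q) = emb1 c * emb q"
  by (induction q) (simp_all add: emb_0 emb_pCons emb1_mult distrib_left mult.left_commute)

lemma emb_mult: "emb (F * G) = emb F * emb G"
  by (induction F)
     (simp_all add: emb_0 emb_pCons emb_add emb_smult distrib_right emb1_0 mult.assoc)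

lemma emb_1: "emb 1 = 1"
  by (simp only: one_pCons emb_pCons emb_0 emb1_pCons emb1_0 laurent_const_1
      mult_zero_right add_0_right)

lemma emb_sum: "emb (\<Sum>x\<in>A. f x) = (\<Sum>x\<in>A. emb (f x))"
  by (induction A rule: infinite_finite_induct) (simp_all add: emb_0 emb_add)

lemma emb_dvd: "F dvd G \<Longrightarrow> emb F dvd emb G"
  by (metis dvd_def emb_mult)

lemma coef_emb1: "coef (emb1 p) (x, y) = (if y = 0 \<and> x \<ge> 0 then coeff p (nat x) else 0)"
proof (induction p arbitrary: x)
  case 0
  then show ?case by (simp add: emb1_def)
next
  case (pCons a p)
  have "coef (laurent_const a) (x, y) = (if y = 0 \<and> x = 0 then a else 0)"
    by (auto simp: laurent_const_def lookup_single when_def zero_prod_def)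
  then show ?case
    by (auto simp: emb1_pCons lookup_add var_v_def laurent_monom_def coef_term_mult pCons coeff_pCons
        nat_diff_distrib split: nat.splits)
qed

lemma coef_emb: "coef (emb F) (x, y) = (if y \<ge> 0 \<and> x \<ge> 0 then coeff (coeff F (nat y)) (nat x) else 0)"
proof (induction F arbitrary: y)
  case 0
  then show ?case by (simp add: emb_def)
next
  case (pCons p F)
  then show ?case
    by (auto simp: emb_pCons lookup_add var_w_def laurent_monom_def coef_term_mult coef_emb1 coeff_pCons
        nat_diff_distrib split: nat.splits)
qed

lemma emb_inj: "emb F = emb G \<Longrightarrow> F = G"
proof (intro poly_eqI)
  fix i j assume "emb F = emb G"
  then have "coef (emb F) (int j, int i) = coef (emb G) (int j, int i)" by simp
  then show "coeff (coeff F i) j = coeff (coeff G i) j" by (simp add: coef_emb)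
qed

lemma supp_emb: "m \<in> supp (emb F) \<Longrightarrow> 0 \<le> fst m \<and> 0 \<le> snd m"
  by (cases m) (auto simp: in_keys_iff coef_emb split: if_splits)

lemma emb_monom: "emb (monom (monom c i) j) = term_of (int i, int j) c"
proof (rule poly_mapping_eqI)
  fix m show "coef (emb (monom (monom c i) j)) m = coef (term_of (int i, int j) c) m"
    by (cases m) (auto simp: coef_emb lookup_single when_def)
qed

lemma emb_surj:
  assumes "\<And>m. m \<in> supp f \<Longrightarrow> 0 \<le> fst m \<and> 0 \<le> snd m"
  obtains F where "f = emb F"
proof -
  have "(\<Sum>m\<in>supp f. term_of m (coef f m)) = (\<Sum>m\<in>supp f. emb (monom (monom (coef f m) (nat (fst m))) (nat (snd m))))"
    by (rule sum.cong) (auto simp: emb_monom assms)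
  also have "\<dots> = emb (\<Sum>m\<in>supp f. monom (monom (coef f m) (nat (fst m))) (nat (snd m)))"
    by (simp add: emb_sum)
  finally show ?thesis using that by (simp add: sum_terms)
qed

lemma unit_mult_dvd_iff: "(u :: 'a::comm_ring_1) dvd 1 \<Longrightarrow> u * a dvd b \<longleftrightarrow> a dvd b"
proof
  assume "u dvd 1"
  then obtain u' where u': "1 = u * u'" ..
  show "a dvd b" if "u * a dvd b" using that by (rule dvd_mult_right)
  show "u * a dvd b" if ab: "a dvd b"
  proof -
    obtain c where "b = a * c" using ab ..
    have "(u * a) * (u' * c) = (u * u') * (a * c)" by (simp only: ac_simps)
    then have "b = (u * a) * (u' * c)" by (simp only: \<open>b = a * c\<close> flip: u') simp
    then show ?thesis ..
  qed
qed

lemma dvd_unit_mult_iff: "(u :: 'a::comm_ring_1) dvd 1 \<Longrightarrow> a dvd u * b \<longleftrightarrow> a dvd b"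
proof
  assume "u dvd 1"
  then obtain u' where u': "1 = u * u'" ..
  show "a dvd u * b" if "a dvd b" using that by (rule dvd_mult)
  show "a dvd b" if ab: "a dvd u * b"
  proof -
    have "a dvd u' * (u * b)" using ab by (rule dvd_mult)
    moreover have "u' * (u * b) = (u * u') * b" by (simp only: ac_simps)
    ultimately show ?thesis by (simp flip: u')
  qed
qed

lemma irreducible_unit_mult:
  assumes "(u :: 'k::field laurent) dvd 1" "irreducible f"
  shows "irreducible (u * f)"
proof (rule irreducibleI)
  obtain u' where u': "1 = u * u'" using assms(1) ..
  show "u * f \<noteq> 0" using assms u' by (auto simp: laurent_mult_eq_0_iff irreducible_def)
  show "\<not> u * f dvd 1" using assms by (simp add: unit_mult_dvd_iff irreducible_def)
  fix a b assume ab: "u * f = a * b"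
  have "f = (u * u') * f" by (simp flip: u')
  also have "\<dots> = u' * (u * f)" by (simp only: ac_simps)
  also have "\<dots> = (u' * a) * b" by (simp only: ab mult.assoc)
  finally have "f = (u' * a) * b" .
  then have "u' * a dvd 1 \<or> b dvd 1" using assms(2) unfolding irreducible_def by blast
  then show "a dvd 1 \<or> b dvd 1" by (metis dvd_mult_right)
qed

lemma monom_unit: "laurent_monom m dvd (1 :: 'k::field laurent)"
  unfolding laurent_monom_def by (simp add: term_unit)

lemma supp_monom_mult: "supp (laurent_monom a * f) = (+) a ` supp f"
  by (simp add: laurent_monom_def supp_term_mult)

lemma shift_to_emb:
  obtains N :: nat where "\<And>n. n \<ge> N \<Longrightarrow> \<exists>F. laurent_monom (int n, int n) * f = emb F"
proof -
  define N where "N = (\<Sum>m\<in>supp f. nat \<bar>fst m\<bar> + nat \<bar>snd m\<bar>)"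
  have "nat \<bar>fst m\<bar> + nat \<bar>snd m\<bar> \<le> N" if "m \<in> supp f" for m
    unfolding N_def by (rule member_le_sum[of m]) (use that in auto)
  then have *: "- fst m \<le> int N \<and> - snd m \<le> int N" if "m \<in> supp f" for m
    using that by (smt (verit) int_nat_eq of_nat_add of_nat_mono of_nat_0_le_iff)
  have "\<exists>F. laurent_monom (int n, int n) * f = emb F" if "n \<ge> N" for n
  proof (rule emb_surj[of "laurent_monom (int n, int n) * f"])
    fix m assume "m \<in> supp (laurent_monom (int n, int n) * f)"
    then obtain k where "k \<in> supp f" "m = (int n, int n) + k" by (auto simp: supp_monom_mult)
    then show "0 \<le> fst m \<and> 0 \<le> snd m" using *[of k] that by auto
  qed blast
  then show ?thesis using that by blast
qed

text \<open>
  After multiplication by a monomial an irreducible Laurent polynomial is a polynomial divisible by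
  neither variable. As such it is irreducible, since a factor that is invertible among Laurent
  polynomials is a monomial, and irreducible polynomials are prime by Gauss's lemma.
\<close>

lemma laurent_irreducible_imp_prime:
  fixes \<phi> :: "'k::field laurent"
  assumes irr: "irreducible \<phi>"
  shows "prime_elem \<phi>"
proof (rule prime_elemI)
  show nz: "\<phi> \<noteq> 0" and nu: "\<not> \<phi> dvd 1" using irr by (auto simp: irreducible_def)
  define a where "a = Min (fst ` supp \<phi>)"
  define b where "b = Min (snd ` supp \<phi>)"
  have ne: "supp \<phi> \<noteq> {}" using nz by simp
  have a: "a \<in> fst ` supp \<phi>" "\<And>m. m \<in> supp \<phi> \<Longrightarrow> a \<le> fst m"
    unfolding a_def using ne by (auto intro: Min_in Min_le)
  have b: "b \<in> snd ` supp \<phi>" "\<And>m. m \<in> supp \<phi> \<Longrightarrow> b \<le> snd m"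
    unfolding b_def using ne by (auto intro: Min_in Min_le)
  define \<psi> where "\<psi> = laurent_monom (- a, - b) * \<phi>"
  have \<psi>: "supp \<psi> = (+) (- a, - b) ` supp \<phi>" by (simp add: \<psi>_def supp_monom_mult)
  obtain F where F: "\<psi> = emb F"
  proof (rule emb_surj[of \<psi>])
    fix m assume "m \<in> supp \<psi>"
    then obtain k where "k \<in> supp \<phi>" "m = (- a, - b) + k" by (auto simp: \<psi>)
    then show "0 \<le> fst m \<and> 0 \<le> snd m" using a(2)[of k] b(2)[of k] by auto
  qed blast
  have min: "\<exists>m\<in>supp \<psi>. fst m = 0" "\<exists>m\<in>supp \<psi>. snd m = 0"
    using a(1) b(1) by (auto simp: \<psi> image_iff)
  have irr\<psi>: "irreducible \<psi>"
    unfolding \<psi>_def using irr irreducible_unit_mult[OF monom_unit] by blast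
  have factor: "G dvd 1" if FG: "F = G * H" and u: "emb G dvd 1" for G H
  proof -
    obtain m where m: "supp (emb G) = {m}" using u by (auto simp: laurent_unit_iff)
    have m0: "0 \<le> fst m" "0 \<le> snd m" using supp_emb[of m G] m by auto
    have "fst m \<le> fst k \<and> snd m \<le> snd k" if "k \<in> supp \<psi>" for k
    proof -
      have "k \<in> supp (emb G * emb H)" using that by (simp add: F FG emb_mult)
      then obtain h where "h \<in> supp (emb H)" "k = m + h"
        using subsetD[OF supp_mult] m by fastforce
      then show ?thesis using supp_emb[of h H] by simp
    qed
    then have "fst m \<le> 0" "snd m \<le> 0" using min by fastforce+
    then have "m = (0, 0)" using m0 by (simp add: prod_eq_iff)
    define c where "c = coef (emb G) m"
    have "emb G = term_of m c" using sum_terms[of "emb G"] m by (simp add: c_def)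
    also have "\<dots> = emb (monom (monom c 0) 0)" using \<open>m = (0, 0)\<close> by (simp add: emb_monom)
    finally have "G = monom (monom c 0) 0" by (rule emb_inj)
    moreover have "c \<noteq> 0" using m by (auto simp: c_def in_keys_iff)
    ultimately have "G * monom (monom (inverse c) 0) 0 = 1" by (simp add: mult_monom)
    then show ?thesis by (metis dvdI)
  qed
  have "irreducible F"
  proof (rule irreducibleI)
    show "F \<noteq> 0" using irr\<psi> F by (auto simp: irreducible_def emb_0)
    show "\<not> F dvd 1" using irr\<psi> F by (metis emb_dvd emb_1 irreducible_def)
    fix G H assume FG: "F = G * H"
    then have "\<psi> = emb G * emb H" by (simp add: F emb_mult)
    then have "emb G dvd 1 \<or> emb H dvd 1" using irr\<psi> by (auto simp: irreducible_def)
    then show "G dvd 1 \<or> H dvd 1" using factor[of G H] factor[of H G] FG by (auto simp: mult.commute)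
  qed
  then have prime: "prime_elem F" by simp
  fix f g assume "\<phi> dvd f * g"
  then have "\<psi> dvd f * g" by (simp add: \<psi>_def unit_mult_dvd_iff monom_unit)
  then obtain h where h: "f * g = \<psi> * h" ..
  obtain Nf where Nf: "\<And>n. n \<ge> Nf \<Longrightarrow> \<exists>F. laurent_monom (int n, int n) * f = emb F" using shift_to_emb by blast
  obtain Ng where Ng: "\<And>n. n \<ge> Ng \<Longrightarrow> \<exists>F. laurent_monom (int n, int n) * g = emb F" using shift_to_emb by blast
  obtain Nh where Nh: "\<And>n. n \<ge> Nh \<Longrightarrow> \<exists>F. laurent_monom (int n, int n) * h = emb F" using shift_to_emb by blast
  define n where "n = Nf + Ng + Nh"
  obtain F1 where F1: "laurent_monom (int n, int n) * f = emb F1" using Nf[of n] n_def by auto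
  obtain F2 where F2: "laurent_monom (int n, int n) * g = emb F2" using Ng[of n] n_def by auto
  obtain F3 where F3: "laurent_monom (int (n + n), int (n + n)) * h = emb F3" using Nh[of "n + n"] n_def by auto
  have "emb (F1 * F2) = (laurent_monom (int n, int n) * laurent_monom (int n, int n)) * (f * g)"
    by (simp only: emb_mult flip: F1 F2) (simp only: ac_simps)
  also have "\<dots> = \<psi> * (laurent_monom (int (n + n), int (n + n)) * h)"
    by (simp only: h monom_mult add_Pair of_nat_add mult.left_commute)
  also have "\<dots> = emb (F * F3)" by (simp only: F F3 emb_mult)
  finally have "F1 * F2 = F * F3" by (rule emb_inj)
  then have "F dvd F1 \<or> F dvd F2" using prime by (metis dvdI prime_elem_dvd_multD)
  then have "\<psi> dvd laurent_monom (int n, int n) * f \<or> \<psi> dvd laurent_monom (int n, int n) * g"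
    unfolding F F1 F2 using emb_dvd by blast
  then have "\<psi> dvd f \<or> \<psi> dvd g" by (simp add: dvd_unit_mult_iff monom_unit)
  then show "\<phi> dvd f \<or> \<phi> dvd g" by (simp add: \<psi>_def unit_mult_dvd_iff monom_unit)
qed

section \<open>Dimensions of subspaces\<close>

context vector_space begin

lemma independent_Un_if_spans_meet_in_0:
  assumes A: "independent A" and B: "independent B" and AB: "span A \<inter> span B \<subseteq> {0}"
  shows "independent (A \<union> B)" and "A \<inter> B = {}"
proof -
  show dis: "A \<inter> B = {}"
  proof (rule ccontr)
    assume "A \<inter> B \<noteq> {}"
    then obtain x where "x \<in> A" "x \<in> B" by blast
    then have "x = 0" using AB span_base by blast
    then show False using \<open>x \<in> A\<close> A dependent_zero by blast
  qed
  have aux: "a \<notin> span (A \<union> B - {a})"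
    if "independent A" "span A \<inter> span B \<subseteq> {0}" "a \<in> A" "a \<notin> B" for A B a
  proof
    assume "a \<in> span (A \<union> B - {a})"
    moreover have "A \<union> B - {a} = (A - {a}) \<union> B" using that by auto
    ultimately obtain x y where xy: "a = x + y" "x \<in> span (A - {a})" "y \<in> span B"
      by (auto simp: span_Un)
    have "x \<in> span A" using xy(2) span_mono[of "A - {a}" A] by blast
    then have "a - x \<in> span A" using that(3) by (simp add: span_base span_diff)
    then have "y \<in> span A" using xy(1) by simp
    then have "y = 0" using that(2) xy(3) by blast
    then show False using xy that(1,3) by (auto simp: dependent_def)
  qed
  show "independent (A \<union> B)"
    unfolding dependent_def
  proof
    assume "\<exists>a\<in>A \<union> B. a \<in> span (A \<union> B - {a})"
    then obtain a where a: "a \<in> A \<union> B" "a \<in> span (A \<union> B - {a})" by blast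
    show False
    proof (cases "a \<in> A")
      case True
      then show False using aux[OF A AB] a dis by blast
    next
      case False
      then show False using aux[OF B, of A a] AB a dis by (auto simp: Un_commute Int_commute)
    qed
  qed
qed

lemma finite_basis_exists:
  assumes "V \<subseteq> span T" "finite T"
  obtains B where "B \<subseteq> V" "finite B" "independent B" "V \<subseteq> span B" "card B = dim V"
  using basis_exists[of V] independent_span_bound assms by (metis subset_trans)

lemma card_le_dim:
  assumes "V \<subseteq> span T" "finite T" "B \<subseteq> V" "independent B"
  shows "card B \<le> dim V"
proof -
  obtain C where C: "finite C" "V \<subseteq> span C" "card C = dim V"
    using finite_basis_exists[OF assms(1,2)] by metis
  show ?thesis using independent_span_bound[of C B] C assms by auto
qed

lemma dim_mono_finite:
  assumes "V \<subseteq> span T" "finite T" "U \<subseteq> V"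
  shows "dim U \<le> dim V"
proof -
  obtain B where "B \<subseteq> U" "independent B" "card B = dim U" using basis_exists[of U] by metis
  then show ?thesis using card_le_dim[OF assms(1,2), of B] assms(3) by auto
qed

text \<open>
  A linear functional cuts down the dimension by at most one: a vector on which it does not vanish,
  together with a basis of its kernel, spans the space.
\<close>

lemma dim_le_Int_kernel:
  assumes V: "subspace V" "V \<subseteq> span T" "finite T"
    and l: "\<And>x y. l (x + y) = l x + l y" "\<And>c x. l (scale c x) = c * l x"
  shows "dim V \<le> dim (V \<inter> {x. l x = 0}) + 1"
proof (cases "V \<subseteq> {x. l x = 0}")
  case True
  then show ?thesis by (simp add: Int_absorb2)
next
  case False
  then obtain v where v: "v \<in> V" "l v \<noteq> 0" by blast
  obtain B where B: "B \<subseteq> V \<inter> {x. l x = 0}" "finite B" "V \<inter> {x. l x = 0} \<subseteq> span B"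
    "card B = dim (V \<inter> {x. l x = 0})"
    using finite_basis_exists[of "V \<inter> {x. l x = 0}" T] V by (metis le_infI1)
  have "V \<subseteq> span (insert v B)"
  proof
    fix x assume x: "x \<in> V"
    have l_diff: "l (a - b) = l a - l b" for a b using l(1)[of "a - b" b] by simp
    have "x - scale (l x / l v) v \<in> V \<inter> {x. l x = 0}"
      using x v V(1) by (simp add: subspace_diff subspace_scale l_diff l(2))
    then show "x \<in> span (insert v B)" using B(3) by (auto simp: span_breakdown_eq)
  qed
  obtain C where C: "C \<subseteq> V" "independent C" "card C = dim V" using basis_exists[of V] by metis
  have "card C \<le> card (insert v B)"
    using independent_span_bound[of "insert v B" C] B C \<open>V \<subseteq> span (insert v B)\<close> by auto
  also have "\<dots> \<le> card B + 1" using B(2) by (simp add: card_insert_if)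
  finally show ?thesis using B C by simp
qed

lemma dim_le_Int_kernels:
  assumes V: "subspace V" "V \<subseteq> span T" "finite T"
    and l: "\<And>i x y. l i (x + y) = l i x + l i y" "\<And>i c x. l i (scale c x) = c * l i x"
    and "finite I"
  shows "dim V \<le> dim (V \<inter> {x. \<forall>i\<in>I. l i x = 0}) + card I"
  using \<open>finite I\<close>
proof (induction I)
  case (insert j I)
  let ?W = "V \<inter> {x. \<forall>i\<in>I. l i x = 0}"
  have W: "subspace ?W"
  proof (intro subspace_inter V subspaceI)
    fix i
    have "l j 0 = 0" for j using l(2)[of j 0 0] by simp
    then show "0 \<in> {x. \<forall>i\<in>I. l i x = 0}" by simp
  qed (simp_all add: l)
  have "dim ?W \<le> dim (?W \<inter> {x. l j x = 0}) + 1"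
    by (rule dim_le_Int_kernel[OF W _ V(3)]) (use V l in auto)
  moreover have "?W \<inter> {x. l j x = 0} = V \<inter> {x. \<forall>i\<in>insert j I. l i x = 0}" by auto
  ultimately show ?case using insert by simp
qed simp

text \<open>
  Extend a basis \<open>D\<close> of the intersection to a basis \<open>E\<close> of \<open>W\<close>; then a basis of \<open>V\<close> and \<open>E - D\<close>
  are independent together. All spaces lie in the span of a finite set \<open>T\<close>, since the ambient
  space of Laurent polynomials has infinite dimension.
\<close>

lemma dim_add_le_sum_Int:
  assumes V: "subspace V" "V \<subseteq> span T" and W: "subspace W" "W \<subseteq> span T" and T: "finite T"
  shows "dim V + dim W \<le> dim {x + y | x y. x \<in> V \<and> y \<in> W} + dim (V \<inter> W)"
proof -
  obtain D where D: "D \<subseteq> V \<inter> W" "finite D" "independent D" "V \<inter> W \<subseteq> span D" "card D = dim (V \<inter> W)"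
    using finite_basis_exists[of "V \<inter> W" T] V T by (metis le_infI1)
  obtain B where B: "B \<subseteq> V" "finite B" "independent B" "card B = dim V"
    using finite_basis_exists[OF V(2) T] by metis
  obtain E where E: "D \<subseteq> E" "E \<subseteq> W" "independent E" "W \<subseteq> span E"
    using maximal_independent_subset_extend[of D W] D by auto
  have finE: "finite E" using independent_span_bound[OF T E(3)] E(2) W(2) by auto
  have "span B \<inter> span (E - D) \<subseteq> {0}"
  proof
    fix x assume "x \<in> span B \<inter> span (E - D)"
    then have x: "x \<in> V" "x \<in> W" "x \<in> span (E - D)"
      using B(1) V(1) E(2) W(1) span_minimal[of B V] span_minimal[of "E - D" W] by auto
    then have "x \<in> span D" using D(4) by auto
    moreover have "span D \<inter> span (E - D) \<subseteq> {0}"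
    proof -
      have "x = 0" if x: "x \<in> span D" "x \<in> span (E - D)" for x
      proof -
        have xE: "x \<in> span E" using x(1) span_mono[OF E(1)] by blast
        have "representation E x = representation D x"
          by (rule representation_extend[OF E(3) x(1) E(1)])
        moreover have "representation E x = representation (E - D) x"
          by (rule representation_extend[OF E(3) x(2) Diff_subset])
        ultimately have "representation E x b = 0" for b
          using representation_ne_zero[of D x b] representation_ne_zero[of "E - D" x b] by auto
        then show ?thesis using sum_nonzero_representation_eq[OF E(3) xE] by simp
      qed
      then show ?thesis by blast
    qed
    ultimately show "x \<in> {0}" using x by blast
  qed
  note un = independent_Un_if_spans_meet_in_0[OF B(3) independent_mono[OF E(3), of "E - D"] this]
  have "B \<union> (E - D) \<subseteq> {x + y | x y. x \<in> V \<and> y \<in> W}"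
  proof
    fix b assume "b \<in> B \<union> (E - D)"
    then have "b = b + 0 \<and> b \<in> V \<or> b = 0 + b \<and> b \<in> W" using B(1) E(2) by auto
    then show "b \<in> {x + y | x y. x \<in> V \<and> y \<in> W}"
      using subspace_0[OF V(1)] subspace_0[OF W(1)] by blast
  qed
  moreover have "{x + y | x y. x \<in> V \<and> y \<in> W} \<subseteq> span T" using V W by (auto intro: span_add)
  ultimately have "card (B \<union> (E - D)) \<le> dim {x + y | x y. x \<in> V \<and> y \<in> W}"
    using card_le_dim T un(1) by blast
  moreover have "card (B \<union> (E - D)) = card B + (card E - card D)"
    using un(2) B(2) finE by (simp add: card_Un_disjoint card_Diff_subset D E)
  moreover have "dim W \<le> card E"
  proof -
    obtain C where "C \<subseteq> W" "independent C" "card C = dim W" using basis_exists[of W] by metis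
    then show ?thesis using independent_span_bound[of E C] finE E by auto
  qed
  ultimately show ?thesis using B D by linarith
qed

lemma dim_le_image:
  assumes V: "V \<subseteq> span T" "finite T" and f: "\<And>x y. f (x + y) = f x + f y" "\<And>c x. f (scale c x) = scale c (f x)"
    and inj: "inj f" and im: "f ` V \<subseteq> span T'" "finite T'"
  shows "dim V \<le> dim (f ` V)"
proof -
  obtain B where B: "B \<subseteq> V" "finite B" "independent B" "card B = dim V"
    using finite_basis_exists[OF V] by metis
  have f0: "f 0 = 0" using f(2)[of 0 0] by simp
  have fsum: "f (sum g A) = (\<Sum>a\<in>A. f (g a))" for g :: "'b \<Rightarrow> 'b" and A
    by (induction A rule: infinite_finite_induct) (simp_all add: f0 f)
  have "independent (f ` B)"
  proof (rule independent_if_scalars_zero)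
    fix u x assume u: "(\<Sum>x\<in>f ` B. scale (u x) x) = 0" and "x \<in> f ` B"
    then obtain b where b: "x = f b" "b \<in> B" by blast
    have "f (\<Sum>b\<in>B. scale (u (f b)) b) = (\<Sum>b\<in>B. scale (u (f b)) (f b))" by (simp add: fsum f)
    also have "\<dots> = 0" using u inj by (subst (asm) sum.reindex) (auto intro: inj_on_subset)
    finally have "(\<Sum>b\<in>B. scale (u (f b)) b) = 0" using f0 inj by (metis injD)
    then show "u x = 0" using independentD[OF B(3,2), of "\<lambda>b. u (f b)" b] b by auto
  qed (use B in auto)
  then have "card (f ` B) \<le> dim (f ` V)" using card_le_dim[OF im] B(1) by (metis image_mono)
  moreover have "card (f ` B) = card B" using inj by (metis card_image inj_on_subset subset_UNIV)
  ultimately show ?thesis using B by simp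
qed

end

section \<open>Laurent polynomials with prescribed support\<close>

definition supported :: "(int \<times> int) set \<Rightarrow> 'k::field laurent set" where
  "supported S = {f. supp f \<subseteq> S}"

lemma supported_subspace: "laurent.subspace (supported S :: 'k::field laurent set)"
proof (rule laurent.subspaceI)
  fix x y :: "'k laurent" assume "x \<in> supported S" "y \<in> supported S"
  then show "x + y \<in> supported S" using keys_add[of x y] by (auto simp: supported_def)
next
  fix c and x :: "'k laurent" assume "x \<in> supported S"
  then show "laurent_scale c x \<in> supported S"
    by (cases "c = 0") (auto simp: supported_def)
qed (simp add: supported_def)

lemma span_monoms: "laurent.span (laurent_monom ` S) = (supported S :: 'k::field laurent set)"
proof
  show "laurent.span (laurent_monom ` S) \<subseteq> (supported S :: 'k laurent set)"
    by (rule laurent.span_minimal[OF _ supported_subspace]) (auto simp: supported_def)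
  show "(supported S :: 'k laurent set) \<subseteq> laurent.span (laurent_monom ` S)"
  proof
    fix f :: "'k laurent" assume f: "f \<in> supported S"
    have "laurent_scale (coef f m) (laurent_monom m) \<in> laurent.span (laurent_monom ` S)"
      if "m \<in> supp f" for m
      using f that by (intro laurent.span_scale laurent.span_base imageI) (auto simp: supported_def)
    then have "(\<Sum>m\<in>supp f. laurent_scale (coef f m) (laurent_monom m)) \<in> laurent.span (laurent_monom ` S)"
      by (rule laurent.span_sum)
    then show "f \<in> laurent.span (laurent_monom ` S)"
      by (simp only: sum_terms flip: term_eq_scale_monom)
  qed
qed

lemma inj_monom: "inj (laurent_monom :: _ \<Rightarrow> 'k::field laurent)"
  by (rule injI) (metis supp_monom singleton_inject)

lemma independent_monoms:
  assumes S: "finite S"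
  shows "laurent.independent (laurent_monom ` S :: 'k::field laurent set)"
proof (rule laurent.independent_if_scalars_zero)
  fix u :: "'k laurent \<Rightarrow> 'k" and x :: "'k laurent"
  assume u: "(\<Sum>x\<in>laurent_monom ` S. laurent_scale (u x) x) = 0" and "x \<in> laurent_monom ` S"
  then obtain m where m: "x = laurent_monom m" "m \<in> S" by blast
  have "(\<Sum>n\<in>S. laurent_scale (u (laurent_monom n)) (laurent_monom n)) = 0"
    using u by (subst (asm) sum.reindex) (auto intro: inj_on_subset[OF inj_monom])
  then have "coef (\<Sum>n\<in>S. laurent_scale (u (laurent_monom n)) (laurent_monom n)) m = 0" by simp
  moreover have "coef (\<Sum>n\<in>S. laurent_scale (u (laurent_monom n)) (laurent_monom n)) m =
     (\<Sum>n\<in>S. if m = n then u (laurent_monom n) else 0)"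
    by (simp add: lookup_sum coef_monom if_distrib cong: if_cong)
  ultimately show "u x = 0" using S m by simp
qed (use S in simp)

lemma dim_supported: "finite S \<Longrightarrow> laurent.dim (supported S :: 'k::field laurent set) = card S"
proof -
  assume S: "finite S"
  have "laurent.dim (supported S :: 'k laurent set) = card (laurent_monom ` S :: 'k laurent set)"
    by (rule laurent.dim_eq_card[OF _ independent_monoms[OF S]])
       (simp only: span_monoms laurent.span_eq_iff[THEN iffD2, OF supported_subspace])
  also have "\<dots> = card S" by (rule card_image) (auto intro: inj_on_subset[OF inj_monom])
  finally show ?thesis .
qed

lemma pow_p_laurent_subspace: "laurent.subspace (pow_p n)"
  by (rule laurent.subspaceI) (simp_all add: pow_p_0 pow_p_add pow_p_scale)

lemma card_pairs_below: "card {(i, j). i + j < (n::nat)} = n * (n + 1) div 2"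
proof (induction n)
  case (Suc n)
  have "{(i, j). i + j < Suc n} = {(i, j). i + j < n} \<union> (\<lambda>i. (i, n - i)) ` {..n}"
    by (auto simp: image_iff)
  moreover have "card ((\<lambda>i. (i, n - i)) ` {..n}) = Suc n"
    by (subst card_image) (auto intro: inj_onI)
  moreover have "{(i, j). i + j < n} \<inter> (\<lambda>i. (i, n - i)) ` {..n} = {}" by auto
  ultimately have "card {(i, j). i + j < Suc n} = n * (n + 1) div 2 + Suc n"
    by (simp add: card_Un_disjoint Suc)
  then show ?case by simp
qed simp

text \<open>
  Vanishing to order \<open>n\<close> is expressed by the \<open>n (n + 1) / 2\<close> Taylor coefficients of degree below
  \<open>n\<close>, each of which is one linear condition.
\<close>

lemma dim_supported_pow_p:
  assumes "finite S"
  shows "card S \<le> laurent.dim (supported S \<inter> pow_p n :: 'k::field laurent set) + n * (n + 1) div 2"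
proof -
  have le: "laurent.dim (supported S :: 'k laurent set) \<le>
      laurent.dim (supported S \<inter> {f :: 'k laurent. \<forall>p\<in>{(i, j). i + j < n}. taylor (fst p) (snd p) f = 0}) +
      card {(i, j). i + j < n}"
    by (rule laurent.dim_le_Int_kernels[OF supported_subspace, where T = "laurent_monom ` S"
          and l = "\<lambda>p. taylor (fst p) (snd p)"])
       (use assms in \<open>simp_all add: span_monoms taylor_add taylor_scale\<close>)
  have eq: "{f :: 'k laurent. \<forall>p\<in>{(i, j). i + j < n}. taylor (fst p) (snd p) f = 0} = (pow_p n :: 'k laurent set)"
    unfolding Set.set_eq_iff mem_Collect_eq pow_p_iff_taylor by auto
  show ?thesis using le unfolding eq dim_supported[OF assms] card_pairs_below .
qed

section \<open>Descent to a subfield\<close>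

text \<open>
  Gaussian elimination stays inside the field generated by the coefficients: one unknown is
  eliminated with the help of an equation in which it occurs.
\<close>

lemma solve_in_subfield:
  assumes K: "is_subfield K" and "finite J"
    and "\<And>i j. i \<in> I \<Longrightarrow> j \<in> J \<Longrightarrow> a i j \<in> K" "\<And>i. i \<in> I \<Longrightarrow> b i \<in> K"
    and "\<And>i. i \<in> I \<Longrightarrow> (\<Sum>j\<in>J. a i j * x j) = (b i :: 'k::field)"
  shows "\<exists>y. (\<forall>j\<in>J. y j \<in> K) \<and> (\<forall>i\<in>I. (\<Sum>j\<in>J. a i j * y j) = b i)"
  using assms(2-)
proof (induction J arbitrary: a b rule: finite_induct)
  case (insert k J)
  have K0: "0 \<in> K" and Kadd: "\<And>x y. x \<in> K \<Longrightarrow> y \<in> K \<Longrightarrow> x + y \<in> K"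
    and Kmult: "\<And>x y. x \<in> K \<Longrightarrow> y \<in> K \<Longrightarrow> x * y \<in> K"
    and Kneg: "\<And>x. x \<in> K \<Longrightarrow> - x \<in> K" and Kinv: "\<And>x. x \<in> K \<Longrightarrow> inverse x \<in> K"
    using K by (auto simp: is_subfield_def)
  have Kdiff: "x - y \<in> K" if "x \<in> K" "y \<in> K" for x y
    using Kadd[OF that(1) Kneg[OF that(2)]] by simp
  have Ksum: "sum f A \<in> K" if "\<And>x. x \<in> A \<Longrightarrow> f x \<in> K" for f :: "'j \<Rightarrow> 'k" and A
    using that by (induction A rule: infinite_finite_induct) (auto simp: K0 Kadd)
  show ?case
  proof (cases "\<forall>i\<in>I. a i k = 0")
    case True
    have "\<exists>y. (\<forall>j\<in>J. y j \<in> K) \<and> (\<forall>i\<in>I. (\<Sum>j\<in>J. a i j * y j) = b i)"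
      by (rule insert.IH) (use insert True in auto)
    then obtain y where y: "\<forall>j\<in>J. y j \<in> K" "\<forall>i\<in>I. (\<Sum>j\<in>J. a i j * y j) = b i" by blast
    have "(\<Sum>j\<in>J. a i j * (y(k := 0)) j) = (\<Sum>j\<in>J. a i j * y j)" for i
      by (rule sum.cong) (use insert in auto)
    then show ?thesis
      by (intro exI[of _ "y(k := 0)"]) (use insert True y K0 in auto)
  next
    case False
    then obtain p where p: "p \<in> I" "a p k \<noteq> 0" by blast
    define q where "q i = a i k * inverse (a p k)" for i
    have qK: "q i \<in> K" if "i \<in> I" for i unfolding q_def by (intro Kmult Kinv insert that p) auto
    have qp: "q i * a p k = a i k" for i using p by (simp add: q_def)
    have "\<exists>y. (\<forall>j\<in>J. y j \<in> K) \<and> (\<forall>i\<in>I. (\<Sum>j\<in>J. (a i j - q i * a p j) * y j) = b i - q i * b p)"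
    proof (rule insert.IH)
      fix i assume i: "i \<in> I"
      have e: "a i k * x k + (\<Sum>j\<in>J. a i j * x j) = b i" "a p k * x k + (\<Sum>j\<in>J. a p j * x j) = b p"
        using insert.prems(3)[OF i] insert.prems(3)[OF p(1)] insert.hyps by simp_all
      have "(\<Sum>j\<in>J. (a i j - q i * a p j) * x j) = (\<Sum>j\<in>J. a i j * x j) - q i * (\<Sum>j\<in>J. a p j * x j)"
        by (simp add: left_diff_distrib sum_subtractf sum_distrib_left mult.assoc)
      also have "\<dots> = (b i - a i k * x k) - q i * (b p - a p k * x k)"
        by (simp flip: e)
      also have "\<dots> = b i - q i * b p" by (simp add: right_diff_distrib qp flip: mult.assoc)
      finally show "(\<Sum>j\<in>J. (a i j - q i * a p j) * x j) = b i - q i * b p" .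
      show "b i - q i * b p \<in> K" by (intro Kdiff Kmult qK insert i p)
      show "a i j - q i * a p j \<in> K" if "j \<in> J" for j
        by (intro Kdiff Kmult qK insert.prems i p) (use that in auto)
    qed
    then obtain y where y: "\<forall>j\<in>J. y j \<in> K"
      "\<forall>i\<in>I. (\<Sum>j\<in>J. (a i j - q i * a p j) * y j) = b i - q i * b p" by blast
    define z where "z = (b p - (\<Sum>j\<in>J. a p j * y j)) * inverse (a p k)"
    have zK: "z \<in> K" unfolding z_def
      by (intro Kmult Kdiff Ksum Kinv insert.prems(1,2) p) (use y p in auto)
    have apz: "a p k * z = b p - (\<Sum>j\<in>J. a p j * y j)" using p by (simp add: z_def)
    have "(\<Sum>j\<in>insert k J. a i j * (y(k := z)) j) = b i" if i: "i \<in> I" for i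
    proof -
      have "(\<Sum>j\<in>insert k J. a i j * (y(k := z)) j) = a i k * z + (\<Sum>j\<in>J. a i j * (y(k := z)) j)"
        using insert.hyps by simp
      also have "(\<Sum>j\<in>J. a i j * (y(k := z)) j) = (\<Sum>j\<in>J. a i j * y j)"
        by (rule sum.cong) (use insert.hyps in auto)
      also have "a i k * z = q i * (b p - (\<Sum>j\<in>J. a p j * y j))"
        by (simp only: qp flip: apz mult.assoc)
      also have "(\<Sum>j\<in>J. a i j * y j) = (b i - q i * b p) + q i * (\<Sum>j\<in>J. a p j * y j)"
      proof -
        have "(\<Sum>j\<in>J. (a i j - q i * a p j) * y j) = (\<Sum>j\<in>J. a i j * y j) - q i * (\<Sum>j\<in>J. a p j * y j)"
          by (simp add: left_diff_distrib sum_subtractf sum_distrib_left mult.assoc)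
        moreover have "(\<Sum>j\<in>J. (a i j - q i * a p j) * y j) = b i - q i * b p" using y(2) i by blast
        ultimately show ?thesis by (metis diff_add_cancel)
      qed
      finally show ?thesis by (simp add: algebra_simps)
    qed
    then show ?thesis
      by (intro exI[of _ "y(k := z)"]) (use zK y in auto)
  qed
qed auto

lemma subfield_of_int: "is_subfield K \<Longrightarrow> of_int n \<in> K"
proof -
  assume K: "is_subfield K"
  have nat: "of_nat m \<in> K" for m using K by (induction m) (auto simp: is_subfield_def)
  show "of_int n \<in> K"
  proof (cases "n \<ge> 0")
    case True
    then show ?thesis using nat[of "nat n"] by (simp add: of_nat_nat)
  next
    case False
    then have "of_int n = - (of_nat (nat (- n)) :: 'a)" by (simp add: of_nat_nat)
    then show ?thesis using nat[of "nat (- n)"] K by (simp add: is_subfield_def)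
  qed
qed

text \<open>
  The Taylor conditions are linear equations with integer coefficients. Together with prescribed
  values of some coefficients they form a system over the subfield. The coefficients of \<open>f\<close> solve it,
  hence so do some elements of the subfield.
\<close>

lemma descend_pow_p:
  assumes K: "is_subfield K" and S: "finite S" "supp f \<subseteq> S" and f: "f \<in> pow_p n"
    and T: "T \<subseteq> S" "\<And>m. m \<in> T \<Longrightarrow> coef f m \<in> K"
  obtains g where "supp g \<subseteq> S" "g \<in> pow_p n" "\<And>m. coef g m \<in> K" "\<And>m. m \<in> T \<Longrightarrow> coef g m = coef f m"
proof -
  have K01: "0 \<in> K" "1 \<in> K" using K by (auto simp: is_subfield_def)
  define I where "I = Inl ` {(i, j). i + j < n} \<union> Inr ` T"
  define a :: "nat \<times> nat + int \<times> int \<Rightarrow> int \<times> int \<Rightarrow> 'a" where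
    "a e m = (case e of Inl (i, j) \<Rightarrow> of_int (ibinom (fst m) i * ibinom (snd m) j)
                      | Inr t \<Rightarrow> if m = t then 1 else 0)" for e m
  define b where "b e = (case e of Inl _ \<Rightarrow> 0 | Inr t \<Rightarrow> coef f t)" for e :: "nat \<times> nat + int \<times> int"
  have taylor_S: "taylor i j g = (\<Sum>m\<in>S. a (Inl (i, j)) m * coef g m)" if "supp g \<subseteq> S" for g i j
    using taylor_superset[OF S(1) that, of i j] by (simp add: a_def mult.commute)
  have coef_S: "coef g t = (\<Sum>m\<in>S. a (Inr t) m * coef g m)" if "t \<in> S" for g t
    using S(1) that by (simp add: a_def if_distrib if_distribR cong: if_cong)
  have "\<exists>y. (\<forall>m\<in>S. y m \<in> K) \<and> (\<forall>e\<in>I. (\<Sum>m\<in>S. a e m * y m) = b e)"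
  proof (rule solve_in_subfield[OF K S(1), where x = "coef f"])
    fix e assume e: "e \<in> I"
    show "a e m \<in> K" if "m \<in> S" for m
      unfolding a_def using K01 by (auto split: sum.split intro: subfield_of_int[OF K] simp del: of_int_mult)
    show "b e \<in> K" using e T(2) K01 by (auto simp: b_def I_def)
    consider i j where "e = Inl (i, j)" "i + j < n" | t where "e = Inr t" "t \<in> T"
      using e by (auto simp: I_def)
    then show "(\<Sum>m\<in>S. a e m * coef f m) = b e"
    proof cases
      case 1
      then show ?thesis using taylor_S[OF S(2), of i j] taylor_pow_p[OF f] by (simp add: b_def)
    next
      case 2
      then show ?thesis using coef_S[of t f] T(1) by (auto simp: b_def)
    qed
  qed
  then obtain y where y: "\<forall>m\<in>S. y m \<in> K" "\<forall>e\<in>I. (\<Sum>m\<in>S. a e m * y m) = b e" by blast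
  define g where "g = (\<Sum>m\<in>S. term_of m (y m))"
  have g: "coef g m = (if m \<in> S then y m else 0)" for m
    using S(1) by (simp add: g_def lookup_sum lookup_single when_def)
  have sg: "supp g \<subseteq> S" by (auto simp: in_keys_iff g split: if_splits)
  have gy: "(\<Sum>m\<in>S. a e m * coef g m) = b e" if "e \<in> I" for e
    using y(2) that by (simp add: g)
  have "taylor i j g = 0" if "i + j < n" for i j
    using gy[of "Inl (i, j)"] taylor_S[OF sg, of i j] that by (simp add: I_def b_def)
  then have "g \<in> pow_p n" by (simp add: pow_p_iff_taylor)
  moreover have "coef g m = coef f m" if "m \<in> T" for m
    using gy[of "Inr m"] coef_S[of m g] T(1) that by (auto simp: I_def b_def)
  moreover have "coef g m \<in> K" for m using y(1) K01 by (simp add: g)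
  ultimately show ?thesis using that sg by blast
qed

section \<open>Staircases\<close>

text \<open>
  The staircase has columns of \<open>1, 2, \<dots>, r\<close> consecutive points. Let \<open>i\<close> be the first column that
  meets the support and \<open>j\<close> the highest point of the support in it. Up to a shift, the Taylor
  coefficient with indices \<open>r - 1 - i\<close> and \<open>j\<close> weights the exponents by a product of two binomial
  coefficients, the first of which vanishes on the later columns, while the second vanishes on the
  points below the highest one. What remains is a single coefficient with weight \<open>1\<close> or \<open>- 1\<close>, a unit
  in every characteristic. But a Taylor coefficient of degree \<open>r - 1 - i + j < r\<close> is zero.
\<close>

lemma staircase_pow_p_eq_0:
  assumes f: "f \<in> pow_p r"
    and supp: "\<And>m. m \<in> supp f \<Longrightarrow> \<exists>i<r. \<exists>j\<le>i. m = (a + int i, b i + int j)"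
  shows "f = 0"
proof (rule ccontr)
  assume "f \<noteq> 0"
  then obtain m0 where m0: "m0 \<in> supp f" using supp_eq_empty_iff[of f] by blast
  define Q where "Q i \<longleftrightarrow> (\<exists>j\<le>i. (a + int i, b i + int j) \<in> supp f)" for i
  obtain i1 where "i1 < r" "Q i1" using supp[OF m0] m0 by (auto simp: Q_def)
  define i0 where "i0 = (LEAST i. Q i)"
  have Q0: "Q i0" and i0_le: "\<And>i. Q i \<Longrightarrow> i0 \<le> i"
    unfolding i0_def using \<open>Q i1\<close> by (auto intro: LeastI Least_le)
  have i0r: "i0 < r" using i0_le[OF \<open>Q i1\<close>] \<open>i1 < r\<close> by simp
  define d where "d j = coef f (a + int i0, b i0 + int j)" for j
  define j0 where "j0 = (GREATEST j. j \<le> i0 \<and> d j \<noteq> 0)"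
  have exj: "\<exists>j. j \<le> i0 \<and> d j \<noteq> 0" using Q0 by (auto simp: Q_def d_def in_keys_iff)
  have j0: "j0 \<le> i0" "d j0 \<noteq> 0"
    using GreatestI_ex_nat[of "\<lambda>j. j \<le> i0 \<and> d j \<noteq> 0" i0] exj by (auto simp: j0_def)
  have j0_max: "j \<le> j0" if "j \<le> i0" "d j \<noteq> 0" for j
    using Greatest_le_nat[of "\<lambda>j. j \<le> i0 \<and> d j \<noteq> 0" j i0] that by (auto simp: j0_def)
  define p where "p = r - 1 - i0"
  \<comment> \<open>the shift moves column \<open>i0\<close> to abscissa \<open>- 1\<close>, where the
    binomial coefficient is \<open>1\<close> or \<open>- 1\<close>, and the later columns to
    \<open>0, \<dots>, p - 1\<close>, where it vanishes\<close>
  define c where "c = (- (a + int i0 + 1), - b i0)"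
  define h where "h = laurent_monom c * f"
  have "h \<in> pow_p r" unfolding h_def using f by (rule pow_p_mult_left)
  then have "taylor p j0 h = 0" by (rule taylor_pow_p) (use i0r j0(1) in \<open>simp add: p_def\<close>)
  have sh: "supp h = (+) c ` supp f" by (simp add: h_def supp_monom_mult)
  have ch: "coef h (c + m) = coef f m" for m
    by (simp add: h_def laurent_monom_def coef_term_mult)
  have "taylor p j0 h = (\<Sum>m\<in>supp f. coef f m * of_int (ibinom (fst (c + m)) p * ibinom (snd (c + m)) j0))"
    unfolding taylor_def sh by (subst sum.reindex) (auto simp: ch)
  also have "\<dots> = (\<Sum>m\<in>supp f. if m = (a + int i0, b i0 + int j0) then d j0 * (- 1) ^ p else 0)"
  proof (rule sum.cong)
    fix m assume m: "m \<in> supp f"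
    obtain i j where ij: "i < r" "j \<le> i" "m = (a + int i, b i + int j)" using supp[OF m] by blast
    have "i0 \<le> i" by (rule i0_le) (use ij m in \<open>auto simp: Q_def\<close>)
    show "coef f m * of_int (ibinom (fst (c + m)) p * ibinom (snd (c + m)) j0) =
      (if m = (a + int i0, b i0 + int j0) then d j0 * (- 1) ^ p else 0)"
    proof (cases "i = i0")
      case True
      have cm: "fst (c + m) = - 1" "snd (c + m) = int j" using True by (simp_all add: c_def ij(3))
      have "ibinom (- 1) p = (- 1) ^ p" by (simp add: ibinom_def)
      moreover have "ibinom (int j) j0 = (if j = j0 then 1 else 0) \<or> d j = 0"
        using j0_max[of j] ij(2) True by (cases "j = j0") (auto simp: binomial_eq_0)
      moreover have "coef f m = d j" by (simp add: ij(3) True d_def)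
      ultimately show ?thesis unfolding cm using True ij(3) by (auto simp: binomial_eq_0)
    next
      case False
      then have "i0 < i" using \<open>i0 \<le> i\<close> by simp
      have "fst (c + m) = int (i - i0 - 1)" using \<open>i0 < i\<close> by (simp add: c_def ij(3))
      moreover have "i - i0 - 1 < p" using ij(1) \<open>i0 < i\<close> by (simp add: p_def)
      ultimately have "ibinom (fst (c + m)) p = 0" by (simp add: binomial_eq_0)
      then show ?thesis using False ij(3) by simp
    qed
  qed simp
  also have "\<dots> = d j0 * (- 1) ^ p"
    using j0(2) by (simp add: d_def in_keys_iff)
  finally show False using \<open>taylor p j0 h = 0\<close> j0(2) by simp
qed

text \<open>
  A staircase whose columns start at the same height. It has as many points as there are
  conditions for vanishing to order \<open>n\<close>, and these are independent on it.
\<close>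

definition triangle :: "int \<times> int \<Rightarrow> nat \<Rightarrow> (int \<times> int) set" where
  "triangle z n = (\<lambda>(i, j). z + (int (i + j), int j)) ` {(i, j). i + j < n}"

lemma finite_triangle [simp]: "finite (triangle z n)"
  by (simp add: triangle_def)

lemma card_triangle: "card (triangle z n) = n * (n + 1) div 2"
  unfolding triangle_def by (subst card_image) (auto simp: card_pairs_below intro!: inj_onI)

lemma triangle_pow_p_eq_0: "f \<in> supported (triangle z n) \<Longrightarrow> f \<in> pow_p n \<Longrightarrow> f = 0"
proof (rule staircase_pow_p_eq_0[of f n "fst z" "\<lambda>_. snd z"])
  fix m assume "f \<in> supported (triangle z n)" "m \<in> supp f"
  then have "m \<in> triangle z n" by (auto simp: supported_def)
  then obtain i j where ij: "i + j < n" "m = z + (int (i + j), int j)" by (auto simp: triangle_def)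
  show "\<exists>i<n. \<exists>j\<le>i. m = (fst z + int i, snd z + int j)"
    by (rule exI[of _ "i + j"], intro conjI exI[of _ j]) (use ij in \<open>auto simp: prod_eq_iff\<close>)
qed

section \<open>The Koszul estimate\<close>

text \<open>
  Let \<open>V\<close> be the space of elements of order \<open>N\<close> supported in \<open>S'\<close>; its dimension is at least
  \<open>|S'| - N (N + 1) / 2\<close>. The only relations between \<open>f\<close> and \<open>g\<close> are the Koszul relations, so
  \<open>f V \<inter> g V\<close> has dimension at most \<open>|S''|\<close>. The elements of \<open>f V + g V\<close> have order \<open>2 N\<close>, so this
  space meets that of the elements supported in the triangle of size \<open>2 N\<close>, of dimension
  \<open>N (2 N + 1)\<close>, only in \<open>0\<close>. Both are contained in the space of dimension \<open>|S|\<close>, and the terms linear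
  in \<open>N\<close> cancel.
\<close>

lemma koszul_dimension_estimate:
  fixes f g :: "'k::field laurent"
  assumes f: "f \<in> pow_p N" "f \<noteq> 0" and g: "g \<in> pow_p N" "g \<noteq> 0"
    and fin: "finite S" "finite S'" "finite S''"
    and fS: "\<And>a. a \<in> supported S' \<Longrightarrow> f * a \<in> supported S"
    and gS: "\<And>a. a \<in> supported S' \<Longrightarrow> g * a \<in> supported S"
    and rel: "\<And>a b. a \<in> supported S' \<Longrightarrow> b \<in> supported S' \<Longrightarrow> f * a = g * b \<Longrightarrow>
                \<exists>c\<in>supported S''. a = g * c"
    and T: "triangle z (2 * N) \<subseteq> S"
  shows "N ^ 2 + 2 * card S' \<le> card S + card S''"
proof -
  let ?V = "supported S :: 'k laurent set"
  let ?T = "supported (triangle z (2 * N)) :: 'k laurent set"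
  define V0 where "V0 = (supported S' \<inter> pow_p N :: 'k laurent set)"
  define U where "U = (\<lambda>a. f * a) ` V0"
  define W where "W = (\<lambda>a. g * a) ` V0"
  have span: "?V \<subseteq> laurent.span (laurent_monom ` S)" "supported S' \<subseteq> laurent.span (laurent_monom ` S' :: 'k laurent set)"
    by (simp_all only: span_monoms order_refl)
  have V0: "laurent.subspace V0"
    unfolding V0_def by (intro laurent.subspace_inter supported_subspace pow_p_laurent_subspace)
  have image: "laurent.subspace ((\<lambda>a. h * a) ` V0)" for h
  proof (rule laurent.subspaceI)
    show "0 \<in> (\<lambda>a. h * a) ` V0" using laurent.subspace_0[OF V0] by force
    show "x + y \<in> (\<lambda>a. h * a) ` V0" if "x \<in> (\<lambda>a. h * a) ` V0" "y \<in> (\<lambda>a. h * a) ` V0" for x y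
      using that laurent.subspace_add[OF V0] by (auto simp flip: distrib_left)
    show "laurent_scale c x \<in> (\<lambda>a. h * a) ` V0" if "x \<in> (\<lambda>a. h * a) ` V0" for x c
      using that laurent.subspace_scale[OF V0] by (auto simp flip: scale_mult_right)
  qed
  have US: "U \<subseteq> ?V" "W \<subseteq> ?V" using fS gS by (auto simp: U_def W_def V0_def)
  have dV0: "card S' \<le> laurent.dim V0 + N * (N + 1) div 2"
    unfolding V0_def by (rule dim_supported_pow_p) (rule fin)
  have inj: "inj (\<lambda>a. h * a)" if "h \<noteq> 0" for h :: "'k laurent"
    using that by (auto intro: injI simp: laurent_mult_cancel)
  have fin': "finite (laurent_monom ` S :: 'k laurent set)" "finite (laurent_monom ` S' :: 'k laurent set)"
    using fin by auto
  have V0S: "V0 \<subseteq> laurent.span (laurent_monom ` S')" using span(2) by (auto simp: V0_def)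
  have dU: "laurent.dim V0 \<le> laurent.dim U"
    unfolding U_def
    by (rule laurent.dim_le_image[OF V0S fin'(2) _ _ inj[OF f(2)] subset_trans[OF US(1) span(1), unfolded U_def] fin'(1)])
       (simp_all only: distrib_left scale_mult_right)
  have dW: "laurent.dim V0 \<le> laurent.dim W"
    unfolding W_def
    by (rule laurent.dim_le_image[OF V0S fin'(2) _ _ inj[OF g(2)] subset_trans[OF US(2) span(1), unfolded W_def] fin'(1)])
       (simp_all only: distrib_left scale_mult_right)
  let ?UW = "{x + y | x y. x \<in> U \<and> y \<in> W}"
  have d1: "laurent.dim U + laurent.dim W \<le> laurent.dim ?UW + laurent.dim (U \<inter> W)"
    by (rule laurent.dim_add_le_sum_Int[of U "laurent_monom ` S" W])
       (use image US span fin' in \<open>auto simp: U_def W_def\<close>)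
  have d2: "laurent.dim (U \<inter> W) \<le> card S''"
  proof -
    have "U \<inter> W \<subseteq> laurent.span ((\<lambda>m. f * g * laurent_monom m) ` S'')"
    proof
      fix x assume "x \<in> U \<inter> W"
      then obtain a b where ab: "x = f * a" "x = g * b" "a \<in> V0" "b \<in> V0"
        unfolding U_def W_def by blast
      then obtain c where c: "c \<in> supported S''" "a = g * c" using rel[of a b] by (auto simp: V0_def)
      have "x = f * g * (\<Sum>m\<in>supp c. laurent_scale (coef c m) (laurent_monom m))"
        by (simp only: ab(1) c(2) sum_terms mult.assoc flip: term_eq_scale_monom)
      also have "\<dots> = (\<Sum>m\<in>supp c. laurent_scale (coef c m) (f * g * laurent_monom m))"
        by (simp only: sum_distrib_left scale_mult_right)
      also have "\<dots> \<in> laurent.span ((\<lambda>m. f * g * laurent_monom m) ` S'')"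
        using c(1) by (intro laurent.span_sum laurent.span_scale laurent.span_base) (auto simp: supported_def)
      finally show "x \<in> laurent.span ((\<lambda>m. f * g * laurent_monom m) ` S'')" .
    qed
    then have "laurent.dim (U \<inter> W) \<le> card ((\<lambda>m. f * g * laurent_monom m) ` S'')"
      by (rule laurent.dim_le_card) (use fin in auto)
    also have "\<dots> \<le> card S''" by (rule card_image_le) (rule fin)
    finally show ?thesis .
  qed
  have UW: "laurent.subspace ?UW"
  proof -
    have "?UW = {x + y | x y. x \<in> laurent.span U \<and> y \<in> laurent.span W}"
      using image by (simp add: U_def W_def laurent.span_eq_iff[THEN iffD2])
    then show ?thesis by (simp only: laurent.subspace_span flip: laurent.span_Un)
  qed
  have UWS: "?UW \<subseteq> ?V" using US laurent.subspace_add[OF supported_subspace] by blast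
  have "?UW \<inter> ?T \<subseteq> {0}"
  proof
    fix x assume x: "x \<in> ?UW \<inter> ?T"
    then obtain a b where ab: "x = f * a + g * b" "a \<in> V0" "b \<in> V0" by (auto simp: U_def W_def)
    then have "x \<in> pow_p (2 * N)"
      using pow_p_mult[OF f(1), of a N] pow_p_mult[OF g(1), of b N]
      by (simp add: V0_def pow_p_add mult_2)
    then show "x \<in> {0}" using triangle_pow_p_eq_0 x by blast
  qed
  then have d3: "laurent.dim (?UW \<inter> ?T) = 0"
    using laurent.dim_le_card[of "?UW \<inter> ?T" "{}"] by simp
  have TV: "?T \<subseteq> ?V" using T by (auto simp: supported_def)
  have "laurent.dim ?UW + laurent.dim ?T \<le>
      laurent.dim {x + y | x y. x \<in> ?UW \<and> y \<in> ?T} + laurent.dim (?UW \<inter> ?T)"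
    by (rule laurent.dim_add_le_sum_Int[OF UW _ supported_subspace, of "laurent_monom ` S"])
       (use UWS TV span fin' in auto)
  also have "laurent.dim {x + y | x y. x \<in> ?UW \<and> y \<in> ?T} \<le> laurent.dim ?V"
    by (rule laurent.dim_mono_finite[OF span(1) fin'(1)])
       (use UWS TV laurent.subspace_add[OF supported_subspace] in blast)
  finally have d4: "laurent.dim ?UW + N * (2 * N + 1) \<le> card S"
    using fin by (simp add: d3 dim_supported card_triangle mult.assoc)
  have "2 * (N * (N + 1) div 2) = N * (N + 1)" by simp
  then show ?thesis using dV0 dU dW d1 d2 d4 by (simp add: power2_eq_square algebra_simps)
qed

section \<open>Counting lattice points\<close>

definition dilate :: "nat \<Rightarrow> (real \<times> real) set \<Rightarrow> (real \<times> real) set" where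
  "dilate n P = (\<lambda>x. real n *\<^sub>R x) ` P"

definition lattice_in :: "(real \<times> real) set \<Rightarrow> (int \<times> int) set" where
  "lattice_in P = {m. lattice_point m \<in> P}"

lemma lattice_point_add: "lattice_point (a + b) = lattice_point a + lattice_point b"
  by (simp add: lattice_point_def)

lemma lattice_point_diff: "lattice_point (a - b) = lattice_point a - lattice_point b"
  by (simp add: lattice_point_def)

lemma finite_lattice_in:
  assumes "bounded P"
  shows "finite (lattice_in P)"
proof -
  obtain B where B: "\<And>x. x \<in> P \<Longrightarrow> norm x \<le> B" using assms by (auto simp: bounded_iff)
  have "lattice_in P \<subseteq> {- \<lceil>B\<rceil>..\<lceil>B\<rceil>} \<times> {- \<lceil>B\<rceil>..\<lceil>B\<rceil>}"
  proof
    fix m assume "m \<in> lattice_in P"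
    then have "norm (lattice_point m) \<le> B" by (auto simp: lattice_in_def intro: B)
    then have "\<bar>real_of_int (fst m)\<bar> \<le> B" "\<bar>real_of_int (snd m)\<bar> \<le> B"
      using norm_fst_le[of "fst (lattice_point m)" "snd (lattice_point m)"]
        norm_snd_le[of "snd (lattice_point m)" "fst (lattice_point m)"]
      by (simp_all add: lattice_point_def)
    then show "m \<in> {- \<lceil>B\<rceil>..\<lceil>B\<rceil>} \<times> {- \<lceil>B\<rceil>..\<lceil>B\<rceil>}"
      by (cases m) (auto simp: abs_le_iff, linarith+)
  qed
  then show ?thesis by (rule finite_subset) simp
qed

lemma dilate_props:
  assumes "convex P" "compact P"
  shows "convex (dilate n P)" "compact (dilate n P)" "bounded (dilate n P)" "closed (dilate n P)"
proof -
  show "convex (dilate n P)" and c: "compact (dilate n P)"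
    unfolding dilate_def using assms convex_scaling compact_scaling by auto
  show "bounded (dilate n P)" "closed (dilate n P)"
    using c by (auto intro: compact_imp_bounded compact_imp_closed)
qed

text \<open>
  The count divided by \<open>n\<^sup>2\<close> is the integral of the indicator function evaluated at the lower left
  corner of the mesh cell of width \<open>1 / n\<close> that contains a given point. This converges pointwise away
  from the boundary, which has measure \<open>0\<close> by convexity, and dominated convergence applies.
\<close>

lemma area_eq_limit_of_lattice_count:
  assumes P: "convex P" "compact P"
  shows "(\<lambda>n. real (card (lattice_in (dilate n P))) / real n ^ 2) \<longlonglongrightarrow> measure lebesgue P"
proof -
  define cell where "cell n x = (real_of_int \<lfloor>real n * fst x\<rfloor> / real n, real_of_int \<lfloor>real n * snd x\<rfloor> / real n)"
    for n :: nat and x :: "real \<times> real"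
  define box where "box n m = {real_of_int (fst m) / real n ..< real_of_int (fst m + 1) / real n} \<times>
      {real_of_int (snd m) / real n ..< real_of_int (snd m + 1) / real n}" for n :: nat and m :: "int \<times> int"
  have closed: "closed P" using P by (simp add: compact_imp_closed)
  have fin: "finite (lattice_in (dilate n P))" for n
    using P by (intro finite_lattice_in dilate_props)
  have box_iff: "x \<in> box n m \<longleftrightarrow> m = (\<lfloor>real n * fst x\<rfloor>, \<lfloor>real n * snd x\<rfloor>)" if "n > 0" for n x m
    using that unfolding box_def by (cases m; cases x) (auto simp: field_simps; linarith)
  have cell: "indicator P (cell n x) = (\<Sum>m\<in>lattice_in (dilate n P). indicat_real (box n m) x)"
    if n: "n > 0" for n x
  proof -
    let ?m = "(\<lfloor>real n * fst x\<rfloor>, \<lfloor>real n * snd x\<rfloor>)"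
    have "(\<Sum>m\<in>lattice_in (dilate n P). indicat_real (box n m) x) =
      (\<Sum>m\<in>lattice_in (dilate n P). if m = ?m then 1 else 0)"
      by (rule sum.cong) (auto simp: box_iff[OF n] indicator_def)
    also have "\<dots> = (if ?m \<in> lattice_in (dilate n P) then 1 else 0)" using fin by simp
    also have "?m \<in> lattice_in (dilate n P) \<longleftrightarrow> cell n x \<in> P"
    proof -
      have "lattice_point ?m = real n *\<^sub>R cell n x" using n by (simp add: lattice_point_def cell_def)
      moreover have "real n *\<^sub>R cell n x \<in> (\<lambda>x. real n *\<^sub>R x) ` P \<longleftrightarrow> cell n x \<in> P"
        using n by (intro inj_image_mem_iff injI) simp
      ultimately show ?thesis by (simp add: lattice_in_def dilate_def)
    qed
    finally show ?thesis by (simp add: indicator_def)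
  qed
  have box_sets: "box n m \<in> sets (lborel :: (real \<times> real) measure)" for n m
  proof -
    have "box n m \<in> sets (borel \<Otimes>\<^sub>M borel)" unfolding box_def by (rule pair_measureI) simp_all
    then show ?thesis by (simp only: borel_prod sets_lborel)
  qed
  have box_emeasure: "emeasure lborel (box n m) = ennreal (1 / real n ^ 2)" if "n > 0" for n m
  proof -
    have "emeasure lborel (box n m) = emeasure (lborel \<Otimes>\<^sub>M lborel) (box n m)" by (simp add: lborel_prod)
    also have "\<dots> = ennreal (1 / real n) * ennreal (1 / real n)"
      unfolding box_def using that
      by (subst lborel.emeasure_pair_measure_Times) (auto simp: field_simps)
    also have "\<dots> = ennreal (1 / real n ^ 2)"
      by (simp add: power2_eq_square flip: ennreal_mult)
    finally show ?thesis .
  qed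
  have integral: "integral\<^sup>L lborel (\<lambda>x. indicat_real P (cell n x)) = real (card (lattice_in (dilate n P))) / real n ^ 2"
    if n: "n > 0" for n
  proof -
    have "integral\<^sup>L lborel (\<lambda>x. indicat_real P (cell n x)) =
      (\<Sum>m\<in>lattice_in (dilate n P). measure lborel (box n m))"
      unfolding cell[OF n] using box_sets box_emeasure[OF n]
      by (subst Bochner_Integration.integral_sum) (auto simp: integrable_indicator_iff)
    then show ?thesis using box_emeasure[OF n] by (simp add: measure_def)
  qed
  obtain B where B: "\<And>x. x \<in> P \<Longrightarrow> norm x \<le> B" using compact_imp_bounded[OF P(2)] by (auto simp: bounded_iff)
  have cell_dist: "norm (x - cell n x) \<le> 2 / real n" if n: "n > 0" for n x
  proof -
    have *: "\<bar>t - real_of_int \<lfloor>real n * t\<rfloor> / real n\<bar> \<le> 1 / real n" for t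
    proof -
      have "\<bar>real n * t - real_of_int \<lfloor>real n * t\<rfloor>\<bar> \<le> 1" by linarith
      then have "\<bar>real n * t - real_of_int \<lfloor>real n * t\<rfloor>\<bar> / real n \<le> 1 / real n" using n by (simp add: divide_right_mono)
      moreover have "t - real_of_int \<lfloor>real n * t\<rfloor> / real n = (real n * t - real_of_int \<lfloor>real n * t\<rfloor>) / real n"
        using n by (simp add: field_simps)
      ultimately show ?thesis by simp
    qed
    have "norm (x - cell n x) \<le> norm (fst (x - cell n x)) + norm (snd (x - cell n x))"
      by (rule norm_Pair_le[of "fst (x - cell n x)" "snd (x - cell n x)", unfolded prod.collapse])
    also have "\<dots> \<le> 1 / real n + 1 / real n" using * by (intro add_mono) (simp_all add: cell_def)
    finally show ?thesis by simp
  qed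
  have cell_lim: "(\<lambda>n. cell (Suc n) x) \<longlonglongrightarrow> x" for x
  proof -
    have "(\<lambda>n. 2 / real (Suc n)) \<longlonglongrightarrow> 0"
      by (rule tendsto_divide_0[OF tendsto_const]) (rule filterlim_at_top_imp_at_infinity, rule filterlim_compose[OF filterlim_real_sequentially filterlim_Suc])
    then have "(\<lambda>n. x - cell (Suc n) x) \<longlonglongrightarrow> 0"
      by (rule Lim_null_comparison[rotated]) (intro always_eventually allI cell_dist zero_less_Suc)
    then have "(\<lambda>n. x - (x - cell (Suc n) x)) \<longlonglongrightarrow> x - 0" by (intro tendsto_diff tendsto_const)
    then show ?thesis by simp
  qed
  have "(\<lambda>n. integral\<^sup>L lborel (\<lambda>x. indicat_real P (cell (Suc n) x))) \<longlonglongrightarrow> integral\<^sup>L lborel (indicat_real P)"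
  proof (rule integral_dominated_convergence[where w = "indicat_real (cball 0 (B + 2))"])
    show "indicat_real P \<in> borel_measurable lborel" using closed by simp
    show "(\<lambda>x. indicat_real P (cell (Suc n) x)) \<in> borel_measurable lborel" for n
      unfolding cell[OF zero_less_Suc] using box_sets by simp
    show "integrable lborel (indicat_real (cball (0 :: real \<times> real) (B + 2)))"
      using emeasure_bounded_finite[of "cball (0 :: real \<times> real) (B + 2)"]
      by (simp add: integrable_indicator_iff)
    show "AE x in lborel. norm (indicat_real P (cell (Suc n) x)) \<le> indicat_real (cball 0 (B + 2)) x" for n
    proof (rule AE_I2)
      fix x
      have "norm x \<le> B + 2" if "cell (Suc n) x \<in> P"
      proof -
        have "norm x \<le> norm (cell (Suc n) x) + norm (x - cell (Suc n) x)" by (metis norm_triangle_sub)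
        also have "\<dots> \<le> B + 2 / real (Suc n)" by (intro add_mono B that cell_dist) simp
        also have "\<dots> \<le> B + 2" by (simp add: field_simps)
        finally show ?thesis .
      qed
      then show "norm (indicat_real P (cell (Suc n) x)) \<le> indicat_real (cball 0 (B + 2)) x"
        by (auto simp: indicator_def)
    qed
    have "negligible (frontier P)" using P(1) by (rule negligible_convex_frontier)
    then have "frontier P \<in> null_sets lborel"
      using null_sets_completion_iff[of "frontier P" lborel] borel_closed[OF frontier_closed[of P]]
      by (simp only: negligible_iff_null_sets sets_lborel)
    then show "AE x in lborel. (\<lambda>n. indicat_real P (cell (Suc n) x)) \<longlonglongrightarrow> indicat_real P x"
    proof (rule AE_I')
      show "{x \<in> space lborel. \<not> (\<lambda>n. indicat_real P (cell (Suc n) x)) \<longlonglongrightarrow> indicat_real P x} \<subseteq> frontier P"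
      proof clarify
        fix x assume nl: "\<not> (\<lambda>n. indicat_real P (cell (Suc n) x)) \<longlonglongrightarrow> indicat_real P x"
        show "x \<in> frontier P"
        proof (rule ccontr)
          assume "x \<notin> frontier P"
          then consider "x \<in> interior P" | "x \<in> - P"
            using closed by (auto simp: frontier_def)
          then have "\<forall>\<^sub>F n in sequentially. indicat_real P (cell (Suc n) x) = indicat_real P x"
          proof cases
            case 1
            then have "\<forall>\<^sub>F n in sequentially. cell (Suc n) x \<in> interior P"
              using topological_tendstoD[OF cell_lim open_interior] by blast
            then show ?thesis
              by (rule eventually_mono) (use 1 interior_subset[of P] in \<open>auto simp: indicator_def\<close>)
          next
            case 2
            then have "\<forall>\<^sub>F n in sequentially. cell (Suc n) x \<in> - P"
              using topological_tendstoD[OF cell_lim, of "- P"] closed by (simp add: open_Compl)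
            then show ?thesis
              by (rule eventually_mono) (use 2 in \<open>auto simp: indicator_def\<close>)
          qed
          from tendsto_eventually[OF this] show False using nl by contradiction
        qed
      qed
    qed
  qed
  moreover have "integral\<^sup>L lborel (indicat_real P) = measure lebesgue P"
    using closed by (simp add: measure_completion)
  ultimately have "(\<lambda>n. real (card (lattice_in (dilate (Suc n) P))) / real (Suc n) ^ 2) \<longlonglongrightarrow> measure lebesgue P"
    by (simp only: integral[OF zero_less_Suc])
  then show ?thesis
    by (rule filterlim_sequentially_Suc[THEN iffD1])
qed

section \<open>Newton polygons\<close>

lemma newton_lattice_points_eq: "newton_lattice_points f = lattice_in (newton_polygon f)"
  by (simp add: newton_lattice_points_def lattice_in_def)

lemma newton_polygon_props:
  "convex (newton_polygon f)" "compact (newton_polygon f)" "closed (newton_polygon f)" "bounded (newton_polygon f)"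
proof -
  show "convex (newton_polygon f)" and c: "compact (newton_polygon f)"
    by (simp_all add: newton_polygon_def convex_convex_hull finite_imp_compact compact_convex_hull)
  show "closed (newton_polygon f)" "bounded (newton_polygon f)"
    using c by (simp_all add: compact_imp_closed compact_imp_bounded)
qed

lemma finite_newton_lattice_points: "finite (newton_lattice_points f)"
  unfolding newton_lattice_points_eq by (intro finite_lattice_in newton_polygon_props)

lemma supp_subset_newton: "supp f \<subseteq> newton_lattice_points f"
  by (auto simp: newton_lattice_points_def newton_polygon_def intro: hull_inc)

lemma newton_polygon_minimal:
  "convex P \<Longrightarrow> lattice_point ` supp f \<subseteq> P \<Longrightarrow> newton_polygon f \<subseteq> P"
  unfolding newton_polygon_def by (simp add: hull_minimal)

lemma additive_inner: "additive_on_lattice (\<lambda>m. - (a \<bullet> lattice_point m))"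
  by (simp add: additive_on_lattice_def lattice_point_add inner_add_right)

lemma newton_polygon_halfspace:
  assumes "\<And>m. m \<in> supp f \<Longrightarrow> a \<bullet> lattice_point k \<le> a \<bullet> lattice_point m" "x \<in> newton_polygon f"
  shows "a \<bullet> lattice_point k \<le> a \<bullet> x"
proof -
  have "newton_polygon f \<subseteq> {x. a \<bullet> x \<ge> a \<bullet> lattice_point k}"
    by (rule newton_polygon_minimal) (use assms in \<open>auto simp: convex_halfspace_ge\<close>)
  then show ?thesis using assms by auto
qed

lemma zero_in_dilate_0: "P \<noteq> {} \<Longrightarrow> 0 \<in> dilate 0 P"
  by (auto simp: dilate_def)

lemma dilate_1: "dilate (Suc 0) P = P"
  by (simp add: dilate_def)

text \<open>
  Cancellation for Minkowski sums, on the level of supports: a point of the support of \<open>c\<close> outside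
  of \<open>t P\<close> is separated from it by a functional, for which the extremal terms of \<open>f\<close> and \<open>c\<close>
  give a term of \<open>f c\<close> outside of \<open>(t + 1) P\<close>.
\<close>

lemma supp_cancel_newton:
  assumes f: "f \<noteq> 0" and fc: "supp (f * c) \<subseteq> lattice_in (dilate (Suc t) (newton_polygon f))"
  shows "supp c \<subseteq> lattice_in (dilate t (newton_polygon f))"
proof
  fix m assume m: "m \<in> supp c"
  let ?P = "newton_polygon f"
  show "m \<in> lattice_in (dilate t ?P)"
  proof (rule ccontr)
    assume "m \<notin> lattice_in (dilate t ?P)"
    then obtain a b where ab: "a \<bullet> lattice_point m < b" "\<And>x. x \<in> dilate t ?P \<Longrightarrow> b < a \<bullet> x"
      using separating_hyperplane_closed_point[of "dilate t ?P" "lattice_point m"]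
        dilate_props[OF newton_polygon_props(1,2)[of f], of t] by (auto simp: lattice_in_def)
    have "c \<noteq> 0" using m by auto
    then obtain k l where kl: "k \<in> supp f" "l \<in> supp c" "k + l \<in> supp (f * c)"
      "\<And>x. x \<in> supp f \<Longrightarrow> - (a \<bullet> lattice_point x) \<le> - (a \<bullet> lattice_point k)"
      "\<And>x. x \<in> supp c \<Longrightarrow> - (a \<bullet> lattice_point x) \<le> - (a \<bullet> lattice_point l)"
      using support_function_mult[OF additive_inner[of a] f] by metis
    have "lattice_point (k + l) \<in> dilate (Suc t) ?P" using fc kl(3) by (auto simp: lattice_in_def)
    then obtain x where x: "x \<in> ?P" "lattice_point k + lattice_point l = real (Suc t) *\<^sub>R x"
      by (auto simp: dilate_def lattice_point_add)
    have "a \<bullet> lattice_point k + a \<bullet> lattice_point l = a \<bullet> (real (Suc t) *\<^sub>R x)"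
      by (simp only: flip: x(2) inner_add_right)
    also have "\<dots> = a \<bullet> (real t *\<^sub>R x) + a \<bullet> x" by (simp add: algebra_simps)
    finally have "a \<bullet> lattice_point k + a \<bullet> lattice_point l = a \<bullet> (real t *\<^sub>R x) + a \<bullet> x" .
    moreover have "a \<bullet> lattice_point k \<le> a \<bullet> x"
      by (rule newton_polygon_halfspace[OF _ x(1)]) (use kl(4) in auto)
    moreover have "b < a \<bullet> (real t *\<^sub>R x)"
      by (rule ab(2), unfold dilate_def, rule imageI, rule x(1))
    moreover have "a \<bullet> lattice_point l \<le> a \<bullet> lattice_point m" using kl(5)[OF m] by simp
    ultimately show False using ab(1) by linarith
  qed
qed

text \<open>
  The Newton polygon of a product is the Minkowski sum of the Newton polygons; again the extremal
  terms in a separating direction do not cancel.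
\<close>

lemma supp_add_in_newton:
  assumes "f \<noteq> 0" "g \<noteq> 0" "k \<in> supp f" "l \<in> supp g"
  shows "k + l \<in> newton_lattice_points (f * g)"
proof (rule ccontr)
  assume "k + l \<notin> newton_lattice_points (f * g)"
  then have notin: "lattice_point (k + l) \<notin> newton_polygon (f * g)"
    by (simp add: newton_lattice_points_def)
  obtain a b where ab: "a \<bullet> lattice_point (k + l) < b" "\<And>x. x \<in> newton_polygon (f * g) \<Longrightarrow> b < a \<bullet> x"
    using separating_hyperplane_closed_point[OF newton_polygon_props(1,3) notin] by blast
  obtain k' l' where kl: "k' + l' \<in> supp (f * g)"
      "\<And>x. x \<in> supp f \<Longrightarrow> - (a \<bullet> lattice_point x) \<le> - (a \<bullet> lattice_point k')"
      "\<And>x. x \<in> supp g \<Longrightarrow> - (a \<bullet> lattice_point x) \<le> - (a \<bullet> lattice_point l')"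
    using support_function_mult[OF additive_inner[of a] assms(1,2)] by metis
  have "lattice_point (k' + l') \<in> newton_polygon (f * g)"
    using subsetD[OF supp_subset_newton kl(1)] by (simp add: newton_lattice_points_def)
  from ab(2)[OF this] show False using ab(1) kl(2)[OF assms(3)] kl(3)[OF assms(4)]
    by (simp add: lattice_point_add inner_add_right)
qed

lemma dilate_add:
  assumes "convex P" "x \<in> dilate s P" "y \<in> dilate t P"
  shows "x + y \<in> dilate (s + t) P"
proof -
  obtain x' y' where xy: "x = real s *\<^sub>R x'" "x' \<in> P" "y = real t *\<^sub>R y'" "y' \<in> P"
    using assms by (auto simp: dilate_def)
  show ?thesis
  proof (cases "s + t = 0")
    case True
    then show ?thesis using xy by (auto simp: dilate_def)
  next
    case False
    then have pos: "real s + real t > 0" by linarith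
    define z where "z = (real s / (real s + real t)) *\<^sub>R x' + (real t / (real s + real t)) *\<^sub>R y'"
    have "z \<in> P" unfolding z_def
      by (rule convexD[OF assms(1) xy(2,4)]) (use pos in \<open>simp_all flip: add_divide_distrib\<close>)
    moreover have "x + y = real (s + t) *\<^sub>R z" using pos by (simp add: z_def xy scaleR_add_right)
    ultimately show ?thesis by (auto simp: dilate_def)
  qed
qed

lemma supp_mult_dilate:
  assumes "convex P" "supp f \<subseteq> lattice_in (dilate s P)" "supp g \<subseteq> lattice_in (dilate t P)"
  shows "supp (f * g) \<subseteq> lattice_in (dilate (s + t) P)"
proof
  fix m assume "m \<in> supp (f * g)"
  then obtain a b where "m = a + b" "a \<in> supp f" "b \<in> supp g" using subsetD[OF supp_mult] by blast
  then show "m \<in> lattice_in (dilate (s + t) P)"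
    using dilate_add[OF assms(1), of "lattice_point a" s "lattice_point b" t] assms(2,3)
    by (auto simp: lattice_in_def lattice_point_add)
qed

lemma supp_power_dilate:
  assumes "convex P" "P \<noteq> {}" "supp f \<subseteq> lattice_in P"
  shows "supp (f ^ n) \<subseteq> lattice_in (dilate n P)"
proof (induction n)
  case 0
  have "lattice_point 0 = 0" by (simp add: lattice_point_def zero_prod_def)
  then show ?case using zero_in_dilate_0[OF assms(2)] by (simp add: lattice_in_def)
next
  case (Suc n)
  then show ?case using supp_mult_dilate[OF assms(1), of f "Suc 0" "f ^ n" n] assms(3) by (simp add: dilate_1)
qed

lemma supp_cancel_newton_power:
  assumes f: "f \<noteq> 0" and fc: "supp (f ^ n * c) \<subseteq> lattice_in (dilate (n + t) (newton_polygon f))"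
  shows "supp c \<subseteq> lattice_in (dilate t (newton_polygon f))"
  using fc
proof (induction n)
  case (Suc n)
  then have "supp (f * (f ^ n * c)) \<subseteq> lattice_in (dilate (Suc (n + t)) (newton_polygon f))"
    by (simp add: mult.assoc)
  from Suc.IH[OF supp_cancel_newton[OF f this]] show ?case .
qed simp

text \<open>
  A disc in \<open>P\<close> grows linearly under dilation and eventually contains a triangle of size \<open>n\<close>, at a
  scale proportional to \<open>n\<close>.
\<close>

lemma triangle_in_dilate:
  assumes "interior P \<noteq> {}"
  obtains K where "K \<ge> 2" "\<And>n. \<exists>z. triangle z n \<subseteq> lattice_in (dilate (K * n) P)"
proof -
  obtain c e where ce: "e > 0" "ball c e \<subseteq> P" using assms mem_interior by (metis ex_in_conv)
  obtain K0 :: nat where K0: "2 / e < real K0" using reals_Archimedean2 by blast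
  define K where "K = K0 + 2"
  have K: "2 < e * real K" using K0 ce(1) unfolding K_def
    by (simp add: field_simps)
  have "\<exists>z. triangle z n \<subseteq> lattice_in (dilate (K * n) P)" for n
  proof -
    define q where "q = real (K * n)"
    define x where "x = q *\<^sub>R c"
    define z where "z = (\<lfloor>fst x\<rfloor>, \<lfloor>snd x\<rfloor>)"
    have "triangle z n \<subseteq> lattice_in (dilate (K * n) P)"
    proof
      fix m assume "m \<in> triangle z n"
      then obtain i j where ij: "i + j < n" "m = z + (int (i + j), int j)" by (auto simp: triangle_def)
      then have n: "n > 0" by simp
      then have "K * n > 0" by (simp add: K_def)
      then have "q > 0" unfolding q_def by (simp only: of_nat_0_less_iff)
      moreover have "real n * 2 < real n * (e * real K)"
        by (rule mult_strict_left_mono[OF K]) (use n in simp)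
      then have "real n + real n < e * q" by (simp add: q_def algebra_simps)
      ultimately have q: "q > 0" "real n + real n < e * q" by blast+
      have "\<bar>fst (lattice_point m - x)\<bar> \<le> real n" "\<bar>snd (lattice_point m - x)\<bar> \<le> real n"
        using ij by (simp_all add: lattice_point_def z_def, linarith+)
      then have "norm (lattice_point m - x) \<le> real n + real n"
        using norm_Pair_le[of "fst (lattice_point m - x)" "snd (lattice_point m - x)", unfolded prod.collapse]
        by simp
      then have d: "norm (lattice_point m - x) < e * q" using q by simp
      define y where "y = (1 / q) *\<^sub>R lattice_point m"
      have "y - c = (1 / q) *\<^sub>R (lattice_point m - x)"
        using q by (simp add: y_def x_def scaleR_diff_right)
      then have "norm (y - c) = norm (lattice_point m - x) / q" using q by simp
      also have "\<dots> < e" using d q by (simp add: divide_less_eq mult.commute)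
      finally have "y \<in> P" using ce(2) by (auto simp: dist_norm norm_minus_commute)
      moreover have "lattice_point m = q *\<^sub>R y" using q by (simp add: y_def)
      ultimately show "m \<in> lattice_in (dilate (K * n) P)"
        unfolding lattice_in_def dilate_def q_def by blast
    qed
    then show ?thesis by blast
  qed
  then show ?thesis using that[of K] by (simp add: K_def)
qed

lemma prime_power_dvd_cancel:
  fixes \<phi> :: "'k::field laurent"
  assumes "prime_elem \<phi>" "\<not> \<phi> dvd \<psi>" "\<phi> ^ n dvd b * \<psi> ^ k"
  shows "\<phi> ^ n dvd b"
  using assms(3)
proof (induction n arbitrary: b)
  case (Suc n)
  have nz: "\<phi> \<noteq> 0" using assms(1) by (simp add: prime_elem_def)
  have "\<phi> dvd b * \<psi> ^ k" using Suc.prems by (metis dvd_mult_left power_Suc)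
  then have "\<phi> dvd b" using assms(1,2) by (metis prime_elem_dvd_multD prime_elem_dvd_power)
  then obtain b' where b': "b = \<phi> * b'" ..
  obtain d where "b * \<psi> ^ k = \<phi> ^ Suc n * d" using Suc.prems ..
  then have "\<phi> * (b' * \<psi> ^ k) = \<phi> * (\<phi> ^ n * d)" by (simp only: b' power_Suc mult.assoc)
  then have "b' * \<psi> ^ k = \<phi> ^ n * d" by (rule iffD1[OF laurent_mult_cancel[OF nz]])
  then have "\<phi> ^ n dvd b'" using Suc.IH by simp
  then show ?case by (simp add: b' mult_dvd_mono)
qed simp

text \<open>
  In the torus, \<open>\<phi>\<close> and \<open>\<psi>\<close> have at most \<open>2 |P|\<close> common zeros with multiplicity, and at \<open>(1, 1)\<close> the
  multiplicity is at least \<open>r\<^sup>2\<close>. To derive this by counting, let \<open>E j\<close> be the number of lattice points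
  in \<open>j P\<close>. The Koszul estimate for \<open>\<phi>\<^sup>n\<close> and \<open>\<psi>\<^sup>n\<close> reads
  \<open>(r n)\<^sup>2 \<le> E ((k + 2) n) - 2 E ((k + 1) n) + E (k n)\<close>. Since \<open>E (j n) / n\<^sup>2\<close> tends to \<open>j\<^sup>2 |P|\<close>, the
  right-hand side is asymptotic to \<open>2 |P| n\<^sup>2\<close>.
\<close>

lemma order_square_le_area:
  fixes \<phi> \<psi> :: "'k::field laurent"
  assumes irr: "irreducible \<phi>" and \<phi>: "\<phi> \<in> pow_p r" and \<psi>: "\<psi> \<in> pow_p r"
    and sub: "supp \<psi> \<subseteq> newton_lattice_points \<phi>" and int: "interior (newton_polygon \<phi>) \<noteq> {}"
    and ndvd: "\<not> \<phi> dvd \<psi>" and r: "r > 0"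
  shows "(real r)\<^sup>2 \<le> 2 * measure lebesgue (newton_polygon \<phi>)"
proof -
  let ?P = "newton_polygon \<phi>"
  define L where "L j = lattice_in (dilate j ?P)" for j
  have conv: "convex ?P" "compact ?P" by (rule newton_polygon_props)+
  have P_ne: "?P \<noteq> {}" using int interior_subset by blast
  have finL: "finite (L j)" for j
    unfolding L_def using conv by (intro finite_lattice_in dilate_props)
  have nz: "\<phi> \<noteq> 0" "\<psi> \<noteq> 0" using irr ndvd by (auto simp: irreducible_def)
  have prime: "prime_elem \<phi>" using irr by (rule laurent_irreducible_imp_prime)
  obtain K0 where K0: "K0 \<ge> 2" "\<And>n. \<exists>z. triangle z n \<subseteq> lattice_in (dilate (K0 * n) ?P)"
    using triangle_in_dilate[OF int] by blast
  \<comment> \<open>\<open>(k + 2) n P\<close> has room for the triangle of size \<open>2 r n\<close>, for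
    every \<open>n\<close>\<close>
  define k where "k = K0 * (2 * r) - 2"
  have k: "k + 2 = K0 * (2 * r)" "k \<ge> 1"
  proof -
    have "2 * 2 \<le> K0 * (2 * r)" using K0(1) r by (intro mult_le_mono) auto
    then show "k + 2 = K0 * (2 * r)" "k \<ge> 1" by (auto simp: k_def)
  qed
  have est: "(r * n)\<^sup>2 + 2 * card (L ((k + 1) * n)) \<le> card (L ((k + 2) * n)) + card (L (k * n))" for n
  proof -
    obtain z where z: "triangle z (2 * (r * n)) \<subseteq> L ((k + 2) * n)"
      using K0(2)[of "2 * (r * n)"] unfolding L_def k(1) by (auto simp: mult.assoc)
    have pw: "supp (\<phi> ^ n) \<subseteq> L n" "supp (\<psi> ^ n) \<subseteq> L n"
      unfolding L_def using supp_power_dilate[OF conv(1) P_ne] supp_subset_newton[of \<phi>] sub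
      by (simp_all add: newton_lattice_points_eq)
    have mult: "f * a \<in> supported (L ((k + 2) * n))"
      if "supp f \<subseteq> L n" "a \<in> supported (L ((k + 1) * n))" for f a :: "'k laurent"
      using supp_mult_dilate[OF conv(1), of f n a "(k + 1) * n"] that
      by (simp add: L_def supported_def algebra_simps)
    show ?thesis
    proof (rule koszul_dimension_estimate[of "\<phi> ^ n" _ "\<psi> ^ n" _ _ _ z])
      show "\<phi> ^ n \<in> pow_p (r * n)" "\<psi> ^ n \<in> pow_p (r * n)" using \<phi> \<psi> by (simp_all add: pow_p_power)
      show "\<phi> ^ n \<noteq> 0" "\<psi> ^ n \<noteq> 0" using nz by (simp_all add: laurent_power_eq_0_iff)
      fix a b assume a: "a \<in> supported (L ((k + 1) * n))" and b: "b \<in> supported (L ((k + 1) * n))"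
        and eq: "\<phi> ^ n * a = \<psi> ^ n * b"
      have "\<phi> ^ n dvd b * \<psi> ^ n" using eq by (metis dvdI mult.commute)
      then have "\<phi> ^ n dvd b" by (rule prime_power_dvd_cancel[OF prime ndvd])
      then obtain c where c: "b = \<phi> ^ n * c" ..
      have "\<phi> ^ n * a = \<phi> ^ n * (\<psi> ^ n * c)" unfolding eq c by (rule mult.left_commute)
      then have "a = \<psi> ^ n * c" using nz laurent_power_eq_0_iff laurent_mult_cancel by blast
      moreover have "supp c \<subseteq> L (k * n)"
        unfolding L_def
        by (rule supp_cancel_newton_power[OF nz(1), of n])
           (use b in \<open>simp add: c supported_def L_def algebra_simps\<close>)
      ultimately show "\<exists>c\<in>supported (L (k * n)). a = \<psi> ^ n * c" by (auto simp: supported_def)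
    qed (use finL z mult pw in auto)
  qed
  let ?m = "measure lebesgue ?P"
  have lim: "(\<lambda>n. real (card (L (j * n))) / real n ^ 2) \<longlonglongrightarrow> (real j)\<^sup>2 * ?m" if j: "j \<ge> 1" for j
  proof -
    have "filterlim (\<lambda>n. j * n) sequentially sequentially"
      using j by (intro filterlim_at_top_mono[OF filterlim_ident]) (auto intro!: always_eventually)
    from filterlim_compose[OF area_eq_limit_of_lattice_count[OF conv] this]
    have "(\<lambda>n. (real j)\<^sup>2 * (real (card (L (j * n))) / real (j * n) ^ 2)) \<longlonglongrightarrow> (real j)\<^sup>2 * ?m"
      unfolding L_def by (intro tendsto_mult tendsto_const)
    moreover have "(real j)\<^sup>2 * (x / real (j * n) ^ 2) = x / real n ^ 2" for x n
      using j by (simp add: power_mult_distrib)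
    ultimately show ?thesis by simp
  qed
  have "(real r)\<^sup>2 + 2 * ((real (k + 1))\<^sup>2 * ?m) \<le> (real (k + 2))\<^sup>2 * ?m + (real k)\<^sup>2 * ?m"
  proof (rule LIMSEQ_le)
    show "(\<lambda>n. (real r)\<^sup>2 + 2 * (real (card (L ((k + 1) * n))) / real n ^ 2)) \<longlonglongrightarrow>
        (real r)\<^sup>2 + 2 * ((real (k + 1))\<^sup>2 * ?m)"
      by (intro tendsto_intros lim) simp
    show "(\<lambda>n. real (card (L ((k + 2) * n))) / real n ^ 2 + real (card (L (k * n))) / real n ^ 2) \<longlonglongrightarrow>
        (real (k + 2))\<^sup>2 * ?m + (real k)\<^sup>2 * ?m"
      by (intro tendsto_add lim) (use k(2) in linarith)+
    have "(real r)\<^sup>2 + 2 * (real (card (L ((k + 1) * n))) / real n ^ 2) \<le>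
        real (card (L ((k + 2) * n))) / real n ^ 2 + real (card (L (k * n))) / real n ^ 2" if "n \<ge> 1" for n
    proof -
      have "real ((r * n)\<^sup>2 + 2 * card (L ((k + 1) * n))) \<le> real (card (L ((k + 2) * n)) + card (L (k * n)))"
        using est[of n] by (simp only: of_nat_le_iff)
      then have "(real r * real n)\<^sup>2 + 2 * real (card (L ((k + 1) * n))) \<le>
         real (card (L ((k + 2) * n))) + real (card (L (k * n)))" by simp
      from divide_right_mono[OF this, of "real n ^ 2"] show ?thesis
        using that by (simp add: add_divide_distrib power_mult_distrib)
    qed
    then show "\<exists>N. \<forall>n\<ge>N. (real r)\<^sup>2 + 2 * (real (card (L ((k + 1) * n))) / real n ^ 2) \<le>
        real (card (L ((k + 2) * n))) / real n ^ 2 + real (card (L (k * n))) / real n ^ 2" by blast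
  qed
  moreover have "(real (k + 2))\<^sup>2 * ?m + (real k)\<^sup>2 * ?m - 2 * ((real (k + 1))\<^sup>2 * ?m) = 2 * ?m"
    by (simp add: power2_eq_square algebra_simps)
  ultimately show ?thesis by linarith
qed

section \<open>Lattice points on a line\<close>

definition zmult :: "int \<Rightarrow> int \<times> int \<Rightarrow> int \<times> int" where
  "zmult t d = (t * fst d, t * snd d)"

definition det2 :: "int \<times> int \<Rightarrow> int \<times> int \<Rightarrow> int" where
  "det2 u v = fst u * snd v - snd u * fst v"

definition primitive :: "int \<times> int \<Rightarrow> bool" where
  "primitive d \<longleftrightarrow> coprime (fst d) (snd d)"

lemma primitive_nonzero: "primitive d \<Longrightarrow> d \<noteq> 0"
  by (auto simp: primitive_def zero_prod_def)

lemma primitive_multiple: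
  assumes "primitive d" "det2 d m = 0"
  obtains t where "m = zmult t d"
proof -
  obtain a b where ab: "a * fst d + b * snd d = 1"
    using assms(1) bezout_int[of "fst d" "snd d"] by (auto simp: primitive_def)
  have "(a * fst m + b * snd m) * fst d = (a * fst d + b * snd d) * fst m + b * det2 d m"
    "(a * fst m + b * snd m) * snd d = (a * fst d + b * snd d) * snd m - a * det2 d m"
    by (simp_all add: det2_def algebra_simps)
  then have "m = zmult (a * fst m + b * snd m) d"
    unfolding ab assms(2) by (simp add: zmult_def)
  then show ?thesis by (rule that)
qed

lemma primitive_direction:
  assumes "m \<noteq> 0"
  obtains d g where "primitive d" "m = zmult g d" "g > 0"
proof -
  define g where "g = gcd (fst m) (snd m)"
  define d where "d = (fst m div g, snd m div g)"
  have g: "g > 0" using assms by (auto simp: g_def prod_eq_iff)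
  have "m = zmult g d" by (simp add: zmult_def d_def g_def)
  moreover have "primitive d" unfolding primitive_def d_def g_def
    using assms by (auto intro!: div_gcd_coprime simp: prod_eq_iff)
  ultimately show ?thesis using that g by blast
qed

lemma det2_zmult: "det2 (zmult g d) m = g * det2 d m"
  by (simp add: det2_def zmult_def algebra_simps)

lemma lattice_line:
  assumes "m1 \<noteq> (m0 :: int \<times> int)" "\<And>m. m \<in> S \<Longrightarrow> det2 (m1 - m0) (m - m0) = 0"
  obtains d where "primitive d" "\<And>m. m \<in> S \<Longrightarrow> \<exists>t. m = m0 + zmult t d"
proof -
  obtain d g where d: "primitive d" "m1 - m0 = zmult g d" "g > 0"
    using primitive_direction[of "m1 - m0"] assms(1) by auto
  have "\<exists>t. m = m0 + zmult t d" if "m \<in> S" for m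
  proof -
    have "det2 d (m - m0) = 0" using assms(2)[OF that] d(2,3) by (simp add: det2_zmult)
    then obtain t where "m - m0 = zmult t d" using primitive_multiple[OF d(1)] by blast
    then show ?thesis by (metis add.commute diff_add_cancel)
  qed
  then show ?thesis using that d(1) by blast
qed

lemma zmult_inj: "d \<noteq> 0 \<Longrightarrow> zmult s d = zmult t d \<longleftrightarrow> s = t"
  by (auto simp: zmult_def prod_eq_iff)

lemma lattice_point_zmult: "lattice_point (zmult t d) = real_of_int t *\<^sub>R lattice_point d"
  by (simp add: lattice_point_def zmult_def)

lemma lattice_point_in_segment:
  assumes "s \<le> t" "t \<le> u"
  shows "lattice_point (m + zmult t d) \<in>
    closed_segment (lattice_point (m + zmult s d)) (lattice_point (m + zmult u d))"
proof (cases "s = u")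
  case False
  then have pos: "real_of_int u - real_of_int s > 0" using assms by linarith
  define w where "w = (real_of_int t - real_of_int s) / (real_of_int u - real_of_int s)"
  have w: "0 \<le> w" "w \<le> 1" using assms pos by (simp_all add: w_def divide_le_eq)
  have "w * (real_of_int u - real_of_int s) = real_of_int t - real_of_int s" using pos by (simp add: w_def)
  then have "real_of_int t = (1 - w) * real_of_int s + w * real_of_int u" by (simp add: algebra_simps)
  then have "lattice_point (m + zmult t d) =
      (1 - w) *\<^sub>R lattice_point (m + zmult s d) + w *\<^sub>R lattice_point (m + zmult u d)"
    by (simp add: lattice_point_add lattice_point_zmult scaleR_add_right algebra_simps flip: scaleR_add_left)
  then show ?thesis using w by (auto simp: in_segment)
qed (use assms in auto)

lemma primitive_segment_lattice_points:
  assumes d: "primitive d" and k: "lattice_point k \<in> closed_segment (lattice_point m) (lattice_point (m + d))"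
  shows "k = m \<or> k = m + d"
proof -
  obtain w where w: "0 \<le> w" "w \<le> 1"
    "lattice_point k = (1 - w) *\<^sub>R lattice_point m + w *\<^sub>R lattice_point (m + d)"
    using k by (auto simp: in_segment)
  then have kw: "lattice_point (k - m) = w *\<^sub>R lattice_point d"
    by (simp add: lattice_point_add lattice_point_diff algebra_simps)
  then have c: "real_of_int (fst (k - m)) = w * real_of_int (fst d)" "real_of_int (snd (k - m)) = w * real_of_int (snd d)"
    by (simp_all add: lattice_point_def)
  have "real_of_int (det2 d (k - m)) = 0"
    unfolding det2_def of_int_diff of_int_mult c by simp
  then have "det2 d (k - m) = 0" by simp
  then obtain t where t: "k - m = zmult t d" using primitive_multiple[OF d] by blast
  have "lattice_point d \<noteq> 0"
    using primitive_nonzero[OF d] by (auto simp: lattice_point_def zero_prod_def prod_eq_iff)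
  then have "real_of_int t = w" using kw by (simp add: t lattice_point_zmult)
  then have "t = 0 \<or> t = 1" using w by linarith
  then have "k - m = 0 \<or> k - m = d" using t by (auto simp: zmult_def zero_prod_def)
  then show ?thesis by (metis add.commute add_0 diff_add_cancel)
qed

lemma zmult_of_nat: "laurent_monom (zmult (int n) d) = laurent_monom d ^ n"
  by (cases d) (simp add: zmult_def monom_power)

lemma binomial_dvd: "laurent_monom d - 1 dvd (laurent_monom (zmult t d) - 1 :: 'k::field laurent)"
proof -
  have pos: "laurent_monom d - 1 dvd (laurent_monom (zmult (int n) d) - 1 :: 'k laurent)" for n
    unfolding zmult_of_nat by (simp add: power_diff_1_eq)
  show ?thesis
  proof (cases "t \<ge> 0")
    case True
    then show ?thesis using pos[of "nat t"] by simp
  next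
    case False
    then have "laurent_monom (zmult t d) - 1 =
        (laurent_monom (zmult (int (nat (- t))) d) - 1) * (- laurent_monom (zmult t d) :: 'k laurent)"
      by (simp add: left_diff_distrib monom_mult zmult_def monom_0 flip: zero_prod_def)
    then show ?thesis using pos[of "nat (- t)"] by (simp only: dvd_mult2)
  qed
qed

lemma supp_binomial:
  assumes "d \<noteq> 0"
  shows "supp (laurent_monom m * (laurent_monom d - 1) :: 'k::field laurent) = {m, m + d}"
proof -
  have "coef (laurent_monom d - 1 :: 'k laurent) k = (if k = d then 1 else if k = 0 then - 1 else 0)" for k
    using assms by (auto simp: lookup_minus coef_monom lookup_one when_def)
  then have "k \<in> supp (laurent_monom d - 1 :: 'k laurent) \<longleftrightarrow> k \<in> {0, d}" for k
    by (auto simp: in_keys_iff)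
  then have "supp (laurent_monom d - 1 :: 'k laurent) = {0, d}" by blast
  then show ?thesis by (simp add: supp_monom_mult)
qed

lemma binomial_not_unit: "d \<noteq> 0 \<Longrightarrow> \<not> (laurent_monom d - 1 :: 'k::field laurent) dvd 1"
proof
  assume d: "d \<noteq> 0" and "(laurent_monom d - 1 :: 'k laurent) dvd 1"
  then obtain m where "supp (laurent_monom d - 1 :: 'k laurent) = {m}" by (auto simp: laurent_unit_iff)
  then have "{0, d} = {m}" using supp_binomial[OF d, of 0, where 'k = 'k] by (simp add: monom_0)
  then show False using d by (metis insertI1 insertI2 singletonD)
qed

lemma unit_eq_scale_monom: "(u :: 'k::field laurent) dvd 1 \<Longrightarrow> \<exists>c m. c \<noteq> 0 \<and> u = laurent_scale c (laurent_monom m)"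
  using laurent_unit_eq_term term_eq_scale_monom by metis

text \<open>
  The support lies on a line, so all exponents differ by multiples of a primitive vector \<open>d\<close>. As the
  coefficients add up to \<open>0\<close>, the binomial \<open>x\<^sup>d - 1\<close> divides \<open>\<phi>\<close>, and irreducibility leaves only a
  unit as the other factor.
\<close>

lemma degenerate_irreducible:
  fixes \<phi> :: "'k::field laurent"
  assumes irr: "irreducible \<phi>" and \<phi>: "\<phi> \<in> ideal_p" and int: "interior (newton_polygon \<phi>) = {}"
  obtains c m d where "c \<noteq> 0" "primitive d" "\<phi> = laurent_scale c (laurent_monom m * (laurent_monom d - 1))"
proof -
  have nz: "\<phi> \<noteq> 0" and nu: "\<not> \<phi> dvd 1" using irr by (auto simp: irreducible_def)
  obtain m0 where m0: "m0 \<in> supp \<phi>" using nz supp_eq_empty_iff[of \<phi>] by blast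
  obtain m1 where m1: "m1 \<in> supp \<phi>" "m1 \<noteq> m0"
  proof -
    have "supp \<phi> \<noteq> {m0}" using nu unfolding laurent_unit_iff by blast
    then show thesis using that m0 by blast
  qed
  obtain a b where ab: "a \<noteq> 0" "newton_polygon \<phi> \<subseteq> {x. a \<bullet> x = b}"
    using empty_interior_subset_hyperplane[OF newton_polygon_props(1) int] by blast
  have inner: "a \<bullet> lattice_point m = b" if "m \<in> supp \<phi>" for m
    using ab(2) subsetD[OF supp_subset_newton that] by (auto simp: newton_lattice_points_def)
  have "det2 (m1 - m0) (m - m0) = 0" if m: "m \<in> supp \<phi>" for m
  proof -
    define u v where "u = lattice_point (m1 - m0)" and "v = lattice_point (m - m0)"
    have "a \<bullet> u = 0" "a \<bullet> v = 0"
      using inner m m1 m0 by (simp_all add: u_def v_def lattice_point_diff inner_diff_right)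
    then have e: "fst a * fst u + snd a * snd u = 0" "fst a * fst v + snd a * snd v = 0"
      by (simp_all add: inner_prod_def)
    have "fst a * (fst u * snd v - snd u * fst v) =
        snd v * (fst a * fst u + snd a * snd u) - snd u * (fst a * fst v + snd a * snd v)"
      "snd a * (fst u * snd v - snd u * fst v) =
        fst u * (fst a * fst v + snd a * snd v) - fst v * (fst a * fst u + snd a * snd u)"
      by (simp_all add: algebra_simps)
    then have "fst a * (fst u * snd v - snd u * fst v) = 0" "snd a * (fst u * snd v - snd u * fst v) = 0"
      by (simp_all only: e mult_zero_right diff_self)
    then have "fst u * snd v - snd u * fst v = 0" using ab(1) by (auto simp: prod_eq_iff)
    then have "real_of_int (det2 (m1 - m0) (m - m0)) = 0"
      by (simp add: det2_def u_def v_def lattice_point_def)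
    then show ?thesis by simp
  qed
  then obtain d where d: "primitive d" "\<And>m. m \<in> supp \<phi> \<Longrightarrow> \<exists>t. m = m0 + zmult t d"
    using lattice_line[OF m1(2), of "supp \<phi>"] by blast
  have "(\<Sum>m\<in>supp \<phi>. coef \<phi> m) = 0"
  proof -
    have "\<phi> \<in> pow_p (Suc 0)" unfolding pow_p_1 by (rule \<phi>)
    then have "taylor 0 0 \<phi> = 0" by (rule taylor_pow_p) simp
    then show ?thesis by (simp add: taylor_def)
  qed
  then have "(\<Sum>m\<in>supp \<phi>. laurent_scale (coef \<phi> m) (laurent_monom m0)) = 0"
    by (simp flip: laurent.scale_sum_left)
  then have "\<phi> = (\<Sum>m\<in>supp \<phi>. term_of m (coef \<phi> m)) - (\<Sum>m\<in>supp \<phi>. laurent_scale (coef \<phi> m) (laurent_monom m0))"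
    by (simp add: sum_terms)
  also have "\<dots> = (\<Sum>m\<in>supp \<phi>. laurent_scale (coef \<phi> m) (laurent_monom m - laurent_monom m0))"
    by (simp add: term_eq_scale_monom laurent.scale_right_diff_distrib sum_subtractf)
  finally have \<phi>_eq: "\<phi> = (\<Sum>m\<in>supp \<phi>. laurent_scale (coef \<phi> m) (laurent_monom m - laurent_monom m0))" .
  have "laurent_monom d - 1 dvd laurent_scale (coef \<phi> m) (laurent_monom m - laurent_monom m0)"
    if m: "m \<in> supp \<phi>" for m
  proof -
    obtain t where t: "m = m0 + zmult t d" using d(2)[OF m] by blast
    have "laurent_scale (coef \<phi> m) (laurent_monom m - laurent_monom m0) =
      laurent_const (coef \<phi> m) * laurent_monom m0 * (laurent_monom (zmult t d) - 1)"
      by (simp add: t laurent_scale_def right_diff_distrib monom_mult mult.assoc)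
    then show ?thesis by (simp only: dvd_mult binomial_dvd)
  qed
  then have "laurent_monom d - 1 dvd (\<Sum>m\<in>supp \<phi>. laurent_scale (coef \<phi> m) (laurent_monom m - laurent_monom m0))"
    by (rule dvd_sum)
  then have "laurent_monom d - 1 dvd \<phi>" by (simp only: flip: \<phi>_eq)
  then obtain h where h: "\<phi> = (laurent_monom d - 1) * h" ..
  have "h dvd 1"
    using irreducibleD[OF irr h] binomial_not_unit[OF primitive_nonzero[OF d(1)]] by blast
  then obtain c m where "c \<noteq> 0" "h = laurent_scale c (laurent_monom m)" using unit_eq_scale_monom by blast
  then show ?thesis using that[of c d m] d(1) h
    by (simp add: scale_mult_right scale_mult_left mult.commute)
qed

section \<open>Uniqueness within the Newton polygon\<close>

lemma nctD:
  assumes "is_nct r \<phi>"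
  shows "irreducible \<phi>" "\<phi> \<in> pow_p r" "2 * measure lebesgue (newton_polygon \<phi>) < (real r)\<^sup>2"
    "\<phi> \<noteq> 0" "\<not> \<phi> dvd 1"
  using assms by (auto simp: is_nct_def irreducible_def)

text \<open>
  If the polygon has interior points and \<open>\<phi>\<close> did not divide \<open>\<psi>\<close>, the intersection estimate would
  give \<open>r\<^sup>2 \<le> 2 |P|\<close>. The quotient has Newton polygon \<open>0\<close> by cancellation, so it is a constant. If the
  polygon is a segment, its only lattice points are the two exponents of \<open>\<phi>\<close>.
\<close>

theorem nct_unique_in_newton_polygon:
  fixes \<phi> \<psi> :: "'k::field laurent"
  assumes nct: "is_nct r \<phi>" and r: "r > 0"
    and \<psi>: "\<psi> \<in> pow_p r" "supp \<psi> \<subseteq> newton_lattice_points \<phi>"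
  obtains c where "\<psi> = laurent_scale c \<phi>"
proof (cases "interior (newton_polygon \<phi>) = {}")
  case True
  have \<phi>p: "\<phi> \<in> ideal_p"
    using subsetD[OF pow_p_antimono[of "Suc 0" r] nctD(2)[OF nct]] r unfolding pow_p_1 by simp
  obtain c m d where cmd: "c \<noteq> 0" "primitive d" "\<phi> = laurent_scale c (laurent_monom m * (laurent_monom d - 1))"
    by (rule degenerate_irreducible[OF nctD(1)[OF nct] \<phi>p True])
  have d0: "d \<noteq> 0" using primitive_nonzero[OF cmd(2)] .
  have "supp \<phi> = {m, m + d}" unfolding cmd(3) supp_scale[OF cmd(1)] by (rule supp_binomial[OF d0])
  then have seg: "newton_polygon \<phi> = closed_segment (lattice_point m) (lattice_point (m + d))"
    by (simp add: newton_polygon_def segment_convex_hull)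
  have "k \<in> {m, m + d}" if k: "k \<in> supp \<psi>" for k
  proof -
    have "lattice_point k \<in> newton_polygon \<phi>"
      using subsetD[OF \<psi>(2) k] by (simp add: newton_lattice_points_def)
    from primitive_segment_lattice_points[OF cmd(2) this[unfolded seg]] show ?thesis by simp
  qed
  then have \<psi>_supp: "supp \<psi> \<subseteq> {m, m + d}" by blast
  moreover have "taylor 0 0 \<psi> = 0" using \<psi>(1) r by (intro taylor_pow_p) auto
  ultimately have "coef \<psi> m + coef \<psi> (m + d) = 0"
    using taylor_superset[of "{m, m + d}" \<psi> 0 0] d0 by simp
  then have sum0: "coef \<psi> m = - coef \<psi> (m + d)" by (simp add: eq_neg_iff_add_eq_0)
  have "\<psi> = laurent_scale (coef \<psi> (m + d)) (laurent_monom m * (laurent_monom d - 1))"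
  proof (rule poly_mapping_eqI)
    fix k
    have e: "coef (laurent_monom m * (laurent_monom d - 1) :: 'k laurent) k =
      (if k = m + d then 1 else if k = m then - 1 else 0)"
      unfolding right_diff_distrib monom_mult lookup_minus coef_monom mult_1_right using d0 by simp
    consider "k = m + d" | "k \<noteq> m + d" "k = m" | "k \<noteq> m + d" "k \<noteq> m"
      by blast
    then show "coef \<psi> k = coef (laurent_scale (coef \<psi> (m + d)) (laurent_monom m * (laurent_monom d - 1))) k"
    proof cases
      case 1
      have "coef \<psi> k = coef \<psi> (m + d)" by (simp only: 1)
      then show ?thesis by (simp only: coef_scale e if_P[OF 1] mult_1_right)
    next
      case 2
      have "coef \<psi> k = - coef \<psi> (m + d)" unfolding 2(2) by (rule sum0)
      then show ?thesis
        by (simp only: coef_scale e if_not_P[OF 2(1)] if_P[OF 2(2)] mult_minus1_right)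
    next
      case 3
      then have "k \<notin> supp \<psi>" using \<psi>_supp by blast
      then show ?thesis unfolding coef_scale e using 3 by (simp add: in_keys_iff)
    qed
  qed
  also have "\<dots> = laurent_scale (coef \<psi> (m + d) / c) \<phi>" 
    unfolding cmd(3) laurent.scale_scale using cmd(1) by simp
  finally show ?thesis by (rule that)
next
  case False
  have "\<phi> dvd \<psi>"
    using order_square_le_area[OF nctD(1,2)[OF nct] \<psi> False _ r] nctD(3)[OF nct] by linarith
  then obtain c where c: "\<psi> = \<phi> * c" ..
  have "supp (\<phi> * c) \<subseteq> lattice_in (dilate (Suc 0) (newton_polygon \<phi>))"
    using \<psi>(2) c by (simp add: dilate_1 newton_lattice_points_eq)
  then have "supp c \<subseteq> lattice_in (dilate 0 (newton_polygon \<phi>))"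
    by (rule supp_cancel_newton[OF nctD(4)[OF nct]])
  also have "\<dots> \<subseteq> {0}" by (auto simp: lattice_in_def dilate_def lattice_point_def zero_prod_def)
  finally have supp_c: "supp c \<subseteq> {0}" .
  obtain e where e: "c = term_of 0 e"
  proof
    show "c = term_of 0 (coef c 0)"
      using supp_c by (intro poly_mapping_eqI) (auto simp: lookup_single when_def in_keys_iff)
  qed
  have "\<psi> = laurent_scale e \<phi>" unfolding c e laurent_scale_eq by (rule mult.commute)
  then show ?thesis by (rule that)
qed

theorem nct_linear_system:
  fixes \<phi> :: "'k::field laurent"
  assumes nct: "is_nct r \<phi>" and r: "r > 0"
  shows "pow_p r \<inter> laurent.span (laurent_monom ` newton_lattice_points \<phi>) = {laurent_scale c \<phi> | c. True}"
proof (intro subset_antisym subsetI)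
  fix \<psi> :: "'k laurent" assume "\<psi> \<in> pow_p r \<inter> laurent.span (laurent_monom ` newton_lattice_points \<phi>)"
  then have "\<psi> \<in> pow_p r" "supp \<psi> \<subseteq> newton_lattice_points \<phi>" by (auto simp: span_monoms supported_def)
  then show "\<psi> \<in> {laurent_scale c \<phi> | c. True}"
    by (metis (mono_tags, lifting) mem_Collect_eq nct_unique_in_newton_polygon[OF nct r])
next
  fix \<psi> :: "'k laurent" assume "\<psi> \<in> {laurent_scale c \<phi> | c. True}"
  then obtain c where c: "\<psi> = laurent_scale c \<phi>" by blast
  have "\<psi> \<in> pow_p r" unfolding c by (rule pow_p_scale[OF nctD(2)[OF nct]])
  moreover have "\<phi> \<in> supported (newton_lattice_points \<phi>)" using supp_subset_newton by (simp add: supported_def)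
  then have "\<psi> \<in> supported (newton_lattice_points \<phi>)"
    unfolding c by (rule laurent.subspace_scale[OF supported_subspace])
  ultimately show "\<psi> \<in> pow_p r \<inter> laurent.span (laurent_monom ` newton_lattice_points \<phi>)"
    by (simp add: span_monoms)
qed

text \<open>
  With more lattice points, the expected dimension of the linear system would exceed one.
\<close>

theorem nct_card_lattice_points:
  fixes \<phi> :: "'k::field laurent"
  assumes nct: "is_nct r \<phi>" and r: "r > 0"
  shows "card (newton_lattice_points \<phi>) \<le> r * (r + 1) div 2 + 1"
proof -
  have "supported (newton_lattice_points \<phi>) \<inter> pow_p r \<subseteq> laurent.span {\<phi>}"
  proof
    fix \<psi> :: "'k laurent" assume "\<psi> \<in> supported (newton_lattice_points \<phi>) \<inter> pow_p r"
    then obtain c where "\<psi> = laurent_scale c \<phi>"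
      using nct_unique_in_newton_polygon[OF nct r, of \<psi>] by (auto simp: supported_def)
    then show "\<psi> \<in> laurent.span {\<phi>}" by (simp add: laurent.span_base laurent.span_scale)
  qed
  from laurent.dim_le_card[OF this]
  have "laurent.dim (supported (newton_lattice_points \<phi>) \<inter> pow_p r :: 'k laurent set) \<le> 1" by simp
  then show ?thesis
    using dim_supported_pow_p[OF finite_newton_lattice_points, of \<phi> r, where 'k = 'k] by linarith
qed

lemma irreducible_scale: "c \<noteq> 0 \<Longrightarrow> irreducible f \<Longrightarrow> irreducible (laurent_scale c f)"
  unfolding laurent_scale_eq by (rule irreducible_unit_mult[OF term_unit])

text \<open>
  By uniqueness such an element would be a multiple of the irreducible \<open>\<phi>\<close>.
\<close>

theorem nct_no_reducible:
  fixes \<phi> \<zeta> :: "'k::field laurent"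
  assumes nct: "is_nct r \<phi>" and r: "r > 0" and \<zeta>: "is_reducible \<zeta>" "\<zeta> \<in> pow_p r"
  shows "\<not> lattice_point ` supp \<zeta> \<subseteq> newton_polygon \<phi>"
proof
  assume "lattice_point ` supp \<zeta> \<subseteq> newton_polygon \<phi>"
  then have "supp \<zeta> \<subseteq> newton_lattice_points \<phi>" by (auto simp: newton_lattice_points_def)
  then obtain c where c: "\<zeta> = laurent_scale c \<phi>" using nct_unique_in_newton_polygon[OF nct r \<zeta>(2)] by blast
  then have "c \<noteq> 0" using \<zeta>(1) by (auto simp: is_reducible_def)
  then have "irreducible \<zeta>" using irreducible_scale nctD(1)[OF nct] c by blast
  then show False using \<zeta>(1) by (auto simp: is_reducible_def irreducible_def)
qed

lemma supp_binomial_power: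
  "supp ((laurent_monom d - 1) ^ n :: 'k::field laurent) \<subseteq> (\<lambda>i. zmult (int i) d) ` {..n}"
proof (induction n)
  case 0 then show ?case by (auto simp: zmult_def zero_prod_def)
next
  case (Suc n)
  have one: "supp (laurent_monom d - 1 :: 'k laurent) \<subseteq> {0, d}"
    by (auto simp: in_keys_iff lookup_minus coef_monom lookup_one when_def split: if_splits)
  show ?case
  proof
    fix m assume "m \<in> supp ((laurent_monom d - 1) ^ Suc n :: 'k laurent)"
    then obtain a b where ab: "m = a + b" "a \<in> supp (laurent_monom d - 1 :: 'k laurent)"
      "b \<in> supp ((laurent_monom d - 1) ^ n :: 'k laurent)"
      unfolding power_Suc using subsetD[OF supp_mult] by blast
    obtain i where i: "i \<le> n" "b = zmult (int i) d" using ab(3) Suc by blast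
    have "a = 0 \<or> a = d" using ab(2) one by blast
    then have "m = zmult (int i) d \<or> m = zmult (int (Suc i)) d"
      using ab(1) i(2) by (auto simp: zmult_def prod_eq_iff algebra_simps)
    moreover have "zmult (int i) d \<in> (\<lambda>i. zmult (int i) d) ` {..Suc n}"
      "zmult (int (Suc i)) d \<in> (\<lambda>i. zmult (int i) d) ` {..Suc n}"
      using i(1) by (intro imageI; simp)+
    ultimately show "m \<in> (\<lambda>i. zmult (int i) d) ` {..Suc n}" by blast
  qed
qed

text \<open>
  If \<open>d\<close> is the primitive direction of the line, \<open>x\<^sup>m (x\<^sup>d - 1)\<^sup>r\<close> with a suitable \<open>m\<close> is supported in
  \<open>r + 1\<close> successive lattice points of the line inside the polygon; it is reducible of order \<open>r\<close>.
\<close>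

theorem nct_no_long_line:
  fixes \<phi> :: "'k::field laurent"
  assumes nct: "is_nct r \<phi>" and r: "r \<ge> 2"
    and S: "S \<subseteq> newton_lattice_points \<phi>" "card S = r + 1" "collinear (lattice_point ` S)"
  shows False
proof -
  have finS: "finite S" using S(2) by (intro card_ge_0_finite) simp
  have "\<not> card S \<le> 1" using S(2) r by simp
  then obtain m0 m1 where m: "m0 \<in> S" "m1 \<in> S" "m1 \<noteq> m0"
    using card_le_Suc0_iff_eq[OF finS] by auto
  obtain u where u: "\<And>x y. x \<in> S \<Longrightarrow> y \<in> S \<Longrightarrow> \<exists>c. lattice_point x - lattice_point y = c *\<^sub>R u"
    using S(3) unfolding collinear_def by blast
  have "det2 (m1 - m0) (k - m0) = 0" if k: "k \<in> S" for k
  proof -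
    obtain c where "lattice_point (m1 - m0) = c *\<^sub>R u" using u[OF m(2,1)] by (auto simp: lattice_point_diff)
    moreover obtain c' where "lattice_point (k - m0) = c' *\<^sub>R u" using u[OF k m(1)] by (auto simp: lattice_point_diff)
    ultimately have "real_of_int (det2 (m1 - m0) (k - m0)) = 0"
      by (cases u) (auto simp: lattice_point_def det2_def)
    then show ?thesis by simp
  qed
  then obtain d where d: "primitive d" "\<And>k. k \<in> S \<Longrightarrow> \<exists>t. k = m0 + zmult t d"
    using lattice_line[OF m(3), of S] by blast
  have d0: "d \<noteq> 0" using primitive_nonzero[OF d(1)] .
  define T where "T = {t. m0 + zmult t d \<in> S}"
  have ST: "S = (\<lambda>t. m0 + zmult t d) ` T" using d(2) unfolding T_def by blast
  have injT: "inj (\<lambda>t. m0 + zmult t d)" by (rule injI) (simp add: zmult_inj[OF d0])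
  note inj_on_T = inj_on_subset[OF injT subset_UNIV, of T]
  have finT: "finite T" using finS unfolding ST by (rule finite_imageD[OF _ inj_on_T])
  have cT: "card T = r + 1" using S(2) unfolding ST card_image[OF inj_on_T] .
  then have "T \<noteq> {}" by auto
  define t0 t1 where "t0 = Min T" and "t1 = Max T"
  have t: "t0 \<in> T" "t1 \<in> T" using finT \<open>T \<noteq> {}\<close> by (auto simp: t0_def t1_def)
  have "T \<subseteq> {t0..t1}" using finT by (auto simp: t0_def t1_def)
  then have "card T \<le> card {t0..t1}" by (rule card_mono[rotated]) simp
  then have t01: "t0 + int r \<le> t1" using cT by simp
  define q where "q = r - 2"
  have q: "r = Suc (Suc q)" using r by (simp add: q_def)
  define \<zeta> where "\<zeta> = laurent_monom (m0 + zmult t0 d) * (laurent_monom d - 1 :: 'k laurent) ^ r"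
  have nz: "laurent_monom d - 1 \<noteq> (0 :: 'k laurent)" using binomial_not_unit[OF d0, where 'k = 'k] supp_binomial[OF d0, of 0, where 'k = 'k]
    by (auto simp: monom_0)
  have "(laurent_monom d - 1 :: 'k laurent) \<in> pow_p (Suc 0)"
    unfolding pow_p_1 by (rule monom_diff_1_in_ideal_p)
  from pow_p_power[OF this, of r] have "\<zeta> \<in> pow_p r" unfolding \<zeta>_def by (simp add: pow_p_mult_left)
  moreover have "is_reducible \<zeta>"
    unfolding is_reducible_def
  proof (intro conjI exI)
    have m_nz: "laurent_monom (m0 + zmult t0 d) \<noteq> (0 :: 'k laurent)"
      by (metis empty_not_insert keys_zero supp_monom)
    show "\<zeta> \<noteq> 0" using nz m_nz by (simp add: \<zeta>_def laurent_mult_eq_0_iff laurent_power_eq_0_iff)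
    show "\<zeta> = (laurent_monom d - 1) * (laurent_monom (m0 + zmult t0 d) * (laurent_monom d - 1) ^ Suc q)"
      unfolding \<zeta>_def q by (simp only: power_Suc ac_simps)
    show "\<not> (laurent_monom d - 1 :: 'k laurent) dvd 1" by (rule binomial_not_unit[OF d0])
    then show "\<not> laurent_monom (m0 + zmult t0 d) * (laurent_monom d - 1 :: 'k laurent) ^ Suc q dvd 1"
      by (metis dvd_mult_left dvd_mult_right power_Suc)
  qed
  moreover have "lattice_point ` supp \<zeta> \<subseteq> newton_polygon \<phi>"
  proof (rule image_subsetI)
    fix k assume "k \<in> supp \<zeta>"
    then obtain i where i: "i \<le> r" "k = m0 + zmult t0 d + zmult (int i) d"
      unfolding \<zeta>_def supp_monom_mult using supp_binomial_power[of d r, where 'k = 'k] by blast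
    have k: "k = m0 + zmult (t0 + int i) d" unfolding i(2) by (simp add: zmult_def prod_eq_iff algebra_simps)
    have "lattice_point k \<in> closed_segment (lattice_point (m0 + zmult t0 d)) (lattice_point (m0 + zmult t1 d))"
      unfolding k by (rule lattice_point_in_segment) (use i(1) t01 in auto)
    moreover have "lattice_point (m0 + zmult t0 d) \<in> newton_polygon \<phi>" "lattice_point (m0 + zmult t1 d) \<in> newton_polygon \<phi>"
      using t S(1) by (auto simp: T_def newton_lattice_points_def)
    ultimately show "lattice_point k \<in> newton_polygon \<phi>"
      using newton_polygon_props(1)[of \<phi>] by (meson convex_contains_segment subsetD)
  qed
  ultimately show False using nct_no_reducible[OF nct, of \<zeta>] r by auto
qed

section \<open>Fields of definition\<close>

lemma is_subfield_prime_field: "is_subfield prime_field"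
  unfolding is_subfield_def prime_field_def by (intro conjI ballI; simp add: is_subfield_def)

lemma prime_field_subset: "is_subfield K \<Longrightarrow> prime_field \<subseteq> K"
  unfolding prime_field_def by (rule Inter_lower) simp

text \<open>
  Normalize one coefficient to \<open>1\<close> and descend: the result has the same order and is supported in the
  same polygon, hence is a multiple of \<open>\<phi>\<close>.
\<close>

lemma nct_defined_over_subfield:
  fixes \<phi> :: "'k::field laurent"
  assumes nct: "is_nct r \<phi>" and r: "r > 0" and K: "is_subfield K"
  obtains c where "c \<noteq> 0" "\<And>m. coef (laurent_scale c \<phi>) m \<in> K"
proof -
  obtain m0 where m0: "m0 \<in> supp \<phi>" using nctD(4)[OF nct] supp_eq_empty_iff[of \<phi>] by blast
  define f where "f = laurent_scale (inverse (coef \<phi> m0)) \<phi>"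
  have f0: "coef f m0 = 1" using m0 by (simp add: f_def in_keys_iff)
  have f: "supp f \<subseteq> supp \<phi>" "f \<in> pow_p r"
    using m0 nctD(2)[OF nct] by (simp_all add: f_def in_keys_iff pow_p_scale)
  have "1 \<in> K" using K by (simp add: is_subfield_def)
  obtain g where g: "supp g \<subseteq> supp \<phi>" "g \<in> pow_p r" "\<And>m. coef g m \<in> K"
    "\<And>m. m \<in> {m0} \<Longrightarrow> coef g m = coef f m"
    by (rule descend_pow_p[OF K finite_keys f(1,2), of "{m0}"]) (use m0 f0 \<open>1 \<in> K\<close> in auto)
  obtain c where c: "g = laurent_scale c \<phi>"
    by (rule nct_unique_in_newton_polygon[OF nct r g(2) subset_trans[OF g(1) supp_subset_newton]])
  have "coef g m0 = 1" using g(4)[of m0] f0 by simp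
  then have "c \<noteq> 0" by (auto simp: c)
  then show ?thesis using that g(3) unfolding c by blast
qed

section \<open>The multiplicity is exact\<close>

text \<open>
  For \<open>l = fst\<close> and \<open>l = snd\<close> these are the logarithmic derivatives \<open>v d/dv\<close> and \<open>w d/dw\<close>.
\<close>

definition euler :: "(int \<times> int \<Rightarrow> int) \<Rightarrow> 'k::field laurent \<Rightarrow> 'k laurent" where
  "euler l f = (\<Sum>m\<in>supp f. term_of m (of_int (l m) * coef f m))"

lemma coef_euler: "coef (euler l f) m = of_int (l m) * coef f m"
proof -
  have "coef (euler l f) m = (\<Sum>k\<in>supp f. if k = m then of_int (l m) * coef f m else 0)"
    unfolding euler_def lookup_sum by (rule sum.cong) (auto simp: lookup_single when_def)
  then show ?thesis by (simp add: in_keys_iff)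
qed

lemma supp_euler: "supp (euler l f) \<subseteq> supp f"
  by (auto simp: in_keys_iff coef_euler)

lemma euler_pow_p:
  assumes "f \<in> pow_p (Suc n)"
  shows "euler fst f \<in> pow_p n" "euler snd f \<in> pow_p n"
proof -
  have t: "taylor i j (euler l f) = (\<Sum>m\<in>supp f. coef f m * of_int (l m * (ibinom (fst m) i * ibinom (snd m) j)))"
    for i j l
    by (simp add: taylor_superset[OF finite_keys supp_euler] coef_euler mult.assoc mult.left_commute)
  have "taylor i j (euler fst f) = of_int (int (Suc i)) * taylor (Suc i) j f + of_int (int i) * taylor i j f" for i j
    unfolding t
    by (subst mult.assoc[symmetric], subst ibinom_times)
       (simp add: taylor_def sum_distrib_left sum.distrib[symmetric] algebra_simps)
  then have "taylor i j (euler fst f) = 0" if "i + j < n" for i j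
    using taylor_pow_p[OF assms, of "Suc i" j] taylor_pow_p[OF assms, of i j] that by simp
  then show "euler fst f \<in> pow_p n" by (simp add: pow_p_iff_taylor)
  have "taylor i j (euler snd f) = of_int (int (Suc j)) * taylor i (Suc j) f + of_int (int j) * taylor i j f" for i j
    unfolding t
    by (subst mult.left_commute, subst ibinom_times)
       (simp add: taylor_def sum_distrib_left sum.distrib[symmetric] algebra_simps)
  then have "taylor i j (euler snd f) = 0" if "i + j < n" for i j
    using taylor_pow_p[OF assms, of i "Suc j"] taylor_pow_p[OF assms, of i j] that by simp
  then show "euler snd f \<in> pow_p n" by (simp add: pow_p_iff_taylor)
qed

lemma CHAR_laurent: "CHAR('k::field laurent) = CHAR('k)"
proof (rule CHAR_eqI)
  have e: "(of_nat n :: 'k laurent) = 0 \<longleftrightarrow> (of_nat n :: 'k) = 0" for n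
  proof
    assume "(of_nat n :: 'k laurent) = 0"
    from arg_cong[OF this, of "\<lambda>f. coef f 0"] show "(of_nat n :: 'k) = 0" by (simp add: lookup_of_nat)
  next
    assume "(of_nat n :: 'k) = 0"
    then have "term_of 0 (of_nat n :: 'k) = 0" by simp
    then show "(of_nat n :: 'k laurent) = 0" by (simp only: single_of_nat)
  qed
  show "of_nat CHAR('k) = (0 :: 'k laurent)" by (simp add: e)
  show "CHAR('k) dvd n" if "of_nat n = (0 :: 'k laurent)" for n
    using that by (simp only: e of_nat_eq_0_iff_char_dvd)
qed

text \<open>
  In characteristic \<open>p\<close> the prime field is contained in this subfield, so its elements are their own
  \<open>p\<close>-th powers.
\<close>

lemma frobenius_fixed_subfield:
  assumes "prime p" "p = CHAR('k::field)"
  shows "is_subfield {c :: 'k. c ^ p = c}"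
proof -
  have p: "prime CHAR('k)" using assms by simp
  have p0: "p > 0" using assms(1) by (rule prime_gt_0_nat)
  have neg: "(- x) ^ p = - x" if "x ^ p = x" for x :: 'k
  proof -
    have "0 = (x + - x) ^ p" using p0 by simp
    also have "\<dots> = x ^ p + (- x) ^ p" unfolding assms(2) by (rule freshmans_dream[OF p refl])
    finally show ?thesis using that by (simp add: eq_neg_iff_add_eq_0 add.commute)
  qed
  show ?thesis
    unfolding is_subfield_def
    using p0 neg freshmans_dream[OF p assms(2)] by (auto simp: power_mult_distrib power_inverse)
qed

lemma power_char_sum_terms:
  fixes k :: "int \<times> int \<Rightarrow> int \<times> int"
  assumes p: "prime p" "p = CHAR('k::field)" and c: "\<And>m. m \<in> A \<Longrightarrow> c m ^ p = (c m :: 'k)"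
  shows "(\<Sum>m\<in>A. term_of (k m) (c m)) ^ p = (\<Sum>m\<in>A. term_of (zmult (int p) (k m)) (c m))"
proof -
  have pow: "term_of a d ^ n = term_of (zmult (int n) a) (d ^ n)" for a and d :: 'k and n
  proof (induction n)
    case 0
    then show ?case by (simp add: zmult_def flip: zero_prod_def)
  next
    case (Suc n)
    then show ?case by (cases a) (simp add: mult_single zmult_def algebra_simps)
  qed
  have "(\<Sum>m\<in>A. term_of (k m) (c m)) ^ p = (\<Sum>m\<in>A. term_of (k m) (c m) ^ p)"
    by (rule freshmans_dream_sum) (use p CHAR_laurent[where 'k = 'k] in simp_all)
  also have "\<dots> = (\<Sum>m\<in>A. term_of (zmult (int p) (k m)) (c m))"
    by (rule sum.cong) (simp_all add: pow c)
  finally show ?thesis .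
qed

text \<open>
  If \<open>\<phi>\<close> had order \<open>r + 1\<close>, its logarithmic derivatives would have order \<open>r\<close> and so be multiples of
  \<open>\<phi>\<close>: all exponents would be congruent modulo the characteristic. In characteristic \<open>0\<close> this leaves
  one term. In characteristic \<open>p\<close> it makes a multiple of \<open>\<phi>\<close> a monomial times a \<open>p\<close>-th power, as the
  coefficients may be taken in the prime field. Neither is irreducible.
\<close>

theorem nct_order_exact:
  fixes \<phi> :: "'k::field laurent"
  assumes nct: "is_nct r \<phi>" and r: "r > 0"
  shows "\<phi> \<notin> pow_p (r + 1)"
proof
  assume "\<phi> \<in> pow_p (r + 1)"
  then have in_Suc: "\<phi> \<in> pow_p (Suc r)" by (simp only: Suc_eq_plus1)
  obtain m0 where m0: "m0 \<in> supp \<phi>" using nctD(4)[OF nct] supp_eq_empty_iff[of \<phi>] by blast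
  have const: "int CHAR('k) dvd l m - l m0" if l: "euler l \<phi> \<in> pow_p r" and m: "m \<in> supp \<phi>" for l m
  proof -
    obtain c where c: "euler l \<phi> = laurent_scale c \<phi>"
      by (rule nct_unique_in_newton_polygon[OF nct r l subset_trans[OF supp_euler supp_subset_newton]])
    have "of_int (l k) = c" if "k \<in> supp \<phi>" for k
    proof -
      have "of_int (l k) * coef \<phi> k = c * coef \<phi> k"
        using arg_cong[OF c, of "\<lambda>f. coef f k"] by (simp only: coef_euler coef_scale)
      then show ?thesis using that by (simp add: in_keys_iff)
    qed
    then have "(of_int (l m - l m0) :: 'k) = 0" using m m0 by simp
    then show ?thesis by (simp only: of_int_eq_0_iff_char_dvd)
  qed
  define p where "p = CHAR('k)"
  have dvd: "int p dvd fst m - fst m0" "int p dvd snd m - snd m0" if "m \<in> supp \<phi>" for m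
    using const[OF euler_pow_p(1)[OF in_Suc] that] const[OF euler_pow_p(2)[OF in_Suc] that]
    by (simp_all add: p_def)
  show False
  proof (cases "p = 0")
    case True
    then have "m = m0" if "m \<in> supp \<phi>" for m using dvd[OF that] by (simp add: prod_eq_iff)
    then have "supp \<phi> = {m0}" using m0 by blast
    then show False using nctD(5)[OF nct] unfolding laurent_unit_iff by blast
  next
    case False
    then have p: "prime p" "p = CHAR('k)" using prime_CHAR_semidom[where 'a = 'k] by (simp_all add: p_def)
    have fixed: "prime_field \<subseteq> {c :: 'k. c ^ p = c}"
      by (rule prime_field_subset[OF frobenius_fixed_subfield[OF p]])
    obtain c where c: "c \<noteq> 0" "\<And>m. coef (laurent_scale c \<phi>) m \<in> prime_field"
    proof (rule nct_defined_over_subfield[OF nct r is_subfield_prime_field])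
      fix c assume "c \<noteq> 0" "\<And>m. coef (laurent_scale c \<phi>) m \<in> prime_field"
      then show thesis by (rule that)
    qed
    define \<psi> where "\<psi> = laurent_scale c \<phi>"
    define k where "k m = ((fst m - fst m0) div int p, (snd m - snd m0) div int p)" for m
    have k: "m = m0 + zmult (int p) (k m)" if "m \<in> supp \<phi>" for m
      using dvd[OF that] by (simp add: k_def zmult_def prod_eq_iff)
    define g where "g = (\<Sum>m\<in>supp \<phi>. term_of (k m) (coef \<psi> m))"
    have "laurent_monom m0 * g ^ p = (\<Sum>m\<in>supp \<phi>. laurent_monom m0 * term_of (zmult (int p) (k m)) (coef \<psi> m))"
      unfolding g_def using c(2) fixed
      by (subst power_char_sum_terms[OF p]) (auto simp: \<psi>_def sum_distrib_left)
    also have "\<dots> = (\<Sum>m\<in>supp \<phi>. term_of m (coef \<psi> m))"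
      by (rule sum.cong) (simp_all add: laurent_monom_def mult_single flip: k)
    also have "\<dots> = \<psi>" using sum_terms[of \<psi>] c(1) by (simp add: \<psi>_def)
    finally have \<psi>: "\<psi> = laurent_monom m0 * g ^ p" ..
    have irr: "irreducible \<psi>" unfolding \<psi>_def by (rule irreducible_scale[OF c(1) nctD(1)[OF nct]])
    define q where "q = p - 2"
    have q: "p = Suc (Suc q)" using prime_ge_2_nat[OF p(1)] by (simp add: q_def)
    have "\<psi> = (laurent_monom m0 * g ^ Suc q) * g" unfolding \<psi> q by (simp only: power_Suc ac_simps)
    then have "laurent_monom m0 * g ^ Suc q dvd 1 \<or> g dvd 1" by (rule irreducibleD[OF irr])
    then have "g dvd 1"
    proof
      assume "laurent_monom m0 * g ^ Suc q dvd 1"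
      then have "g ^ Suc q dvd 1" by (rule dvd_mult_right)
      then show ?thesis unfolding power_Suc by (rule dvd_mult_left)
    qed
    then have "g ^ p dvd 1 ^ p" by (rule dvd_power_same)
    then have "g ^ p dvd 1" by simp
    then have "\<psi> dvd 1" unfolding \<psi> by (simp only: unit_mult_dvd_iff[OF monom_unit])
    then show False using irr by (simp add: irreducible_def)
  qed
qed

section \<open>Extension of the base field\<close>

context
  fixes h :: "'k::field \<Rightarrow> 'l::field"
  assumes hom: "is_ring_hom h"
begin

lemma hom_add: "h (x + y) = h x + h y" and hom_mult: "h (x * y) = h x * h y" and hom_1: "h 1 = 1"
  using hom by (auto simp: is_ring_hom_def)

lemma hom_0: "h 0 = 0"
proof -
  have "h 0 + h 0 = h 0 + 0" by (simp flip: hom_add)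
  then show ?thesis by (rule add_left_imp_eq)
qed

lemma hom_uminus: "h (- x) = - h x"
  using hom_add[of "- x" x] by (simp add: hom_0 eq_neg_iff_add_eq_0)

lemma hom_inverse: "h (inverse x) = inverse (h x)"
proof (cases "x = 0")
  case False
  then have "h x * h (inverse x) = 1" by (simp flip: hom_mult add: hom_1)
  then show ?thesis by (rule inverse_unique[symmetric])
qed (simp add: hom_0)

lemma hom_eq_0_iff: "h x = 0 \<longleftrightarrow> x = 0"
  using hom_mult[of x "inverse x"] by (cases "x = 0") (auto simp: hom_0 hom_1)

lemma hom_sum: "h (sum f A) = (\<Sum>x\<in>A. h (f x))"
  by (induction A rule: infinite_finite_induct) (simp_all add: hom_0 hom_add)

lemma hom_of_int: "h (of_int n) = of_int n"
proof -
  have nat: "h (of_nat m) = of_nat m" for m by (induction m) (simp_all add: hom_0 hom_add hom_1)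
  show ?thesis
  proof (cases "n \<ge> 0")
    case True
    then have "\<exists>m. n = int m" by (rule nonneg_int_cases) blast
    then show ?thesis using nat by auto
  next
    case False
    then have "n = - int (nat (- n))" by simp
    then obtain m where "n = - int m" by blast
    then show ?thesis using nat by (simp add: hom_uminus)
  qed
qed

lemma is_subfield_range: "is_subfield (range h)"
proof -
  have "0 \<in> range h" "1 \<in> range h" using rangeI[of h 0] rangeI[of h 1] by (simp_all only: hom_0 hom_1)
  moreover have "h a + h b \<in> range h" "h a * h b \<in> range h" "- h a \<in> range h" "inverse (h a) \<in> range h" for a b
    by (simp_all only: rangeI flip: hom_add hom_mult hom_uminus hom_inverse)
  ultimately show ?thesis unfolding is_subfield_def by blast
qed

lemma coef_map: "coef (Poly_Mapping.map h f) m = h (coef f m)"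
  by (simp add: Poly_Mapping.map.rep_eq when_def hom_0)

lemma supp_map: "supp (Poly_Mapping.map h f) = supp f"
  by (auto simp: in_keys_iff coef_map hom_eq_0_iff)

lemma map_mult: "Poly_Mapping.map h (f * g :: 'k laurent) = Poly_Mapping.map h f * Poly_Mapping.map h g"
proof (rule poly_mapping_eqI)
  fix m
  show "coef (Poly_Mapping.map h (f * g)) m = coef (Poly_Mapping.map h f * Poly_Mapping.map h g) m"
    by (simp add: coef_mult[of "supp f"] coef_map supp_map hom_sum hom_mult)
qed

lemma taylor_map: "taylor i j (Poly_Mapping.map h f) = h (taylor i j f)"
  by (simp add: taylor_def supp_map coef_map hom_sum hom_mult hom_of_int del: of_int_mult)

lemma map_pow_p_iff: "Poly_Mapping.map h f \<in> pow_p n \<longleftrightarrow> f \<in> pow_p n"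
  by (simp add: pow_p_iff_taylor taylor_map hom_eq_0_iff)

lemma newton_polygon_map: "newton_polygon (Poly_Mapping.map h f) = newton_polygon f"
  by (simp add: newton_polygon_def supp_map)

lemma map_preimage:
  assumes "\<And>m. coef g m \<in> range h"
  obtains f where "g = Poly_Mapping.map h f" "supp f = supp g"
proof -
  define a where "a m = (SOME x. h x = coef g m)" for m
  have a: "h (a m) = coef g m" for m
    unfolding a_def by (rule someI_ex) (use assms[of m] in \<open>metis rangeE\<close>)
  define f where "f = (\<Sum>m\<in>supp g. term_of m (a m))"
  have "coef f m = (if m \<in> supp g then a m else 0)" for m
    by (simp add: f_def lookup_sum lookup_single when_def)
  then have "g = Poly_Mapping.map h f"
    by (intro poly_mapping_eqI) (simp add: coef_map a hom_0 in_keys_iff)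
  then show ?thesis by (rule that) (simp add: supp_map \<open>g = _\<close>)
qed

text \<open>
  A linear system with integer coefficients has the same dimension over both fields. Here this is
  made explicit: an element that is not a multiple could be descended, with a coefficient \<open>0\<close> at one
  exponent of \<open>\<phi>\<close> and a coefficient \<open>1\<close> elsewhere.
\<close>

lemma nct_unique_over_extension:
  assumes nct: "is_nct r \<phi>" and r: "r > 0"
    and f: "f \<in> pow_p r" "supp f \<subseteq> newton_lattice_points \<phi>"
  obtains c where "f = laurent_scale c (Poly_Mapping.map h \<phi>)"
proof -
  define \<Phi> where "\<Phi> = Poly_Mapping.map h \<phi>"
  let ?S = "newton_lattice_points \<phi>"
  have \<Phi>: "\<Phi> \<in> pow_p r" "supp \<Phi> \<subseteq> ?S"
    using nctD(2)[OF nct] supp_subset_newton by (simp_all add: \<Phi>_def map_pow_p_iff supp_map)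
  obtain m0 where m0: "m0 \<in> supp \<phi>" using nctD(4)[OF nct] supp_eq_empty_iff[of \<phi>] by blast
  then have m0': "coef \<Phi> m0 \<noteq> 0" by (simp add: \<Phi>_def coef_map hom_eq_0_iff in_keys_iff)
  \<comment> \<open>\<open>f1\<close> is the part of \<open>f\<close> that vanishes at \<open>m0\<close>; if
    it is nonzero, normalizing it at \<open>m1\<close> gives values \<open>0\<close> and
    \<open>1\<close> at these exponents, which are in the image of the smaller field\<close>
  define c where "c = coef f m0 / coef \<Phi> m0"
  define f1 where "f1 = f - laurent_scale c \<Phi>"
  have "f1 = 0"
  proof (rule ccontr)
    assume "f1 \<noteq> 0"
    then obtain m1 where m1: "m1 \<in> supp f1" using supp_eq_empty_iff[of f1] by blast
    define f2 where "f2 = laurent_scale (inverse (coef f1 m1)) f1"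
    have c0: "coef f2 m0 = 0" using m0' by (simp add: f2_def f1_def c_def lookup_minus)
    have c1: "coef f2 m1 = 1" using m1 by (simp add: f2_def in_keys_iff)
    have f2: "f2 \<in> pow_p r"
      unfolding f2_def f1_def by (intro pow_p_scale pow_p_diff f \<Phi>)
    have "f1 \<in> supported ?S"
      unfolding f1_def using f(2) \<Phi>(2)
      by (intro laurent.subspace_diff laurent.subspace_scale supported_subspace) (simp_all add: supported_def)
    then have "f2 \<in> supported ?S"
      unfolding f2_def by (rule laurent.subspace_scale[OF supported_subspace])
    then have f2S: "supp f2 \<subseteq> ?S" by (simp add: supported_def)
    have m1S: "m1 \<in> supp f2" using c1 by (simp add: in_keys_iff)
    have "0 \<in> range h" "1 \<in> range h" using is_subfield_range by (simp_all add: is_subfield_def)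
    then have T: "{m0, m1} \<subseteq> ?S" "\<And>m. m \<in> {m0, m1} \<Longrightarrow> coef f2 m \<in> range h"
      using c0 c1 m0 m1S f2S supp_subset_newton[of \<phi>] by auto
    obtain g where g: "supp g \<subseteq> ?S" "g \<in> pow_p r" "\<And>m. coef g m \<in> range h"
      "\<And>m. m \<in> {m0, m1} \<Longrightarrow> coef g m = coef f2 m"
    proof (rule descend_pow_p[OF is_subfield_range finite_newton_lattice_points f2S f2 T])
      fix g assume "supp g \<subseteq> ?S" "g \<in> pow_p r" "\<And>m. coef g m \<in> range h"
        "\<And>m. m \<in> {m0, m1} \<Longrightarrow> coef g m = coef f2 m"
      then show thesis by (rule that)
    qed
    obtain g' where g': "g = Poly_Mapping.map h g'" "supp g' = supp g" by (rule map_preimage[OF g(3)])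
    have "g' \<in> pow_p r" "supp g' \<subseteq> ?S" using g(1,2) g' by (simp_all add: map_pow_p_iff)
    then obtain e where e: "g' = laurent_scale e \<phi>" by (rule nct_unique_in_newton_polygon[OF nct r])
    have "h (coef g' m0) = 0" using g(4)[of m0] c0 by (simp add: g'(1) coef_map)
    then have "e = 0" using m0 by (simp add: e hom_eq_0_iff in_keys_iff)
    then have "coef g m1 = 0" by (simp add: g'(1) coef_map e hom_0)
    then show False using g(4)[of m1] c1 by simp
  qed
  then have "f = laurent_scale c \<Phi>" by (simp add: f1_def)
  then show ?thesis unfolding \<Phi>_def by (rule that)
qed

text \<open>
  Let \<open>\<psi>'\<close> have order \<open>a\<close> and be supported in the support of \<open>\<psi>\<close>. Then \<open>\<psi>' \<eta>\<close> belongs to the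
  one-dimensional linear system of \<open>\<phi>\<close>, so \<open>\<psi>'\<close> is a multiple of \<open>\<psi>\<close>. Such an element \<open>\<psi>'\<close> exists
  over the smaller field, since \<open>\<psi>\<close> itself can be descended.
\<close>

lemma nct_factor_descends:
  assumes nct: "is_nct r \<phi>" and r: "r > 0"
    and fac: "Poly_Mapping.map h \<phi> = \<psi> * \<eta>" and \<psi>: "\<psi> \<in> pow_p a" and \<eta>: "\<eta> \<in> pow_p b" and ab: "a + b = r"
  obtains c \<rho> where "\<psi> = laurent_scale c (Poly_Mapping.map h \<rho>)" "supp \<rho> = supp \<psi>" "c \<noteq> 0"
proof -
  have "Poly_Mapping.map h \<phi> \<noteq> 0"
    using nctD(4)[OF nct] supp_map[of \<phi>] by (metis supp_eq_empty_iff)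
  then have nz: "\<psi> \<noteq> 0" "\<eta> \<noteq> 0" unfolding fac by auto
  obtain m0 where m0: "m0 \<in> supp \<psi>" using nz supp_eq_empty_iff[of \<psi>] by blast
  define f where "f = laurent_scale (inverse (coef \<psi> m0)) \<psi>"
  have f0: "coef f m0 = 1" using m0 by (simp add: f_def in_keys_iff)
  have f: "supp f \<subseteq> supp \<psi>" "f \<in> pow_p a"
    using m0 \<psi> by (simp_all add: f_def in_keys_iff pow_p_scale)
  have "1 \<in> range h" using is_subfield_range by (simp add: is_subfield_def)
  obtain g where g: "supp g \<subseteq> supp \<psi>" "g \<in> pow_p a" "\<And>m. coef g m \<in> range h"
    "\<And>m. m \<in> {m0} \<Longrightarrow> coef g m = coef f m"
    by (rule descend_pow_p[OF is_subfield_range finite_keys f(1,2), of "{m0}"])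
       (use m0 f0 \<open>1 \<in> range h\<close> in auto)
  have "g * \<eta> \<in> pow_p r" using pow_p_mult[OF g(2) \<eta>] ab by simp
  moreover have "supp (g * \<eta>) \<subseteq> newton_lattice_points \<phi>"
  proof
    fix m assume "m \<in> supp (g * \<eta>)"
    then obtain k l where kl: "m = k + l" "k \<in> supp \<psi>" "l \<in> supp \<eta>"
      using subsetD[OF supp_mult] g(1) by blast
    have "m \<in> newton_lattice_points (\<psi> * \<eta>)" unfolding kl(1) by (rule supp_add_in_newton[OF nz kl(2,3)])
    then show "m \<in> newton_lattice_points \<phi>"
      by (simp add: newton_lattice_points_def newton_polygon_map flip: fac)
  qed
  ultimately obtain e where e: "g * \<eta> = laurent_scale e (Poly_Mapping.map h \<phi>)"
    by (rule nct_unique_over_extension[OF nct r])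
  have "\<eta> * g = \<eta> * laurent_scale e \<psi>"
    using e unfolding fac scale_mult_right by (simp only: mult.commute)
  then have ge: "g = laurent_scale e \<psi>" by (rule iffD1[OF laurent_mult_cancel[OF nz(2)]])
  have "coef g m0 = 1" using g(4)[of m0] f0 by simp
  then have e0: "e \<noteq> 0" by (auto simp: ge)
  obtain \<rho> where \<rho>: "g = Poly_Mapping.map h \<rho>" "supp \<rho> = supp g" by (rule map_preimage[OF g(3)])
  have "\<psi> = laurent_scale (inverse e) (Poly_Mapping.map h \<rho>)"
    by (simp only: ge laurent.scale_scale left_inverse[OF e0] laurent.scale_one flip: \<rho>(1))
  moreover have "supp \<rho> = supp \<psi>" using e0 by (simp add: \<rho>(2) ge)
  ultimately show ?thesis by (rule that[OF _ _ nonzero_imp_inverse_nonzero[OF e0]])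
qed

text \<open>
  Only irreducibility is in question. The factors of a factorization share the multiplicity \<open>r\<close>
  between them, so both are, up to scalars, defined over the smaller field, where one of them is a
  unit.
\<close>

theorem nct_base_change:
  assumes nct: "is_nct r \<phi>" and r: "r > 0"
  shows "is_nct r (Poly_Mapping.map h \<phi>)"
proof -
  have "irreducible (Poly_Mapping.map h \<phi>)"
  proof (rule irreducibleI)
    show "Poly_Mapping.map h \<phi> \<noteq> 0"
      using nctD(4)[OF nct] supp_map[of \<phi>] by (metis supp_eq_empty_iff)
    show "\<not> Poly_Mapping.map h \<phi> dvd 1"
      using nctD(5)[OF nct] unfolding laurent_unit_iff supp_map .
    fix \<psi> \<eta> assume fac: "Poly_Mapping.map h \<phi> = \<psi> * \<eta>"
    have "\<psi> * \<eta> \<in> pow_p r" using nctD(2)[OF nct] by (simp add: map_pow_p_iff flip: fac)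
    then obtain a b where ab: "a + b = r" "\<psi> \<in> pow_p a" "\<eta> \<in> pow_p b" by (rule pow_p_mult_split)
    obtain c \<rho> where \<rho>: "\<psi> = laurent_scale c (Poly_Mapping.map h \<rho>)" "supp \<rho> = supp \<psi>" "c \<noteq> 0"
      by (rule nct_factor_descends[OF nct r fac ab(2,3,1)])
    have fac': "Poly_Mapping.map h \<phi> = \<eta> * \<psi>" unfolding fac by (rule mult.commute)
    have ba: "b + a = r" using ab(1) by simp
    obtain d \<theta> where \<theta>: "\<eta> = laurent_scale d (Poly_Mapping.map h \<theta>)" "supp \<theta> = supp \<eta>" "d \<noteq> 0"
      by (rule nct_factor_descends[OF nct r fac' ab(3,2) ba])
    have fac2: "Poly_Mapping.map h \<phi> = laurent_scale (c * d) (Poly_Mapping.map h (\<rho> * \<theta>))"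
      unfolding fac \<rho>(1) \<theta>(1) by (simp only: scale_mult_left scale_mult_right map_mult laurent.scale_scale mult.commute)
    obtain m where m: "m \<in> supp \<phi>" using nctD(4)[OF nct] supp_eq_empty_iff[of \<phi>] by blast
    have eq: "h (coef \<phi> n) = c * d * h (coef (\<rho> * \<theta>) n)" for n
      using arg_cong[OF fac2, of "\<lambda>f. coef f n"] by (simp add: coef_map)
    have "h (coef \<phi> m) \<noteq> 0" using m by (simp add: hom_eq_0_iff in_keys_iff)
    then have h0: "h (coef (\<rho> * \<theta>) m) \<noteq> 0" using eq[of m] by auto
    define e where "e = coef \<phi> m * inverse (coef (\<rho> * \<theta>) m)"
    have "h e = c * d" using eq[of m] h0 by (simp add: e_def hom_mult hom_inverse)
    then have "h (coef \<phi> n) = h (e * coef (\<rho> * \<theta>) n)" for n using eq[of n] by (simp add: hom_mult)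
    then have "h (coef \<phi> n - e * coef (\<rho> * \<theta>) n) = 0" for n
      by (simp add: hom_add hom_uminus diff_conv_add_uminus del: add_uminus_conv_diff)
    then have "coef \<phi> n = coef (laurent_scale e (\<rho> * \<theta>)) n" for n by (simp add: hom_eq_0_iff)
    then have "\<phi> = laurent_scale e \<rho> * \<theta>" unfolding scale_mult_left by (rule poly_mapping_eqI)
    then have "laurent_scale e \<rho> dvd 1 \<or> \<theta> dvd 1" by (rule irreducibleD[OF nctD(1)[OF nct]])
    moreover have "e \<noteq> 0" using \<open>h (coef \<phi> m) \<noteq> 0\<close> h0 by (auto simp: e_def hom_eq_0_iff)
    ultimately have "(\<exists>m. supp \<rho> = {m}) \<or> (\<exists>m. supp \<theta> = {m})" by (simp add: laurent_unit_iff)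
    then show "\<psi> dvd 1 \<or> \<eta> dvd 1" unfolding \<rho>(2) \<theta>(2) laurent_unit_iff .
  qed
  then show ?thesis
    using nctD(2,3)[OF nct] by (simp add: is_nct_def map_pow_p_iff newton_polygon_map)
qed

end

section \<open>Monomial substitutions\<close>

definition lattice_auto :: "(int \<times> int \<Rightarrow> int \<times> int) \<Rightarrow> bool" where
  "lattice_auto M \<longleftrightarrow> bij M \<and> (\<forall>x y. M (x + y) = M x + M y)"

abbreviation inverse_fun :: "('a \<Rightarrow> 'b) \<Rightarrow> 'b \<Rightarrow> 'a" where
  "inverse_fun \<equiv> inv_into UNIV"

definition subst_monom :: "(int \<times> int \<Rightarrow> int \<times> int) \<Rightarrow> 'k::field laurent \<Rightarrow> 'k laurent" where
  "subst_monom M f = (\<Sum>m\<in>supp f. term_of (M m) (coef f m))"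

definition real_extension :: "(int \<times> int \<Rightarrow> int \<times> int) \<Rightarrow> real \<times> real \<Rightarrow> real \<times> real" where
  "real_extension M x = fst x *\<^sub>R lattice_point (M (1, 0)) + snd x *\<^sub>R lattice_point (M (0, 1))"

lemma lattice_auto_add: "lattice_auto M \<Longrightarrow> M (x + y) = M x + M y"
  unfolding lattice_auto_def by blast

lemma lattice_auto_bij: "lattice_auto M \<Longrightarrow> bij M"
  unfolding lattice_auto_def by blast

lemma lattice_auto_inj: "lattice_auto M \<Longrightarrow> inj M"
  by (rule bij_is_inj[OF lattice_auto_bij])

lemma lattice_auto_zmult:
  assumes "lattice_auto M"
  shows "M (zmult t d) = zmult t (M d)"
proof -
  note add = lattice_auto_add[OF assms]
  have "M 0 + M 0 = M 0 + 0" by (simp flip: add)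
  then have M0: "M 0 = 0" by (rule add_left_imp_eq)
  have z1: "zmult (i + 1) e = zmult i e + e" "zmult (i - 1) e = zmult i e - e" for i e
    by (simp_all add: zmult_def prod_eq_iff algebra_simps)
  have diff: "M (x - y) = M x - M y" for x y using add[of "x - y" y] by (simp add: algebra_simps)
  show ?thesis
  proof (induction t rule: int_induct[of _ 0])
    case base
    then show ?case using M0 by (simp add: zmult_def zero_prod_def)
  qed (simp_all add: z1 add diff)
qed

lemma lattice_auto_eq:
  assumes "lattice_auto M"
  shows "M m = zmult (fst m) (M (1, 0)) + zmult (snd m) (M (0, 1))"
proof -
  have "m = zmult (fst m) (1, 0) + zmult (snd m) (0, 1)" by (simp add: zmult_def prod_eq_iff)
  then have "M m = M (zmult (fst m) (1, 0) + zmult (snd m) (0, 1))" by simp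
  also have "\<dots> = M (zmult (fst m) (1, 0)) + M (zmult (snd m) (0, 1))"
    by (rule lattice_auto_add[OF assms])
  finally show ?thesis by (simp only: lattice_auto_zmult[OF assms])
qed

lemma lattice_auto_inv:
  assumes "lattice_auto M"
  shows "lattice_auto (inverse_fun M)" "inverse_fun M (M m) = m" "M (inverse_fun M m) = m"
proof -
  note b = lattice_auto_bij[OF assms] and add = lattice_auto_add[OF assms]
  show i: "inverse_fun M (M m) = m" and j: "M (inverse_fun M m) = m" for m
    using b by (simp_all add: bij_is_inj bij_is_surj surj_f_inv_f)
  have "inverse_fun M (x + y) = inverse_fun M x + inverse_fun M y" for x y
    using i[of "inverse_fun M x + inverse_fun M y"] by (simp add: add j)
  then show "lattice_auto (inverse_fun M)" unfolding lattice_auto_def using bij_imp_bij_inv[OF b] by blast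
qed

lemma lattice_auto_set_eqI:
  assumes M: "lattice_auto M" and eq: "\<And>m. m \<in> A \<longleftrightarrow> inverse_fun M m \<in> B"
  shows "A = M ` B"
proof (intro subset_antisym subsetI)
  fix m assume "m \<in> A"
  then have "M (inverse_fun M m) \<in> M ` B" unfolding eq by (rule imageI)
  then show "m \<in> M ` B" by (simp only: lattice_auto_inv(3)[OF M])
next
  fix m assume "m \<in> M ` B"
  then obtain k where "m = M k" "k \<in> B" by (rule imageE)
  then show "m \<in> A" by (simp only: eq lattice_auto_inv(2)[OF M])
qed

lemma lattice_auto_zero: "lattice_auto M \<Longrightarrow> M 0 = 0"
  using lattice_auto_zmult[of M 0 0] by (simp add: zmult_def zero_prod_def)

lemma lattice_autoI:
  assumes "\<And>x y. M (x + y) = M x + M y" "\<And>m. M' (M m) = m" "\<And>m. M (M' m) = m"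
  shows "lattice_auto M"
proof -
  have "bij M" by (rule o_bij[of M']) (use assms(2,3) in \<open>simp_all add: fun_eq_iff\<close>)
  then show ?thesis unfolding lattice_auto_def using assms(1) by blast
qed

lemma coef_subst_monom:
  assumes "lattice_auto M"
  shows "coef (subst_monom M f) (M m) = coef f m"
proof -
  have "inj M" by (rule lattice_auto_inj[OF assms])
  then have "coef (subst_monom M f) (M m) = (\<Sum>k\<in>supp f. if k = m then coef f k else 0)"
    unfolding subst_monom_def lookup_sum by (intro sum.cong) (auto simp: lookup_single when_def inj_eq)
  then show ?thesis by (simp add: in_keys_iff)
qed

lemma supp_subst_monom:
  assumes "lattice_auto M"
  shows "supp (subst_monom M f) = M ` supp f"
proof -
  have "m \<in> supp (subst_monom M f) \<longleftrightarrow> inverse_fun M m \<in> supp f" for m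
    using coef_subst_monom[OF assms, of f "inverse_fun M m"] by (simp add: lattice_auto_inv[OF assms] in_keys_iff)
  then show ?thesis by (rule lattice_auto_set_eqI[OF assms])
qed

lemma laurent_eqI_auto:
  assumes "lattice_auto M" "\<And>m. coef f (M m) = coef g (M m)"
  shows "f = g"
proof (rule poly_mapping_eqI)
  fix m show "coef f m = coef g m"
    using assms(2)[of "inverse_fun M m"] unfolding lattice_auto_inv(3)[OF assms(1)] .
qed

lemma subst_monom_add:
  assumes M: "lattice_auto M"
  shows "subst_monom M (f + g) = subst_monom M f + subst_monom M g"
  by (rule laurent_eqI_auto[OF M]) (simp add: coef_subst_monom[OF M] lookup_add)

lemma subst_monom_term:
  assumes M: "lattice_auto M"
  shows "subst_monom M (term_of m c) = term_of (M m) c"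
  by (rule laurent_eqI_auto[OF M])
     (simp add: coef_subst_monom[OF M] lookup_single when_def inj_eq[OF lattice_auto_inj[OF M]])

lemma subst_monom_0: "subst_monom M 0 = 0"
  by (simp add: subst_monom_def)

lemma subst_monom_mult:
  assumes "lattice_auto M"
  shows "subst_monom M (f * g) = subst_monom M f * subst_monom M g"
proof (induction f rule: laurent_induct)
  case (monomial a c)
  show ?case
  proof (induction g rule: laurent_induct)
    case (monomial b d)
    show ?case using assms by (simp add: mult_single subst_monom_term lattice_auto_add)
  qed (simp_all add: subst_monom_0 subst_monom_add[OF assms] distrib_left)
qed (simp_all add: subst_monom_0 subst_monom_add[OF assms] distrib_right)

lemma subst_monom_inv: "lattice_auto M \<Longrightarrow> subst_monom (inverse_fun M) (subst_monom M f) = f"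
proof (rule laurent_eqI_auto[OF lattice_auto_inv(1)])
  assume M: "lattice_auto M"
  fix m
  have "coef (subst_monom M f) m = coef f (inverse_fun M m)"
    using coef_subst_monom[OF M, of f "inverse_fun M m"] by (simp add: lattice_auto_inv(3)[OF M])
  then show "coef (subst_monom (inverse_fun M) (subst_monom M f)) (inverse_fun M m) = coef f (inverse_fun M m)"
    by (simp add: coef_subst_monom[OF lattice_auto_inv(1)[OF M]])
qed

lemma subst_monom_one:
  assumes M: "lattice_auto M"
  shows "subst_monom M 1 = 1"
  using subst_monom_term[OF M, of 0 1] unfolding lattice_auto_zero[OF M] by simp

lemma subst_monom_ideal_p:
  assumes M: "lattice_auto M" and f: "f \<in> ideal_p"
  shows "subst_monom M f \<in> ideal_p"
proof -
  obtain a b where ab: "f = (var_v - 1) * a + (var_w - 1) * b" using f unfolding ideal_p_iff by blast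
  have diff: "subst_monom M (laurent_monom m - 1) = laurent_monom (M m) - (1 :: 'a laurent)" for m
    using subst_monom_add[OF M, of "laurent_monom m - 1 :: 'a laurent" 1]
    by (simp add: subst_monom_one[OF M] laurent_monom_def subst_monom_term[OF M] algebra_simps)
  have "subst_monom M f = (laurent_monom (M (1, 0)) - 1) * subst_monom M a + (laurent_monom (M (0, 1)) - 1) * subst_monom M b"
    by (simp only: ab var_v_def var_w_def subst_monom_add[OF M] subst_monom_mult[OF M] diff)
  moreover have "laurent_monom m - 1 \<in> (pow_p (Suc 0) :: 'a laurent set)" for m
    unfolding pow_p_1 by (rule monom_diff_1_in_ideal_p)
  ultimately have "subst_monom M f \<in> pow_p (Suc 0)" by (simp only: pow_p_add pow_p_mult_right)
  then show ?thesis unfolding pow_p_1 .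
qed

lemma subst_monom_iso:
  assumes M: "lattice_auto M"
  shows "p_preserving_iso (subst_monom M)"
proof -
  note M' = lattice_auto_inv(1)[OF M]
  have l: "subst_monom (inverse_fun M) (subst_monom M f) = f" for f :: "'a laurent" by (rule subst_monom_inv[OF M])
  have "inverse_fun (inverse_fun M) = M" by (rule inv_inv_eq[OF lattice_auto_bij[OF M]])
  then have r: "subst_monom M (subst_monom (inverse_fun M) f) = f" for f :: "'a laurent"
    using subst_monom_inv[OF M', of f] by simp
  have "subst_monom M ` ideal_p = (ideal_p :: 'a laurent set)"
  proof (intro subset_antisym subsetI)
    fix f :: "'a laurent" assume "f \<in> ideal_p"
    then have "subst_monom (inverse_fun M) f \<in> ideal_p" by (rule subst_monom_ideal_p[OF M'])
    then have "subst_monom M (subst_monom (inverse_fun M) f) \<in> subst_monom M ` ideal_p" by (rule imageI)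
    then show "f \<in> subst_monom M ` ideal_p" by (simp only: r)
  next
    fix f :: "'a laurent" assume "f \<in> subst_monom M ` ideal_p"
    then show "f \<in> ideal_p" using subst_monom_ideal_p[OF M] by auto
  qed
  moreover have "bij (subst_monom M :: 'a laurent \<Rightarrow> _)"
    by (rule o_bij[of "subst_monom (inverse_fun M)"]) (auto simp: l r)
  ultimately show ?thesis
    by (simp add: p_preserving_iso_def is_ring_hom_def subst_monom_one[OF M] subst_monom_add[OF M]
        subst_monom_mult[OF M] laurent_const_def subst_monom_term[OF M] lattice_auto_zero[OF M])
qed

text \<open>
  Monomials are units and so are mapped to units \<open>c x\<^sup>m\<close>; comparing values at \<open>(1, 1)\<close> gives \<open>c = 1\<close>.
\<close>

lemma p_preserving_iso_monomial:
  assumes iso: "p_preserving_iso \<xi>"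
  obtains M where "lattice_auto M" "\<And>m. \<xi> (laurent_monom m) = laurent_monom (M m)"
proof -
  have one: "\<xi> 1 = 1" and add: "\<And>f g. \<xi> (f + g) = \<xi> f + \<xi> g" and mult: "\<And>f g. \<xi> (f * g) = \<xi> f * \<xi> g"
    and const: "\<And>c. \<xi> (laurent_const c) = laurent_const c" and bij: "bij \<xi>" and p: "\<xi> ` ideal_p = ideal_p"
    using iso by (auto simp: p_preserving_iso_def is_ring_hom_def)
  have ex: "\<exists>n. \<xi> (laurent_monom m) = laurent_monom n" for m
  proof -
    have "laurent_monom m * laurent_monom (- m) = (1 :: 'a laurent)" by (simp add: monom_mult monom_0)
    then have "\<xi> (laurent_monom m) * \<xi> (laurent_monom (- m)) = 1" by (simp only: one flip: mult)
    then have "\<xi> (laurent_monom m) dvd 1" by (metis dvdI)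
    then obtain c n where cn: "\<xi> (laurent_monom m) = laurent_scale c (laurent_monom n)"
      using unit_eq_scale_monom by blast
    have "\<xi> (laurent_monom m - 1) = \<xi> (laurent_monom m) - 1"
      using add[of "laurent_monom m - 1" 1] by (simp add: one algebra_simps)
    then have "\<xi> (laurent_monom m) - 1 \<in> ideal_p"
      using imageI[OF monom_diff_1_in_ideal_p, of \<xi> m] unfolding p by simp
    then have "\<xi> (laurent_monom m) - 1 \<in> pow_p (Suc 0)" unfolding pow_p_1 .
    then have "taylor 0 0 (\<xi> (laurent_monom m) - 1) = 0" by (rule taylor_pow_p) simp
    moreover have "taylor 0 0 (1 :: 'a laurent) = 1" using taylor_term[of 0 0 0 1] by simp
    moreover have "taylor 0 0 (laurent_monom n :: 'a laurent) = 1" by (simp add: laurent_monom_def taylor_term)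
    ultimately have "c = 1" by (simp add: cn taylor_diff taylor_scale)
    then have "\<xi> (laurent_monom m) = laurent_monom n" using cn by simp
    then show ?thesis by blast
  qed
  define M where "M m = (SOME n. \<xi> (laurent_monom m) = laurent_monom n)" for m
  have M: "\<xi> (laurent_monom m) = laurent_monom (M m)" for m
    unfolding M_def by (rule someI_ex[OF ex])
  have M_add: "M (a + b) = M a + M b" for a b
  proof -
    have "laurent_monom (M (a + b)) = (laurent_monom (M a + M b) :: 'a laurent)"
      by (simp only: mult flip: M monom_mult)
    then show ?thesis by (rule injD[OF inj_monom])
  qed
  have inj: "inj M"
  proof (rule injI)
    fix a b assume "M a = M b"
    then have "\<xi> (laurent_monom a) = \<xi> (laurent_monom b)" by (simp only: M)
    then have "laurent_monom a = (laurent_monom b :: 'a laurent)" using bij by (simp add: bij_is_inj inj_eq)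
    then show "a = b" by (rule injD[OF inj_monom])
  qed
  have ex: "\<exists>m. M m = n" for n
  proof -
    obtain f where f: "\<xi> f = laurent_monom n" using bij_is_surj[OF bij] by (metis surjD)
    obtain g where g: "\<xi> g = laurent_monom (- n)" using bij_is_surj[OF bij] by (metis surjD)
    have "\<xi> (f * g) = \<xi> 1" by (simp add: mult f g one monom_mult monom_0)
    then have "f * g = 1" using bij by (simp add: bij_is_inj inj_eq)
    then have "f dvd 1" by (metis dvdI)
    then obtain c m where cm: "c \<noteq> 0" "f = laurent_scale c (laurent_monom m)"
      using unit_eq_scale_monom by blast
    have "laurent_monom n = laurent_scale c (laurent_monom (M m))"
      by (simp only: cm laurent_scale_def mult const M flip: f)
    then have "supp (laurent_monom n :: 'a laurent) = supp (laurent_scale c (laurent_monom (M m)))" by simp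
    then have "M m = n" using cm(1) by simp
    then show ?thesis by blast
  qed
  have "surj M" unfolding surj_def using ex by (metis (no_types))
  then have "lattice_auto M" unfolding lattice_auto_def bij_def using inj M_add by blast
  then show ?thesis using that M by blast
qed

lemma p_preserving_iso_eq_subst:
  assumes iso: "p_preserving_iso \<xi>" and M: "lattice_auto M" "\<And>m. \<xi> (laurent_monom m) = laurent_monom (M m)"
  shows "\<xi> f = subst_monom M f"
proof (induction f rule: laurent_induct)
  case zero
  have "\<xi> (0 + 0) = \<xi> 0 + \<xi> 0" using iso unfolding p_preserving_iso_def is_ring_hom_def by blast
  then have "\<xi> 0 + \<xi> 0 = \<xi> 0 + 0" by (simp only: add_0_right)
  then show ?case unfolding subst_monom_0 by (rule add_left_imp_eq)
next
  case (monomial m c)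
  have "\<xi> (term_of m c) = \<xi> (laurent_const c) * \<xi> (laurent_monom m)"
    using iso by (simp add: term_eq_scale_monom laurent_scale_def p_preserving_iso_def is_ring_hom_def)
  also have "\<dots> = laurent_const c * laurent_monom (M m)" using iso M(2) by (simp add: p_preserving_iso_def)
  also have "\<dots> = term_of (M m) c" by (simp add: term_eq_scale_monom laurent_scale_def)
  finally show ?case by (simp only: subst_monom_term[OF M(1)])
next
  case (add f g)
  then show ?case using iso by (simp add: p_preserving_iso_def is_ring_hom_def subst_monom_add[OF M(1)])
qed

lemma p_preserving_iso_matrix:
  assumes iso: "p_preserving_iso \<xi>"
  shows "\<exists>a :: int^2^2. invertible a \<and> \<xi> var_v = laurent_monom (a $ 1 $ 1, a $ 1 $ 2) \<and>
           \<xi> var_w = laurent_monom (a $ 2 $ 1, a $ 2 $ 2)"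
proof -
  obtain M where M: "lattice_auto M" "\<And>m. \<xi> (laurent_monom m) = laurent_monom (M m)"
    by (rule p_preserving_iso_monomial[OF iso], rule that)
  define mat_of where "mat_of N = (vector [vector [fst (N (1, 0)), snd (N (1, 0))],
      vector [fst (N (0, 1)), snd (N (0, 1))]] :: int^2^2)" for N :: "int \<times> int \<Rightarrow> int \<times> int"
  have inv: "mat_of N ** mat_of N' = Finite_Cartesian_Product.mat 1"
    if N': "lattice_auto N'" and id: "\<And>m. N' (N m) = m" for N N'
  proof -
    have "N' (N m) = zmult (fst (N m)) (N' (1, 0)) + zmult (snd (N m)) (N' (0, 1))" for m
      by (rule lattice_auto_eq[OF N'])
    then have e: "zmult (fst (N m)) (N' (1, 0)) + zmult (snd (N m)) (N' (0, 1)) = m" for m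
      by (simp only: id)
    show ?thesis
      using e[of "(1, 0)"] e[of "(0, 1)"]
      by (simp add: Finite_Cartesian_Product.vec_eq_iff forall_2 matrix_matrix_mult_def sum_2 Finite_Cartesian_Product.mat_def mat_of_def zmult_def prod_eq_iff)
  qed
  have "invertible (mat_of M)"
    unfolding invertible_def
    using inv[OF lattice_auto_inv(1,2)[OF M(1)]] inv[OF M(1) lattice_auto_inv(3)[OF M(1)]] by blast
  moreover have "\<xi> var_v = laurent_monom (mat_of M $ 1 $ 1, mat_of M $ 1 $ 2)"
    "\<xi> var_w = laurent_monom (mat_of M $ 2 $ 1, mat_of M $ 2 $ 2)"
    by (simp_all add: var_v_def var_w_def M(2) mat_of_def)
  ultimately show ?thesis by blast
qed

section \<open>Invariance of the area\<close>

lemma linear_real_extension: "linear (real_extension M)"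
  unfolding real_extension_def by (intro linearI) (simp_all add: algebra_simps)

lemma real_extension_lattice_point:
  "lattice_auto M \<Longrightarrow> real_extension M (lattice_point m) = lattice_point (M m)"
  by (subst (2) lattice_auto_eq) (simp_all add: real_extension_def lattice_point_add lattice_point_zmult, simp add: lattice_point_def)

lemma real_extension_inv:
  assumes M: "lattice_auto M"
  shows "real_extension (inverse_fun M) (real_extension M x) = x"
proof -
  have "real_extension (inverse_fun M) (real_extension M x) =
      fst x *\<^sub>R lattice_point (inverse_fun M (M (1, 0))) + snd x *\<^sub>R lattice_point (inverse_fun M (M (0, 1)))"
    unfolding real_extension_def[of M]
    by (simp only: linear_add[OF linear_real_extension] linear_scale[OF linear_real_extension]
        real_extension_lattice_point[OF lattice_auto_inv(1)[OF M]])
  then show ?thesis by (simp add: lattice_auto_inv[OF M] lattice_point_def)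
qed

lemma newton_polygon_subst:
  assumes "lattice_auto M"
  shows "newton_polygon (subst_monom M f) = real_extension M ` newton_polygon f"
proof -
  have "lattice_point ` supp (subst_monom M f) = real_extension M ` lattice_point ` supp f"
    by (simp add: supp_subst_monom[OF assms] image_image real_extension_lattice_point[OF assms])
  then show ?thesis
    unfolding newton_polygon_def by (simp add: convex_hull_linear_image[OF linear_real_extension])
qed

text \<open>
  An automorphism of the lattice permutes lattice points, so the image and the original have the same
  number of them in every dilate; the areas are the limits of these counts.
\<close>

lemma area_real_extension:
  assumes M: "lattice_auto M" and P: "convex P" "compact P"
  shows "measure lebesgue (real_extension M ` P) = measure lebesgue P"
proof -
  have inj: "inj (real_extension M)" using real_extension_inv[OF M] by (rule inj_on_inverseI)
  have "lattice_in (dilate n (real_extension M ` P)) = M ` lattice_in (dilate n P)" for n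
  proof -
    have "dilate n (real_extension M ` P) = real_extension M ` dilate n P"
      unfolding dilate_def image_image by (simp only: linear_scale[OF linear_real_extension])
    moreover have "M m \<in> lattice_in (real_extension M ` Q) \<longleftrightarrow> m \<in> lattice_in Q" for m Q
      unfolding lattice_in_def mem_Collect_eq real_extension_lattice_point[OF M, symmetric]
      by (rule inj_image_mem_iff[OF inj])
    note 1 = this
    have "m \<in> lattice_in (real_extension M ` Q) \<longleftrightarrow> inverse_fun M m \<in> lattice_in Q" for m Q
      using 1[of "inverse_fun M m" Q] unfolding lattice_auto_inv(3)[OF M] .
    then have "lattice_in (real_extension M ` Q) = M ` lattice_in Q" for Q
      by (rule lattice_auto_set_eqI[OF M])
    ultimately show ?thesis by simp
  qed
  moreover have "inj M" by (rule lattice_auto_inj[OF M])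
  ultimately have card: "card (lattice_in (dilate n (real_extension M ` P))) = card (lattice_in (dilate n P))" for n
    using inj_on_subset by (simp add: card_image inj_on_subset[OF _ subset_UNIV])
  have "convex (real_extension M ` P)" "compact (real_extension M ` P)"
    using P by (auto intro!: convex_linear_image compact_continuous_image linear_continuous_on
        linear_real_extension simp: linear_conv_bounded_linear[symmetric])
  from area_eq_limit_of_lattice_count[OF this] area_eq_limit_of_lattice_count[OF P]
  show ?thesis unfolding card by (rule LIMSEQ_unique)
qed

lemma iso_pow_p:
  assumes iso: "p_preserving_iso \<xi>" and f: "f \<in> pow_p n"
  shows "\<xi> f \<in> pow_p n"
  using f
proof (induction n arbitrary: f)
  case (Suc n)
  obtain a b where ab: "f = (var_v - 1) * a + (var_w - 1) * b" "a \<in> pow_p n" "b \<in> pow_p n"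
    using Suc.prems by (rule pow_p_SucE)
  have "var_v - 1 \<in> ideal_p" "var_w - 1 \<in> (ideal_p :: 'a laurent set)"
    unfolding var_v_def var_w_def by (rule monom_diff_1_in_ideal_p)+
  moreover have "\<xi> ` ideal_p = ideal_p" using iso by (simp add: p_preserving_iso_def)
  ultimately have p: "\<xi> (var_v - 1) \<in> pow_p (Suc 0)" "\<xi> (var_w - 1) \<in> pow_p (Suc 0)"
    unfolding pow_p_1 by blast+
  have "\<xi> f = \<xi> (var_v - 1) * \<xi> a + \<xi> (var_w - 1) * \<xi> b"
    using iso by (simp add: ab(1) p_preserving_iso_def is_ring_hom_def)
  then show ?case
    using pow_p_mult[OF p(1) Suc.IH[OF ab(2)]] pow_p_mult[OF p(2) Suc.IH[OF ab(3)]]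
    by (simp only: pow_p_add plus_1_eq_Suc One_nat_def add_Suc add_0)
qed simp

lemma iso_irreducible:
  assumes iso: "p_preserving_iso \<xi>" and f: "irreducible f"
  shows "irreducible (\<xi> f)"
proof -
  have one: "\<xi> 1 = 1" and mult: "\<And>f g. \<xi> (f * g) = \<xi> f * \<xi> g" and add: "\<And>f g. \<xi> (f + g) = \<xi> f + \<xi> g"
    and bij: "bij \<xi>"
    using iso by (auto simp: p_preserving_iso_def is_ring_hom_def)
  have "\<xi> 0 + \<xi> 0 = \<xi> 0 + 0" by (simp flip: add)
  then have zero: "\<xi> 0 = 0" by (rule add_left_imp_eq)
  have eq: "\<xi> a = \<xi> b \<longleftrightarrow> a = b" for a b using bij by (simp add: bij_is_inj inj_eq)
  have unit: "\<xi> a dvd 1 \<longleftrightarrow> a dvd 1" for a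
  proof
    assume "a dvd 1"
    then obtain b where "1 = a * b" ..
    then have "1 = \<xi> a * \<xi> b" by (simp only: one flip: mult)
    then show "\<xi> a dvd 1" by (rule dvdI)
  next
    assume "\<xi> a dvd 1"
    then obtain b where b: "1 = \<xi> a * b" ..
    obtain b' where b': "b = \<xi> b'" using bij_is_surj[OF bij] by (metis surjD)
    have "\<xi> 1 = \<xi> (a * b')" using b unfolding b' by (simp only: one mult)
    then have "1 = a * b'" by (simp only: eq)
    then show "a dvd 1" by (rule dvdI)
  qed
  show ?thesis
  proof (rule irreducibleI)
    show "\<xi> f \<noteq> 0" using f eq[of f 0] by (simp add: zero irreducible_def)
    show "\<not> \<xi> f dvd 1" using f by (simp add: unit irreducible_def)
    fix a b assume ab: "\<xi> f = a * b"
    obtain a' where a': "a = \<xi> a'" using bij_is_surj[OF bij] by (metis surjD)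
    obtain b' where b': "b = \<xi> b'" using bij_is_surj[OF bij] by (metis surjD)
    have "f = a' * b'" using ab unfolding a' b' by (simp only: eq flip: mult)
    then have "a' dvd 1 \<or> b' dvd 1" by (rule irreducibleD[OF f])
    then show "a dvd 1 \<or> b dvd 1" unfolding a' b' unit .
  qed
qed

theorem nct_iso:
  assumes iso: "p_preserving_iso \<xi>" and nct: "is_nct r \<phi>"
  shows "is_nct r (\<xi> \<phi>)"
proof -
  obtain M where M: "lattice_auto M" "\<And>m. \<xi> (laurent_monom m) = laurent_monom (M m)"
    by (rule p_preserving_iso_monomial[OF iso], rule that)
  have "measure lebesgue (newton_polygon (\<xi> \<phi>)) = measure lebesgue (newton_polygon \<phi>)"
    unfolding p_preserving_iso_eq_subst[OF iso M] newton_polygon_subst[OF M(1)]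
    by (rule area_real_extension[OF M(1) newton_polygon_props(1,2)])
  then show ?thesis
    using iso_irreducible[OF iso nctD(1)[OF nct]] iso_pow_p[OF iso nctD(2)[OF nct]] nctD(3)[OF nct]
    by (simp add: is_nct_def)
qed

theorem nct_unit_mult:
  assumes u: "u dvd 1" and nct: "is_nct r \<phi>"
  shows "is_nct r (u * \<phi>)"
proof -
  obtain c m where cm: "c \<noteq> 0" "u = term_of m c" using u laurent_unit_eq_term by blast
  have "lattice_point ` supp (u * \<phi>) = (+) (lattice_point m) ` lattice_point ` supp \<phi>"
    by (simp add: cm(2) supp_term_mult[OF cm(1)] image_image lattice_point_add)
  then have "newton_polygon (u * \<phi>) = (+) (lattice_point m) ` newton_polygon \<phi>"
    unfolding newton_polygon_def by (simp add: convex_hull_translation)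
  then have "measure lebesgue (newton_polygon (u * \<phi>)) = measure lebesgue (newton_polygon \<phi>)"
    by (simp add: measure_translation)
  then show ?thesis
    using irreducible_unit_mult[OF u nctD(1)[OF nct]] pow_p_mult_left[OF nctD(2)[OF nct]] nctD(3)[OF nct]
    by (simp add: is_nct_def)
qed

section \<open>Trapezoids\<close>

definition trapezoid :: "real \<Rightarrow> real \<Rightarrow> real \<Rightarrow> real \<Rightarrow> real \<Rightarrow> real \<Rightarrow> (real \<times> real) set" where
  "trapezoid a b p q s t = {(x, y). a \<le> x \<and> x \<le> b \<and> p + q * x \<le> y \<and> y \<le> s + t * x}"

lemma closed_trapezoid: "closed (trapezoid a b p q s t)"
proof -
  have "trapezoid a b p q s t = {z. a \<le> fst z} \<inter> {z. fst z \<le> b} \<inter> {z. p + q * fst z \<le> snd z} \<inter> {z. snd z \<le> s + t * fst z}"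
    by (auto simp: trapezoid_def)
  also have "closed \<dots>"
    by (intro closed_Int closed_Collect_le continuous_intros)
  finally show ?thesis .
qed

text \<open>
  The length of the vertical slices is an affine function, integrated by its primitive.
\<close>

lemma area_trapezoid:
  assumes ab: "a \<le> b" and le: "p + q * a \<le> s + t * a" "p + q * b \<le> s + t * b"
  shows "trapezoid a b p q s t \<in> lmeasurable"
    and "measure lebesgue (trapezoid a b p q s t) = (b - a) * ((s - p) + (t - q) * (a + b) / 2)"
proof -
  define f where "f x = (s - p) + (t - q) * x" for x
  define F where "F x = (s - p) * x + (t - q) * x\<^sup>2 / 2" for x
  let ?T = "trapezoid a b p q s t"
  have f_nonneg: "0 \<le> f x" if "a \<le> x" "x \<le> b" for x
  proof (cases "t - q \<ge> 0")
    case True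
    then have "(t - q) * a \<le> (t - q) * x" using that by (intro mult_left_mono) auto
    then show ?thesis using le by (simp add: f_def algebra_simps)
  next
    case False
    then have "(t - q) * b \<le> (t - q) * x" using that by (intro mult_left_mono_neg) auto
    then show ?thesis using le by (simp add: f_def algebra_simps)
  qed
  have T: "?T \<in> sets borel" using closed_trapezoid by (rule borel_closed)
  have slice: "emeasure lborel (Pair x -` ?T) = ennreal (f x) * indicator {a..b} x" for x
  proof (cases "a \<le> x \<and> x \<le> b")
    case True
    then have "Pair x -` ?T = {p + q * x..s + t * x}" by (auto simp: trapezoid_def)
    moreover have "s + t * x - (p + q * x) = f x" by (simp add: f_def algebra_simps)
    moreover have "p + q * x \<le> s + t * x" using f_nonneg[of x] True by (simp add: f_def algebra_simps)
    ultimately show ?thesis using True by simp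
  next
    case False
    then have "Pair x -` ?T = {}" by (auto simp: trapezoid_def)
    then show ?thesis using False by (auto simp: indicator_def)
  qed
  have "emeasure lborel ?T = emeasure (lborel \<Otimes>\<^sub>M lborel) ?T" by (simp only: lborel_prod)
  also have "\<dots> = (\<integral>\<^sup>+ x. emeasure lborel (Pair x -` ?T) \<partial>lborel)"
    by (rule lborel.emeasure_pair_measure_alt) (use T in \<open>simp only: lborel_prod sets_lborel\<close>)
  also have "\<dots> = (\<integral>\<^sup>+ x. ennreal (f x) * indicator {a..b} x \<partial>lborel)" by (simp only: slice)
  also have "\<dots> = ennreal (F b - F a)"
  proof (rule nn_integral_FTC_Icc)
    show "f \<in> borel_measurable borel" unfolding f_def[abs_def] by simp
    show "(F has_real_derivative f x) (at x)" if "x \<in> {a..b}" for x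
      unfolding F_def[abs_def] f_def by (auto intro!: derivative_eq_intros simp: field_simps)
  qed (use f_nonneg ab in auto)
  finally have em: "emeasure lborel ?T = ennreal (F b - F a)" .
  have val: "F b - F a = (b - a) * ((s - p) + (t - q) * (a + b) / 2)"
    by (simp add: F_def power2_eq_square field_simps)
  have "(a + b) / 2 \<ge> a" "(a + b) / 2 \<le> b" using ab by auto
  from f_nonneg[OF this] have "0 \<le> F b - F a" unfolding val using ab by (simp add: f_def)
  then have "measure lborel ?T = F b - F a" using em by (simp add: measure_def)
  then show "measure lebesgue ?T = (b - a) * ((s - p) + (t - q) * (a + b) / 2)"
    using T val by (simp add: measure_completion)
  show "?T \<in> lmeasurable"
    using T em by (intro fmeasurableI) (simp_all add: emeasure_completion)
qed

section \<open>A criterion for irreducibility\<close>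

text \<open>
  Maximal values of an additive functional add up in products. Where \<open>l2\<close> and \<open>l3\<close> attain their
  maximum on the support of the product at \<open>a + b\<close> and \<open>a' + b\<close>, they attain it on the second factor
  at the same point \<open>b\<close>. With \<open>l1\<close>, three sides of a triangle confine this factor to \<open>b\<close>.
\<close>

lemma factor_at_edge_is_unit:
  fixes g h :: "'k::field laurent"
  assumes add: "additive_on_lattice l2" "additive_on_lattice l3"
    and nz: "g \<noteq> 0" "h \<noteq> 0"
    and a: "a \<in> supp g" "a' \<in> supp g" and b: "b \<in> supp h"
    and l1: "\<And>y. y \<in> supp h \<Longrightarrow> l1 y \<le> l1 b"
    and l2: "\<And>m. m \<in> supp (g * h) \<Longrightarrow> l2 m \<le> l2 (a + b)"
    and l3: "\<And>m. m \<in> supp (g * h) \<Longrightarrow> l3 m \<le> l3 (a' + b)"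
    and cone: "\<And>y. l1 y \<le> l1 b \<Longrightarrow> l2 y \<le> l2 b \<Longrightarrow> l3 y \<le> l3 b \<Longrightarrow> y = b"
  shows "h dvd 1"
proof -
  have "y = b" if y: "y \<in> supp h" for y
  proof -
    have *: "l y \<le> l b" if l: "additive_on_lattice l" "e \<in> supp g"
      and max: "\<And>m. m \<in> supp (g * h) \<Longrightarrow> l m \<le> l (e + b)" for l :: "int \<times> int \<Rightarrow> real" and e
    proof (rule support_function_mult[OF l(1) nz])
      fix p q assume pq: "p \<in> supp g" "q \<in> supp h" "p + q \<in> supp (g * h)"
        "\<And>x. x \<in> supp g \<Longrightarrow> l x \<le> l p" "\<And>x. x \<in> supp h \<Longrightarrow> l x \<le> l q"
      have "l e + l y \<le> l p + l q" using pq(4)[OF l(2)] pq(5)[OF y] by simp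
      also have "\<dots> = l (p + q)" using l(1) unfolding additive_on_lattice_def by metis
      also have "\<dots> \<le> l (e + b)" by (rule max[OF pq(3)])
      also have "\<dots> = l e + l b" using l(1) unfolding additive_on_lattice_def by metis
      finally show "l y \<le> l b" by simp
    qed
    show ?thesis by (rule cone[OF l1[OF y] *[OF add(1) a(1) l2] *[OF add(2) a(2) l3]])
  qed
  then have "supp h = {b}" using b by blast
  then show ?thesis unfolding laurent_unit_iff by blast
qed

text \<open>
  The support lies in a triangle with base \<open>A B\<close> and contains no other point of the base. The edges of
  two factors in this direction add up to a primitive vector, so one of them is a point. The two
  other sides pass through \<open>A\<close> and \<open>B\<close>, and so confine this factor to that point.
\<close>

lemma irreducible_if_primitive_edge:
  fixes f :: "'k::field laurent"
  assumes add: "additive_on_lattice l1" "additive_on_lattice l2" "additive_on_lattice l3"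
    and AB: "A \<in> supp f" "B \<in> supp f" "fst A < fst B" "l1 A = l1 B"
    and l1: "\<And>m. m \<in> supp f \<Longrightarrow> m \<noteq> A \<Longrightarrow> m \<noteq> B \<Longrightarrow> l1 m < l1 B"
    and l2: "\<And>m. m \<in> supp f \<Longrightarrow> l2 m \<le> l2 B"
    and l3: "\<And>m. m \<in> supp f \<Longrightarrow> l3 m \<le> l3 A"
    and edge: "\<And>d. l1 d = 0 \<Longrightarrow> \<exists>t. d = zmult t (B - A)"
    and cone: "\<And>d. l1 d \<le> 0 \<Longrightarrow> l2 d \<le> 0 \<Longrightarrow> l3 d \<le> 0 \<Longrightarrow> d = 0"
  shows "irreducible f"
proof (rule irreducibleI)
  have AB_ne: "A \<noteq> B" using AB(3) by auto
  show "f \<noteq> 0" using AB(1) by auto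
  show "\<not> f dvd 1"
  proof
    assume "f dvd 1"
    then obtain m where "supp f = {m}" unfolding laurent_unit_iff by blast
    then show False using AB(1,2) AB_ne by auto
  qed
  have l_add: "l (x + y) = l x + l y" if "additive_on_lattice l" for l :: "int \<times> int \<Rightarrow> real" and x y
    using that unfolding additive_on_lattice_def by blast
  have l_diff: "l (x - y) = l x - l y" if "additive_on_lattice l" for l :: "int \<times> int \<Rightarrow> real" and x y
    using l_add[OF that, of "x - y" y] by simp
  fix g h assume f: "f = g * h"
  then have nz: "g \<noteq> 0" "h \<noteq> 0" using \<open>f \<noteq> 0\<close> by auto
  obtain a b where ab: "a \<in> supp g" "b \<in> supp h" "a + b \<in> supp f"
    "\<forall>x\<in>supp g. x \<noteq> a \<longrightarrow> lex_less l1 1 x a" "\<forall>x\<in>supp h. x \<noteq> b \<longrightarrow> lex_less l1 1 x b"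
    "\<forall>x\<in>supp f. x \<noteq> a + b \<longrightarrow> lex_less l1 1 x (a + b)"
    by (rule leading_term[OF add(1), of 1 g h]) (use nz f in auto)
  obtain a' b' where ab': "a' \<in> supp g" "b' \<in> supp h" "a' + b' \<in> supp f"
    "\<forall>x\<in>supp g. x \<noteq> a' \<longrightarrow> lex_less l1 (- 1) x a'" "\<forall>x\<in>supp h. x \<noteq> b' \<longrightarrow> lex_less l1 (- 1) x b'"
    "\<forall>x\<in>supp f. x \<noteq> a' + b' \<longrightarrow> lex_less l1 (- 1) x (a' + b')"
    by (rule leading_term[OF add(1), of "- 1" g h]) (use nz f in auto)
  have lex_le: "l1 x \<le> l1 y" if "lex_less l1 s x y" for s x y
    using that by (auto simp: lex_less_def)
  have lex_max: "l1 y \<le> l1 x" if "\<forall>y\<in>S. y \<noteq> x \<longrightarrow> lex_less l1 1 y x" "y \<in> S" for x y S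
  proof (cases "y = x")
    case False
    then have "lex_less l1 1 y x" using that by blast
    then show ?thesis by (rule lex_le)
  qed simp
  have B: "a + b = B"
  proof (rule ccontr)
    assume ne: "a + b \<noteq> B"
    then have less: "lex_less l1 1 B (a + b)" using ab(6) AB(2) by auto
    then have "a + b = A" using lex_le[OF less] l1[OF ab(3)] ne by force
    then show False using less AB(3,4) by (simp add: lex_less_def)
  qed
  have A: "a' + b' = A"
  proof (rule ccontr)
    assume ne: "a' + b' \<noteq> A"
    then have less: "lex_less l1 (- 1) A (a' + b')" using ab'(6) AB(1) by auto
    then have "a' + b' = B" using lex_le[OF less] l1[OF ab'(3)] ne AB(4) by force
    then show False using less AB(3,4) by (simp add: lex_less_def)
  qed
  have eq: "l1 x = l1 x' \<and> fst x' \<le> fst x"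
    if x: "x \<in> S" "\<forall>y\<in>S. y \<noteq> x \<longrightarrow> lex_less l1 1 y x" and x': "x' \<in> S" "\<forall>y\<in>S. y \<noteq> x' \<longrightarrow> lex_less l1 (- 1) y x'"
    for x x' S
  proof (cases "x = x'")
    case False
    then have "lex_less l1 1 x' x" "lex_less l1 (- 1) x x'" using x x' by auto
    then show ?thesis by (auto simp: lex_less_def)
  qed simp
  note ea = eq[OF ab(1,4) ab'(1,4)] and eb = eq[OF ab(2,5) ab'(2,5)]
  obtain t where t: "a - a' = zmult t (B - A)" using edge[of "a - a'"] ea by (auto simp: l_diff[OF add(1)])
  obtain u where u: "b - b' = zmult u (B - A)" using edge[of "b - b'"] eb by (auto simp: l_diff[OF add(1)])
  have "(a - a') + (b - b') = B - A" using A B by (simp add: algebra_simps)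
  then have "t * (fst B - fst A) + u * (fst B - fst A) = fst B - fst A"
    unfolding t u by (auto simp: zmult_def dest: arg_cong[of _ _ fst])
  then have "(t + u - 1) * (fst B - fst A) = 0" by (simp add: algebra_simps)
  then have tu: "t + u = 1" using AB(3) by simp
  have "fst a - fst a' = t * (fst B - fst A)" "fst b - fst b' = u * (fst B - fst A)"
    using arg_cong[OF t, of fst] arg_cong[OF u, of fst] by (simp_all add: zmult_def)
  then have "0 \<le> t * (fst B - fst A)" "0 \<le> u * (fst B - fst A)" using ea eb by auto
  then have "t \<ge> 0" "u \<ge> 0" using AB(3) by (auto simp: zero_le_mult_iff)
  then consider "u = 0" | "t = 0" using tu by linarith
  then show "g dvd 1 \<or> h dvd 1"
  proof cases
    case 1
    then have bb: "b' = b" using u by (simp add: zmult_def flip: zero_prod_def)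
    have "h dvd 1"
    proof (rule factor_at_edge_is_unit[OF add(2,3) nz ab(1) ab'(1) ab(2), of l1])
      show "l1 y \<le> l1 b" if "y \<in> supp h" for y by (rule lex_max[OF ab(5) that])
      show "l2 m \<le> l2 (a + b)" if "m \<in> supp (g * h)" for m using l2 that unfolding B f by blast
      show "l3 m \<le> l3 (a' + b)" if "m \<in> supp (g * h)" for m
        using l3 that A unfolding bb f by simp
      show "y = b" if "l1 y \<le> l1 b" "l2 y \<le> l2 b" "l3 y \<le> l3 b" for y
        using cone[of "y - b"] that by (simp add: l_diff add)
    qed
    then show ?thesis ..
  next
    case 2
    then have aa: "a' = a" using t by (simp add: zmult_def flip: zero_prod_def)
    have gh: "g * h = h * g" by (rule mult.commute)
    have "g dvd 1"
    proof (rule factor_at_edge_is_unit[OF add(2,3) nz(2,1) ab(2) ab'(2) ab(1), of l1])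
      show "l1 y \<le> l1 a" if "y \<in> supp g" for y by (rule lex_max[OF ab(4) that])
      show "l2 m \<le> l2 (b + a)" if "m \<in> supp (h * g)" for m
        using l2 that unfolding f gh add.commute[of b a] B by blast
      show "l3 m \<le> l3 (b' + a)" if "m \<in> supp (h * g)" for m
        using l3 that A unfolding aa f gh add.commute[of b' a] by simp
      show "y = a" if "l1 y \<le> l1 a" "l2 y \<le> l2 a" "l3 y \<le> l3 a" for y
        using cone[of "y - a"] that by (simp add: l_diff add)
    qed
    then show ?thesis ..
  qed
qed

section \<open>Existence\<close>

lemma measure_subset_Un3_le:
  fixes A :: "(real \<times> real) set"
  assumes "A \<subseteq> T1 \<union> T2 \<union> T3" "A \<in> sets lebesgue" "T1 \<in> lmeasurable" "T2 \<in> lmeasurable" "T3 \<in> lmeasurable"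
  shows "measure lebesgue A \<le> measure lebesgue T1 + measure lebesgue T2 + measure lebesgue T3"
proof -
  have "measure lebesgue A \<le> measure lebesgue (T1 \<union> T2 \<union> T3)"
    using assms by (intro measure_mono_fmeasurable fmeasurable.Un) auto
  also have "\<dots> \<le> measure lebesgue (T1 \<union> T2) + measure lebesgue T3"
    using assms by (intro measure_Un_le) auto
  also have "\<dots> \<le> measure lebesgue T1 + measure lebesgue T2 + measure lebesgue T3"
    using assms by (simp add: measure_Un_le fmeasurableD)
  finally show ?thesis .
qed

lemma sets_newton_polygon: "newton_polygon f \<in> lmeasurable"
  using newton_polygon_props(2) by (rule lmeasurable_compact)

text \<open>
  Cut the region at the abscissas \<open>1\<close> and \<open>r - 1\<close> of its upper corners into three trapezoids, whose
  areas add up to \<open>(r\<^sup>2 - 1) / 2\<close>.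
\<close>

lemma stair_region_area:
  fixes r :: nat and A :: "(real \<times> real) set"
  assumes r: "r \<ge> 2" and A: "A \<in> sets lebesgue"
    and sub: "\<And>x y. (x, y) \<in> A \<Longrightarrow> x \<le> real r * y \<and> y \<le> 2 * x \<and> y \<le> x + 1 \<and> (real r - 1) * x + y \<le> (real r)\<^sup>2 - r + 1"
  shows "2 * measure lebesgue A < (real r)\<^sup>2"
proof -
  define s where "s = real r"
  have s: "s \<ge> 2" using r by (simp add: s_def)
  let ?T1 = "trapezoid 0 1 0 (1 / s) 0 2"
  let ?T2 = "trapezoid 1 (s - 1) 0 (1 / s) 1 1"
  let ?T3 = "trapezoid (s - 1) s 0 (1 / s) (s\<^sup>2 - s + 1) (1 - s)"
  have pos: "s > 0" "1 / s \<le> 1" using s by auto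
  have "s\<^sup>2 - s + 1 + (1 - s) * (s - 1) = s" by (simp add: algebra_simps power2_eq_square)
  moreover have one: "(s - 1) / s \<le> 1" using pos by (simp add: divide_le_eq)
  ultimately have top: "(s - 1) / s \<le> s\<^sup>2 - s + 1 + (1 - s) * (s - 1)" using s by linarith
  have sq: "2 * s \<le> s\<^sup>2" using s by (simp add: power2_eq_square)
  have "A \<subseteq> ?T1 \<union> ?T2 \<union> ?T3"
  proof
    fix z assume z: "z \<in> A"
    obtain x y where xy: "z = (x, y)" by (cases z)
    have h: "x \<le> s * y" "y \<le> 2 * x" "y \<le> x + 1" "(s - 1) * x + y \<le> s\<^sup>2 - s + 1"
      using sub[of x y] z xy by (auto simp: s_def)
    have "s * y \<le> s * (2 * x)" using h(2) pos(1) by (intro mult_left_mono) auto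
    then have "0 \<le> (2 * s - 1) * x" using h(1) by (simp add: algebra_simps)
    then have "x \<ge> 0" using s by (simp add: zero_le_mult_iff)
    have "s * ((s - 1) * x + y) \<le> s * (s\<^sup>2 - s + 1)" using h(4) pos(1) by (intro mult_left_mono) auto
    then have "(s\<^sup>2 - s + 1) * (x - s) \<le> 0" using h(1) by (simp add: algebra_simps power2_eq_square)
    moreover have "s\<^sup>2 - s + 1 > 0" using s sq by linarith
    ultimately have "x \<le> s" by (simp add: mult_le_0_iff)
    have "x / s \<le> y" using h(1) pos(1) by (simp add: field_simps)
    then show "z \<in> ?T1 \<union> ?T2 \<union> ?T3"
      using h \<open>x \<ge> 0\<close> \<open>x \<le> s\<close> unfolding xy trapezoid_def by (auto simp: algebra_simps)
  qed
  moreover have "?T1 \<in> lmeasurable" "measure lebesgue ?T1 = (2 - 1 / s) / 2"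
    using area_trapezoid[of 0 1 0 "1 / s" 0 2] s pos by auto
  moreover have "?T2 \<in> lmeasurable" "measure lebesgue ?T2 = (s - 2) * (s + 1) / 2"
  proof -
    have "0 + 1 / s * (s - 1) \<le> 1 + 1 * (s - 1)" using order_trans[OF one, of s] s by simp
    note T2 = area_trapezoid[of 1 "s - 1" 0 "1 / s" 1 1, OF _ _ this]
    show "?T2 \<in> lmeasurable" using T2(1) s pos by simp
    have "measure lebesgue ?T2 = (s - 1 - 1) * (1 - 0 + (1 - 1 / s) * (1 + (s - 1)) / 2)" using T2(2) s pos by simp
    also have "\<dots> = (s - 2) * (s + 1) / 2" using pos by (simp add: field_simps)
    finally show "measure lebesgue ?T2 = (s - 2) * (s + 1) / 2" .
  qed
  moreover have "?T3 \<in> lmeasurable" "measure lebesgue ?T3 = (s\<^sup>2 - s + 1) - (s - 1 + 1 / s) * (2 * s - 1) / 2"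
  proof -
    have le: "s - 1 \<le> s" "0 + 1 / s * (s - 1) \<le> s\<^sup>2 - s + 1 + (1 - s) * (s - 1)" using top by simp_all
    have "0 + 1 / s * s \<le> s\<^sup>2 - s + 1 + (1 - s) * s" using pos by (simp add: algebra_simps power2_eq_square)
    note T3 = area_trapezoid[OF le this]
    show "?T3 \<in> lmeasurable" by (rule T3(1))
    show "measure lebesgue ?T3 = (s\<^sup>2 - s + 1) - (s - 1 + 1 / s) * (2 * s - 1) / 2"
      unfolding T3(2) by (simp add: algebra_simps diff_divide_distrib add_divide_distrib)
  qed
  ultimately have "measure lebesgue A \<le> (2 - 1 / s) / 2 + (s - 2) * (s + 1) / 2 +
      ((s\<^sup>2 - s + 1) - (s - 1 + 1 / s) * (2 * s - 1) / 2)"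
    using measure_subset_Un3_le[OF _ A, of ?T1 ?T2 ?T3] by (simp only:)
  also have "\<dots> = (s\<^sup>2 - 1) / 2"
  proof -
    define t where "t = 1 / s"
    have t: "s * t = 1" using s by (simp add: t_def)
    have "(2 - t) / 2 + (s - 2) * (s + 1) / 2 + ((s\<^sup>2 - s + 1) - (s - 1 + t) * (2 * s - 1) / 2) =
        (s\<^sup>2 - 1) / 2 + 1 - s * t"
      by (simp add: field_simps power2_eq_square)
    also have "\<dots> = (s\<^sup>2 - 1) / 2" unfolding t by simp
    finally show ?thesis unfolding t_def .
  qed
  finally show ?thesis by (simp add: s_def)
qed

text \<open>
  The lowest ordinate of a column: the first column consists of the origin, the others start at
  height \<open>1\<close>.
\<close>

definition stair_shift :: "nat \<Rightarrow> int" where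
  "stair_shift i = (if i = 0 then 0 else 1)"

text \<open>
  The pairs \<open>(i, j)\<close> with \<open>i + j < r\<close> number the points of the staircase: column \<open>i + j\<close>, height \<open>j\<close>
  above its lowest point.
\<close>

definition stair :: "nat \<Rightarrow> (int \<times> int) set" where
  "stair r = (\<lambda>(i, j). (int (i + j), stair_shift (i + j) + int j)) ` {(i, j). i + j < r}"

lemma stair_iff: "m \<in> stair r \<longleftrightarrow> (\<exists>i<r. \<exists>j\<le>i. m = (int i, stair_shift i + int j))"
proof
  assume "m \<in> stair r"
  then obtain i j where ij: "i + j < r" "m = (int (i + j), stair_shift (i + j) + int j)"
    by (auto simp: stair_def)
  then show "\<exists>i<r. \<exists>j\<le>i. m = (int i, stair_shift i + int j)" by (intro exI[of _ "i + j"] conjI exI[of _ j]) auto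
next
  assume "\<exists>i<r. \<exists>j\<le>i. m = (int i, stair_shift i + int j)"
  then obtain i j where ij: "i < r" "j \<le> i" "m = (int i, stair_shift i + int j)" by blast
  then have "m = (\<lambda>(i, j). (int (i + j), stair_shift (i + j) + int j)) (i - j, j)" "(i - j, j) \<in> {(i, j). i + j < r}"
    by auto
  then show "m \<in> stair r" unfolding stair_def by (rule image_eqI)
qed

lemma card_stair: "card (stair r) = r * (r + 1) div 2"
proof -
  have "inj_on (\<lambda>(i, j). (int (i + j), stair_shift (i + j) + int j)) {(i, j). i + j < r}"
  proof (rule inj_onI)
    fix p q :: "nat \<times> nat"
    assume eq: "(\<lambda>(i, j). (int (i + j), stair_shift (i + j) + int j)) p =
      (\<lambda>(i, j). (int (i + j), stair_shift (i + j) + int j)) q"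
    have sum: "fst p + snd p = fst q + snd q"
      using arg_cong[OF eq, of fst] unfolding case_prod_unfold fst_conv of_nat_eq_iff .
    have "stair_shift (fst p + snd p) + int (snd p) = stair_shift (fst q + snd q) + int (snd q)"
      using arg_cong[OF eq, of snd] unfolding case_prod_unfold snd_conv .
    then have "snd p = snd q" unfolding sum by simp
    with sum show "p = q" by (simp add: prod_eq_iff)
  qed
  then show ?thesis unfolding stair_def by (simp add: card_image card_pairs_below del: of_nat_add)
qed

lemma stair_cases:
  assumes "m \<in> insert (int r, 1) (stair r)"
  shows "m = (0, 0) \<or> m = (int r, 1) \<or> (1 \<le> fst m \<and> fst m < int r \<and> 1 \<le> snd m \<and> snd m \<le> fst m + 1)"
  using assms by (auto simp: stair_iff stair_shift_def split: if_splits)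

text \<open>
  Adding \<open>(r, 1)\<close> to the staircase gives one point more than there are conditions. This set is a
  staircase in two ways: by columns after removal of \<open>(r, 1)\<close>, and by rows after removal of the
  origin. So neither of these exponents can be missing.
\<close>

lemma stair_element:
  assumes "r > 0"
  obtains f :: "'k::field laurent" where "f \<in> pow_p r" "supp f \<subseteq> insert (int r, 1) (stair r)"
    "(0, 0) \<in> supp f" "(int r, 1) \<in> supp f"
proof -
  let ?Q = "insert (int r, 1) (stair r)"
  have fin: "finite (stair r)" unfolding stair_def by (simp add: finite_pairs_below)
  have "(int r, 1) \<notin> stair r" by (auto simp: stair_iff)
  then have "card ?Q = Suc (r * (r + 1) div 2)" using fin by (simp add: card_stair)
  then have "laurent.dim (supported ?Q \<inter> pow_p r :: 'k laurent set) > 0"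
    using dim_supported_pow_p[of ?Q r, where 'k = 'k] fin by simp
  then have ne: "\<not> (supported ?Q \<inter> pow_p r :: 'k laurent set) \<subseteq> {0}"
  proof (intro notI)
    assume "(supported ?Q \<inter> pow_p r :: 'k laurent set) \<subseteq> {0}"
    then have "laurent.dim (supported ?Q \<inter> pow_p r :: 'k laurent set) \<le> card ({} :: 'k laurent set)"
      by (intro laurent.dim_le_card) (simp_all add: laurent.span_empty)
    then show False using \<open>laurent.dim _ > 0\<close> by simp
  qed
  obtain f :: "'k laurent" where "f \<in> supported ?Q \<inter> pow_p r" "f \<noteq> 0"
    using ne unfolding subset_iff singleton_iff by meson
  then have f: "supp f \<subseteq> ?Q" "f \<in> pow_p r" "f \<noteq> 0" by (simp_all add: supported_def)
  have B: "(int r, 1) \<in> supp f"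
  proof (rule ccontr)
    assume no: "(int r, 1) \<notin> supp f"
    have "f = 0"
    proof (rule staircase_pow_p_eq_0[OF f(2), of 0 stair_shift])
      fix m assume m: "m \<in> supp f"
      then have "m \<in> stair r" using subsetD[OF f(1) m] no by (elim insertE) simp_all
      then show "\<exists>i<r. \<exists>j\<le>i. m = (0 + int i, stair_shift i + int j)" unfolding stair_iff add_0_left .
    qed
    then show False using f(3) by simp
  qed
  have A: "(0, 0) \<in> supp f"
  proof (rule ccontr)
    assume no: "(0, 0) \<notin> supp f"
    \<comment> \<open>a quarter turn makes the rows columns; the row at height \<open>y\<close> becomes column
      \<open>r - y\<close>\<close>
    define M :: "int \<times> int \<Rightarrow> int \<times> int" where "M m = (- snd m, fst m)" for m
    have M: "lattice_auto M"
      by (rule lattice_autoI[of _ "\<lambda>m. (snd m, - fst m)"]) (simp_all add: M_def prod_eq_iff)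
    let ?b = "\<lambda>i. if i = r - 1 then 1 else int r - 1 - int i"
    have "subst_monom M f = 0"
    proof (rule staircase_pow_p_eq_0[OF iso_pow_p[OF subst_monom_iso[OF M] f(2)], of "- int r" ?b])
      fix m assume "m \<in> supp (subst_monom M f)"
      then obtain n where n: "n \<in> supp f" "m = M n" by (auto simp: supp_subst_monom[OF M])
      have n0: "n \<noteq> (0, 0)" using n no by auto
      have "n \<in> ?Q" using n(1) f(1) by (rule subsetD[rotated])
      from stair_cases[OF this] n0
      have n': "1 \<le> snd n" "snd n \<le> int r" "snd n \<le> fst n + 1" "fst n \<le> int r" "1 \<le> fst n" "snd n = 1 \<or> fst n < int r"
        using assms by auto
      define i where "i = nat (int r - snd n)"
      have i: "int i = int r - snd n" "i < r" using n' by (auto simp: i_def)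
      define j where "j = nat (fst n - ?b i)"
      have "0 \<le> fst n - ?b i" "fst n - ?b i \<le> int i" using n' i by auto
      then have j: "int j = fst n - ?b i" "j \<le> i" by (auto simp: j_def)
      have "m = (- int r + int i, ?b i + int j)" using i j n(2) by (simp add: M_def)
      then show "\<exists>i<r. \<exists>j\<le>i. m = (- int r + int i, ?b i + int j)" using i(2) j(2) by blast
    qed
    then have "M ` supp f = {}" using supp_subst_monom[OF M, of f] by simp
    then show False using B by blast
  qed
  show thesis by (rule that[OF f(2,1) A B])
qed

text \<open>
  The segment from \<open>(0, 0)\<close> to \<open>(r, 1)\<close> is primitive and the staircase lies above it, in a triangle
  with this base; this gives irreducibility. For \<open>r \<ge> 2\<close> the polygon is contained in the quadrilateral with
  corners \<open>(0, 0)\<close>, \<open>(1, 2)\<close>, \<open>(r - 1, r)\<close>, \<open>(r, 1)\<close>.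
\<close>

lemma nct_exists:
  assumes r: "r > 0"
  shows "\<exists>f :: 'k::field laurent. is_nct r f"
proof -
  obtain f :: "'k laurent" where f: "f \<in> pow_p r" "supp f \<subseteq> insert (int r, 1) (stair r)"
    "(0, 0) \<in> supp f" "(int r, 1) \<in> supp f"
    by (rule stair_element[OF r])
  have cases: "m = (0, 0) \<or> m = (int r, 1) \<or> (1 \<le> fst m \<and> fst m < int r \<and> 1 \<le> snd m \<and> snd m \<le> fst m + 1)"
    if "m \<in> supp f" for m
    using f(2) that by (intro stair_cases) (rule subsetD)
  have in_trap: "newton_polygon f \<subseteq> R" if "convex R" "\<And>m. m \<in> supp f \<Longrightarrow> lattice_point m \<in> R" for R
    using that by (intro newton_polygon_minimal) auto
  have "irreducible f"
  proof (rule irreducible_if_primitive_edge[where A = "(0, 0)" and B = "(int r, 1)"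
        and ?l1.0 = "\<lambda>m. real_of_int (fst m - int r * snd m)"
        and ?l2.0 = "\<lambda>m. real_of_int ((int r - 1) * fst m + snd m)"
        and ?l3.0 = "\<lambda>m. real_of_int (snd m - 2 * fst m)"])
    fix m assume m: "m \<in> supp f"
    show "real_of_int (fst m - int r * snd m) < real_of_int (fst (int r, 1 :: int) - int r * snd (int r, 1 :: int))"
      if "m \<noteq> (0, 0)" "m \<noteq> (int r, 1)"
    proof -
      have "fst m < int r * 1" "1 \<le> snd m" using cases[OF m] that by auto
      moreover have "int r * 1 \<le> int r * snd m" using \<open>1 \<le> snd m\<close> by (intro mult_left_mono) auto
      ultimately show ?thesis unfolding of_int_less_iff by simp
    qed
    have "(int r - 1) * fst m + snd m \<le> (int r - 1) * int r + 1"
      using cases[OF m]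
    proof (elim disjE)
      assume a: "1 \<le> fst m \<and> fst m < int r \<and> 1 \<le> snd m \<and> snd m \<le> fst m + 1"
      then have "(int r - 1) * fst m + snd m \<le> int r * fst m + 1" by (simp add: algebra_simps)
      also have "\<dots> \<le> int r * (int r - 1) + 1" using a by (intro add_right_mono mult_left_mono) auto
      finally show ?thesis by (simp add: algebra_simps)
    qed (use r in auto)
    then show "real_of_int ((int r - 1) * fst m + snd m)
        \<le> real_of_int ((int r - 1) * fst (int r, 1 :: int) + snd (int r, 1 :: int))"
      unfolding of_int_le_iff by simp
    show "real_of_int (snd m - 2 * fst m) \<le> real_of_int (snd (0, 0 :: int) - 2 * fst (0 :: int, 0))"
      unfolding of_int_le_iff using cases[OF m] r by auto
  next
    fix d :: "int \<times> int"
    show "\<exists>t. d = zmult t ((int r, 1) - (0, 0))" if "real_of_int (fst d - int r * snd d) = 0"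
    proof (intro exI)
      have "fst d - int r * snd d = 0" using that unfolding of_int_eq_0_iff .
      then show "d = zmult (snd d) ((int r, 1) - (0, 0))"
        by (simp add: zmult_def prod_eq_iff mult.commute)
    qed
    assume "real_of_int (fst d - int r * snd d) \<le> 0" "real_of_int ((int r - 1) * fst d + snd d) \<le> 0"
      "real_of_int (snd d - 2 * fst d) \<le> 0"
    then have d: "fst d \<le> int r * snd d" "(int r - 1) * fst d + snd d \<le> 0" "snd d \<le> 2 * fst d"
      unfolding of_int_le_0_iff by auto
    have "int r * snd d \<le> int r * (2 * fst d)" using d(3) by (intro mult_left_mono) auto
    then have "0 \<le> (2 * int r - 1) * fst d" using d(1) by (simp add: algebra_simps)
    then have x: "0 \<le> fst d" using r by (simp add: zero_le_mult_iff)
    then have "0 \<le> (int r - 1) * fst d" using r by (intro mult_nonneg_nonneg) auto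
    then have "snd d \<le> 0" using d(2) by linarith
    then have "int r * snd d \<le> 0" by (simp add: mult_le_0_iff)
    then have "fst d = 0" using d(1) x by linarith
    moreover have "snd d \<ge> 0"  using d(1) \<open>fst d = 0\<close> r by (simp add: zero_le_mult_iff)
    ultimately show "d = 0" using \<open>snd d \<le> 0\<close> by (simp add: prod_eq_iff)
  qed (use f r in \<open>auto simp: additive_on_lattice_def algebra_simps\<close>)
  moreover have "2 * measure lebesgue (newton_polygon f) < (real r)\<^sup>2"
  proof (cases "r = 1")
    case True
    \<comment> \<open>for \<open>r = 1\<close> the polygon is the diagonal of the unit square\<close>
    let ?T = "trapezoid 0 1 0 1 0 1"
    have "newton_polygon f \<subseteq> ?T"
    proof (rule in_trap)
      have "?T = {z. 0 \<le> fst z} \<inter> {z. fst z \<le> 1} \<inter> {z. (1, -1) \<bullet> z = 0}"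
        by (auto simp: trapezoid_def)
      moreover have "convex \<dots>" 
        using convex_halfspace_ge[of 0 "(1, 0 :: real) :: real \<times> real"] convex_halfspace_le[of "(1, 0 :: real) :: real \<times> real" 1]
        by (intro convex_Int convex_hyperplane) (simp_all add: inner_prod_def)
      ultimately show "convex ?T" by simp
      show "lattice_point m \<in> ?T" if "m \<in> supp f" for m
        using cases[OF that] True by (auto simp: lattice_point_def trapezoid_def)
    qed
    then have "measure lebesgue (newton_polygon f) \<le> measure lebesgue ?T"
      using sets_newton_polygon area_trapezoid(1)[of 0 1 0 1 0 1] by (intro measure_mono_fmeasurable) auto
    then show ?thesis using area_trapezoid(2)[of 0 1 0 1 0 1] True by simp
  next
    case False
    then have r2: "r \<ge> 2" using r by simp
    let ?R = "{z. (1, - real r) \<bullet> z \<le> 0} \<inter> {z. (- 2, 1) \<bullet> z \<le> 0} \<inter> {z. (- 1, 1) \<bullet> z \<le> 1} \<inter>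
        {z :: real \<times> real. (real r - 1, 1) \<bullet> z \<le> (real r)\<^sup>2 - real r + 1}"
    have sub: "newton_polygon f \<subseteq> ?R"
    proof (rule in_trap)
      show "convex ?R" by (intro convex_Int convex_halfspace_le)
      fix m assume m: "m \<in> supp f"
      obtain x y where xy: "m = (x, y)" by (cases m)
      have "int r * 1 \<le> int r * int r" using r by (intro mult_left_mono) auto
      then have rr: "0 \<le> (int r)\<^sup>2 - int r + 1" unfolding power2_eq_square by linarith
      have "x \<le> int r * y \<and> y \<le> 2 * x \<and> y \<le> x + 1 \<and> (int r - 1) * x + y \<le> (int r)\<^sup>2 - int r + 1"
        using cases[OF m]
      proof (elim disjE)
        assume a: "1 \<le> fst m \<and> fst m < int r \<and> 1 \<le> snd m \<and> snd m \<le> fst m + 1"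
        then have xy': "1 \<le> x" "x < int r" "1 \<le> y" "y \<le> x + 1" unfolding xy by simp_all
        have "int r * 1 \<le> int r * y" using xy' by (intro mult_left_mono) auto
        moreover have "(int r - 1) * x + y \<le> int r * x + 1" using a xy by (simp add: algebra_simps)
        moreover have "int r * x + 1 \<le> int r * (int r - 1) + 1" using a xy by (intro add_right_mono mult_left_mono) auto
        moreover have "int r * (int r - 1) + 1 = (int r)\<^sup>2 - int r + 1"
          by (simp add: algebra_simps power2_eq_square)
        ultimately show ?thesis using xy' by linarith
      next
        assume "m = (0, 0)"
        then have "x = 0" "y = 0" unfolding xy by simp_all
        with rr show ?thesis by simp
      qed (use r2 xy in \<open>auto simp: algebra_simps power2_eq_square\<close>)
      then have "real_of_int x \<le> real_of_int (int r * y)" "real_of_int y \<le> real_of_int (2 * x)"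
        "real_of_int y \<le> real_of_int (x + 1)"
        "real_of_int ((int r - 1) * x + y) \<le> real_of_int ((int r)\<^sup>2 - int r + 1)"
        unfolding of_int_le_iff by auto
      then show "lattice_point m \<in> ?R" by (simp add: lattice_point_def xy)
    qed
    show ?thesis
    proof (rule stair_region_area[OF r2])
      show "newton_polygon f \<in> sets lebesgue" using sets_newton_polygon by (rule fmeasurableD)
      show "x \<le> real r * y \<and> y \<le> 2 * x \<and> y \<le> x + 1 \<and> (real r - 1) * x + y \<le> (real r)\<^sup>2 - r + 1"
        if "(x, y) \<in> newton_polygon f" for x y
        using subsetD[OF sub that] by simp
    qed
  qed
  ultimately show ?thesis using f(1) unfolding is_nct_def by blast
qed

section \<open>Finiteness\<close>

lemma equiv_nct_equiv: "equiv (NCT r) (nct_equiv r :: ('k::field laurent \<times> 'k laurent) set)"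
proof -
  let ?F = "{E. equiv (NCT r) E \<and> nct_step r \<subseteq> E} :: ('k laurent \<times> 'k laurent) set set"
  have "NCT r \<times> NCT r \<in> ?F"
    by (auto simp: nct_step_def equiv_def refl_on_def sym_def trans_def)
  then have sub: "\<Inter>?F \<subseteq> NCT r \<times> NCT r" by (rule Inter_lower)
  have F: "refl_on (NCT r) E" "sym E" "trans E" if "E \<in> ?F" for E
    using that by (auto simp: equiv_def)
  show ?thesis unfolding nct_equiv_def
  proof (rule equivI[OF sub])
    show "refl_on (NCT r) (\<Inter>?F)" using F(1) unfolding refl_on_def by blast
    show "sym (\<Inter>?F)" using F(2) by (intro symI InterI) (meson InterD symD)
    show "trans (\<Inter>?F)" using F(3) by (intro transI InterI) (meson InterD transD)
  qed
qed

lemma nct_step_equiv: "(f, g) \<in> nct_step r \<Longrightarrow> (f, g) \<in> nct_equiv r"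
  unfolding nct_equiv_def by blast

lemma nct_equiv_scale:
  assumes nct: "is_nct r \<phi>" and c: "c \<noteq> 0"
  shows "(\<phi>, laurent_scale c \<phi>) \<in> nct_equiv r"
proof (rule nct_step_equiv)
  have u: "laurent_const c dvd 1" unfolding laurent_unit_eq_term laurent_const_def using c by blast
  then have "is_nct r (laurent_const c * \<phi>)" by (rule nct_unit_mult[OF _ nct])
  then show "(\<phi>, laurent_scale c \<phi>) \<in> nct_step r"
    unfolding nct_step_def NCT_def laurent_scale_def using nct u by blast
qed

lemma nct_equiv_affine:
  assumes nct: "is_nct r \<phi>" and M: "lattice_auto M"
  shows "(\<phi>, subst_monom M (laurent_monom a * \<phi>)) \<in> nct_equiv r"
    and "is_nct r (subst_monom M (laurent_monom a * \<phi>))"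
    and "supp (subst_monom M (laurent_monom a * \<phi>)) = (\<lambda>m. M (m + a)) ` supp \<phi>"
proof -
  let ?\<psi> = "laurent_monom a * \<phi>"
  have n1: "is_nct r ?\<psi>" by (rule nct_unit_mult[OF monom_unit nct])
  show n2: "is_nct r (subst_monom M ?\<psi>)" by (rule nct_iso[OF subst_monom_iso[OF M] n1])
  have "(\<phi>, ?\<psi>) \<in> nct_step r"
    unfolding nct_step_def NCT_def using nct n1 monom_unit[of a] by blast
  moreover have "(?\<psi>, subst_monom M ?\<psi>) \<in> nct_step r"
    unfolding nct_step_def NCT_def using n1 n2 subst_monom_iso[OF M] by blast
  moreover have "trans (nct_equiv r :: ('a laurent \<times> 'a laurent) set)"
    using equiv_nct_equiv by (rule equivE)
  ultimately show "(\<phi>, subst_monom M ?\<psi>) \<in> nct_equiv r"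
    using nct_step_equiv by (meson transD)
  show "supp (subst_monom M ?\<psi>) = (\<lambda>m. M (m + a)) ` supp \<phi>"
    by (simp add: supp_subst_monom[OF M] supp_monom_mult image_image add.commute)
qed

text \<open>By uniqueness the support determines an nct up to a scalar, which is a unit.\<close>

lemma nct_equiv_if_same_supp:
  assumes "is_nct r \<phi>" "is_nct r \<psi>" "supp \<phi> = supp \<psi>" "r > 0"
  shows "(\<phi>, \<psi>) \<in> nct_equiv r"
proof -
  have "supp \<psi> \<subseteq> newton_lattice_points \<phi>" using supp_subset_newton[of \<phi>] assms(3) by simp
  then obtain c where c: "\<psi> = laurent_scale c \<phi>"
    by (rule nct_unique_in_newton_polygon[OF assms(1,4) nctD(2)[OF assms(2)]])
  have "c \<noteq> 0" using c nctD(4)[OF assms(2)] by (auto simp: laurent_scale_def laurent_const_def)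
  then show ?thesis unfolding c by (rule nct_equiv_scale[OF assms(1)])
qed

text \<open>
  Complete the primitive direction of \<open>u\<close> to a basis of the lattice, in which it becomes \<open>(0, 1)\<close>;
  then subtract a multiple of the first coordinate from the second to reduce the last entry of \<open>v\<close>.
\<close>

lemma hermite_normal_form:
  assumes det: "det2 u v > 0"
  obtains M g D b where "lattice_auto M" "M u = (0, g)" "M v = (D, b)" "0 \<le> b" "b < D" "g > 0"
    "\<And>m n. det2 (M m) (M n) = - det2 m n"
proof -
  have "u \<noteq> 0" using det by (auto simp: det2_def)
  then obtain d g where d: "primitive d" "u = zmult g d" "g > 0" by (rule primitive_direction)
  obtain d1 d2 where d12: "d = (d1, d2)" by (cases d)
  obtain a b where ab: "a * d1 + b * d2 = 1"
    using d(1) bezout_int[of d1 d2] by (auto simp: primitive_def d12)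
  have D: "det2 d v > 0" using det d(2,3) by (simp add: det2_zmult zero_less_mult_iff)
  define X where "X m = a * fst m + b * snd m" for m
  define q where "q = X v div det2 d v"
  \<comment> \<open>\<open>det2 d\<close> and \<open>X\<close> are coordinates of the lattice that take the
    values \<open>0\<close> and \<open>1\<close> at \<open>d\<close>\<close>
  define M where "M m = (det2 d m, X m - q * det2 d m)" for m
  define M' where "M' m = (d1 * (snd m + q * fst m) - b * fst m, d2 * (snd m + q * fst m) + a * fst m)" for m
  have M'M: "M' (M m) = m" for m
  proof -
    have "fst (M' (M m)) = (a * d1 + b * d2) * fst m" "snd (M' (M m)) = (a * d1 + b * d2) * snd m"
      by (simp_all add: M_def M'_def X_def det2_def d12 algebra_simps)
    then show ?thesis unfolding ab by (simp add: prod_eq_iff)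
  qed
  have MM': "M (M' m) = m" for m
  proof -
    have Y: "det2 d (M' m) = (a * d1 + b * d2) * fst m"
      by (simp add: M'_def det2_def d12 algebra_simps)
    have X: "X (M' m) = (a * d1 + b * d2) * (snd m + q * fst m)"
      by (simp add: M'_def X_def algebra_simps)
    show ?thesis unfolding M_def Y X ab by simp
  qed
  have M: "lattice_auto M"
    by (rule lattice_autoI[OF _ M'M MM'])
       (simp add: M_def X_def det2_def algebra_simps)
  have "det2 d u = 0" "X u = g * (a * d1 + b * d2)"
    by (simp_all add: d(2) d12 det2_def zmult_def X_def algebra_simps)
  then have Mu: "M u = (0, g)" unfolding M_def ab by simp
  have Mv: "M v = (det2 d v, X v mod det2 d v)"
    by (simp add: M_def q_def minus_mult_div_eq_mod mult.commute)
  have det: "det2 (M m) (M n) = - det2 m n" for m n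
  proof -
    have "det2 (M m) (M n) = - (a * d1 + b * d2) * det2 m n"
      by (simp add: M_def X_def det2_def d12 algebra_simps)
    then show ?thesis unfolding ab by simp
  qed
  show thesis
    by (rule that[OF M Mu Mv _ _ d(3) det]) (use D in simp_all)
qed

lemma triangle_area_le_newton_area:
  fixes f :: "'k::field laurent"
  assumes supp: "(0, 0) \<in> supp f" "(0, g) \<in> supp f" "(D, b) \<in> supp f" and gD: "g > 0" "D > 0"
  shows "real_of_int (g * D) \<le> 2 * measure lebesgue (newton_polygon f)"
proof -
  define p q s where "p = real_of_int D" and "q = real_of_int b" and "s = real_of_int g"
  have pos: "p > 0" "s > 0" using gD by (simp_all add: p_def s_def)
  \<comment> \<open>the triangle with corners \<open>(0, 0)\<close>, \<open>(0, s)\<close>, \<open>(p, q)\<close>\<close>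
  let ?T = "trapezoid 0 p 0 (q / p) s ((q - s) / p)"
  have pts: "(0, 0) \<in> newton_polygon f" "(0, s) \<in> newton_polygon f" "(p, q) \<in> newton_polygon f"
    using supp supp_subset_newton[of f]
    by (auto simp: newton_lattice_points_def lattice_point_def p_def q_def s_def
          dest!: subsetD[OF supp_subset_newton])
  have sub: "?T \<subseteq> newton_polygon f"
  proof
    fix z assume "z \<in> ?T"
    then obtain x y where z: "z = (x, y)" "0 \<le> x" "x \<le> p" "q / p * x \<le> y" "y \<le> s + (q - s) / p * x"
      by (auto simp: trapezoid_def)
    define t where "t = x / p"
    define w where "w = (y - q * t) / s"
    have t: "0 \<le> t" "x = t * p" using z pos by (auto simp: t_def)
    have yt: "q * t \<le> y" "y \<le> s + (q - s) * t" using z(4,5) by (simp_all add: t_def)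
    have w: "0 \<le> w" "y = w * s + t * q" using yt(1) pos by (auto simp: w_def mult.commute)
    have "w * s \<le> (1 - t) * s" using yt(2) w(2) by (simp add: algebra_simps)
    then have "w + t \<le> 1" using pos by simp
    then have "(1 - w - t) *\<^sub>R (0, 0) + w *\<^sub>R (0, s) + t *\<^sub>R (p, q) \<in> convex hull {(0, 0), (0, s), (p, q)}"
      unfolding convex_hull_3 using t(1) w(1) by (intro CollectI exI conjI) (rule refl, auto)
    also have "convex hull {(0, 0), (0, s), (p, q)} \<subseteq> newton_polygon f"
      using pts newton_polygon_props(1) by (intro hull_minimal) auto
    finally show "z \<in> newton_polygon f" using z(1) t(2) w(2) by simp
  qed
  have T: "?T \<in> lmeasurable" "measure lebesgue ?T = (p - 0) * (s - 0 + ((q - s) / p - q / p) * (0 + p) / 2)"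
    using area_trapezoid[of 0 p 0 "q / p" s "(q - s) / p"] pos by simp_all
  have "measure lebesgue ?T \<le> measure lebesgue (newton_polygon f)"
    using sub T(1) sets_newton_polygon by (intro measure_mono_fmeasurable) auto
  moreover have "measure lebesgue ?T = s * p / 2" unfolding T(2) using pos by (simp add: field_simps)
  ultimately show ?thesis by (simp add: p_def s_def)
qed

lemma collinear_supp_interior:
  fixes f :: "'k::field laurent"
  assumes AB: "A \<noteq> B" and det: "\<And>m. m \<in> supp f \<Longrightarrow> det2 (B - A) (m - A) = 0"
  shows "interior (newton_polygon f) = {}"
proof -
  define n :: "real \<times> real" where "n = lattice_point (- snd (B - A), fst (B - A))"
  have n0: "n \<noteq> 0" using AB by (auto simp: n_def lattice_point_def prod_eq_iff)
  have "newton_polygon f \<subseteq> {z. n \<bullet> z = n \<bullet> lattice_point A}"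
  proof (rule newton_polygon_minimal[OF convex_hyperplane])
    have "n \<bullet> lattice_point m = n \<bullet> lattice_point A" if "m \<in> supp f" for m
    proof -
      have "n \<bullet> lattice_point m - n \<bullet> lattice_point A = real_of_int (det2 (B - A) (m - A))"
        by (simp add: n_def lattice_point_def det2_def algebra_simps)
      then show ?thesis using det[OF that] by simp
    qed
    then show "lattice_point ` supp f \<subseteq> {z. n \<bullet> z = n \<bullet> lattice_point A}" by blast
  qed
  then show ?thesis using interior_mono interior_hyperplane[OF n0] by blast
qed

definition support_box :: "nat \<Rightarrow> (int \<times> int) set" where
  "support_box r = {- 2 * (int r)\<^sup>2..2 * (int r)\<^sup>2} \<times> {- 2 * (int r)\<^sup>2..2 * (int r)\<^sup>2}"

text \<open>
  Among the triangles with vertices in the support, one of maximal area is put in Hermite normal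
  form \<open>(0, 0)\<close>, \<open>(0, g)\<close>, \<open>(D, b)\<close>. Its double area \<open>g D\<close> is at most that of the Newton polygon, hence
  below \<open>r\<^sup>2\<close>. Any other exponent spans with two of the vertices a triangle that is not larger, which
  bounds both of its coordinates in terms of \<open>g\<close> and \<open>D\<close>. A degenerate Newton polygon is that of a
  binomial, whose primitive direction is mapped to \<open>(0, 1)\<close>.
\<close>

lemma nct_normal_form:
  fixes \<phi> :: "'k::field laurent"
  assumes nct: "is_nct r \<phi>" and r: "r > 0"
  obtains \<psi> where "(\<phi>, \<psi>) \<in> nct_equiv r" "is_nct r \<psi>" "supp \<psi> \<subseteq> support_box r"
proof (cases "interior (newton_polygon \<phi>) = {}")
  case True
  have \<phi>p: "\<phi> \<in> ideal_p"
    using subsetD[OF pow_p_antimono[of "Suc 0" r] nctD(2)[OF nct]] r unfolding pow_p_1 by simp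
  obtain c m d where cmd: "c \<noteq> 0" "primitive d" "\<phi> = laurent_scale c (laurent_monom m * (laurent_monom d - 1))"
    by (rule degenerate_irreducible[OF nctD(1)[OF nct] \<phi>p True])
  have supp: "supp \<phi> = {m, m + d}"
    unfolding cmd(3) supp_scale[OF cmd(1)] by (rule supp_binomial[OF primitive_nonzero[OF cmd(2)]])
  obtain a b where ab: "a * fst d + b * snd d = 1"
    using cmd(2) bezout_int[of "fst d" "snd d"] by (auto simp: primitive_def)
  have pos: "det2 d (- b, a) > 0" using ab by (simp add: det2_def algebra_simps)
  obtain M g D b' where M: "lattice_auto M" "M d = (0, g)" "M (- b, a) = (D, b')" "0 \<le> b'" "b' < D" "g > 0"
    "\<And>m n. det2 (M m) (M n) = - det2 m n"
    by (rule hermite_normal_form[OF pos], rule that)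
  have "g * D = 1" using M(7)[of d "(- b, a)"] ab unfolding M(2,3) by (simp add: det2_def algebra_simps)
  then have "g = 1" using M(6) by (simp add: zmult_eq_1_iff)
  note aff = nct_equiv_affine[OF nct M(1), of "- m"]
  have "supp (subst_monom M (laurent_monom (- m) * \<phi>)) = {(0, 0), (0, 1)}"
    unfolding aff(3) supp using lattice_auto_zero[OF M(1)] M(2) \<open>g = 1\<close> by (auto simp: zero_prod_def)
  moreover have "0 < (int r)\<^sup>2" using r by simp
  then have "- 1 \<le> 2 * (int r)\<^sup>2" "1 \<le> 2 * (int r)\<^sup>2" by linarith+
  ultimately have "supp (subst_monom M (laurent_monom (- m) * \<phi>)) \<subseteq> support_box r" by (simp add: support_box_def)
  then show thesis by (rule that[OF aff(1,2)])
next
  case False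
  let ?T = "supp \<phi> \<times> supp \<phi> \<times> supp \<phi>"
  define F where "F = (\<lambda>(A, B, C). \<bar>det2 (B - A) (C - A)\<bar>)"
  obtain m0 where "m0 \<in> supp \<phi>" using nctD(4)[OF nct] supp_eq_empty_iff[of \<phi>] by blast
  then have "(m0, m0, m0) \<in> ?T" by (intro SigmaI)
  then have "F ` ?T \<noteq> {}" by (metis empty_iff imageI)
  moreover have "finite (F ` ?T)" by (intro finite_imageI finite_cartesian_product finite_keys)
  ultimately have "Max (F ` ?T) \<in> F ` ?T" by (intro Max_in)
  then obtain A B C where ABC: "A \<in> supp \<phi>" "B \<in> supp \<phi>" "C \<in> supp \<phi>" "F (A, B, C) = Max (F ` ?T)"
    by (elim imageE SigmaE) simp
  have max: "F (A', B', C') \<le> F (A, B, C)" if "A' \<in> supp \<phi>" "B' \<in> supp \<phi>" "C' \<in> supp \<phi>" for A' B' C'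
    unfolding ABC(4) using that by (intro Max_ge imageI SigmaI finite_imageI finite_cartesian_product finite_keys)
  have nz: "F (A, B, C) \<noteq> 0"
  proof
    assume z: "F (A, B, C) = 0"
    have "\<not> (\<exists>m. supp \<phi> = {m})" using nctD(5)[OF nct] unfolding laurent_unit_iff .
    then have "\<not> supp \<phi> \<subseteq> {A}" using ABC(1) by (metis empty_iff subset_singletonD)
    then obtain B' where B': "B' \<in> supp \<phi>" "A \<noteq> B'" unfolding subset_iff singleton_iff by metis
    have "det2 (B' - A) (m - A) = 0" if m: "m \<in> supp \<phi>" for m
    proof -
      have "F (A, B', m) \<le> 0" using max[OF ABC(1) B'(1) m] unfolding z .
      then show ?thesis unfolding F_def by simp
    qed
    then have "interior (newton_polygon \<phi>) = {}" by (rule collinear_supp_interior[OF B'(2)])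
    then show False using False by simp
  qed
  \<comment> \<open>exchanging two vertices makes the determinant positive\<close>
  obtain B' C' where BC: "B' \<in> supp \<phi>" "C' \<in> supp \<phi>" "det2 (B' - A) (C' - A) > 0"
    "F (A, B, C) = det2 (B' - A) (C' - A)"
  proof (cases "det2 (B - A) (C - A) > 0")
    case True
    then show thesis using ABC by (intro that[of B C]) (auto simp: F_def)
  next
    case neg: False
    have "det2 (C - A) (B - A) = - det2 (B - A) (C - A)" by (simp add: det2_def)
    then show thesis using ABC nz neg by (intro that[of C B]) (auto simp: F_def)
  qed
  obtain M g D b where M: "lattice_auto M" "M (B' - A) = (0, g)" "M (C' - A) = (D, b)" "0 \<le> b" "b < D" "g > 0"
    "\<And>m n. det2 (M m) (M n) = - det2 m n"
    by (rule hermite_normal_form[OF BC(3)], rule that)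
  have gD: "F (A, B, C) = g * D"
    using M(7)[of "B' - A" "C' - A"] unfolding BC(4) M(2,3) by (simp add: det2_def)
  define \<psi> where "\<psi> = subst_monom M (laurent_monom (- A) * \<phi>)"
  note aff = nct_equiv_affine[OF nct M(1), of "- A", folded \<psi>_def]
  have supp: "supp \<psi> = (\<lambda>m. M (m - A)) ` supp \<phi>" using aff(3) by simp
  have in_supp: "M (m - A) \<in> supp \<psi>" if "m \<in> supp \<phi>" for m unfolding supp using that by (rule imageI)
  have "(0, 0) \<in> supp \<psi>" using in_supp[OF ABC(1)] lattice_auto_zero[OF M(1)] by (simp add: zero_prod_def)
  moreover have "(0, g) \<in> supp \<psi>" using in_supp[OF BC(1)] unfolding M(2) .
  moreover have "(D, b) \<in> supp \<psi>" using in_supp[OF BC(2)] unfolding M(3) .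
  ultimately have "real_of_int (g * D) \<le> 2 * measure lebesgue (newton_polygon \<psi>)"
    by (rule triangle_area_le_newton_area) (use M in auto)
  then have "real_of_int (g * D) < real_of_int ((int r)\<^sup>2)" using nctD(3)[OF aff(2)] by simp
  then have lt: "g * D < (int r)\<^sup>2" unfolding of_int_less_iff .
  have "g * 1 \<le> g * D" using M(4-6) by (intro mult_left_mono) auto
  moreover have "1 * D \<le> g * D" using M(4-6) by (intro mult_right_mono) auto
  ultimately have bounds: "g < (int r)\<^sup>2" "D < (int r)\<^sup>2" using lt by linarith+
  have "n \<in> support_box r" if n: "n \<in> supp \<psi>" for n
  proof -
    obtain m where m: "m \<in> supp \<phi>" "n = M (m - A)" using n supp by blast
    obtain x y where xy: "n = (x, y)" by (cases n)
    have "\<bar>det2 (0, g) n\<bar> \<le> g * D"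
      using max[OF ABC(1) BC(1) m(1)] M(7)[of "B' - A" "m - A"] unfolding gD M(2) m(2)[symmetric] by (simp add: F_def)
    then have "g * \<bar>x\<bar> \<le> g * D" using M(6) by (simp add: det2_def xy abs_mult)
    then have x: "\<bar>x\<bar> \<le> D" using M(6) by simp
    have "\<bar>det2 n (D, b)\<bar> \<le> g * D"
      using max[OF ABC(1) m(1) BC(2)] M(7)[of "m - A" "C' - A"] unfolding gD M(3) m(2)[symmetric] by (simp add: F_def)
    then have "\<bar>x * b - y * D\<bar> \<le> g * D" by (simp add: det2_def xy)
    moreover have "\<bar>x * b\<bar> \<le> D * b" using x M(4) by (simp add: abs_mult mult_right_mono)
    ultimately have "\<bar>y * D\<bar> \<le> g * D + D * b" by linarith
    then have "\<bar>y\<bar> * D \<le> (g + b) * D" using M(4,5) by (simp add: abs_mult algebra_simps)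
    then have y: "\<bar>y\<bar> \<le> g + b" using M(4,5) by simp
    have "\<bar>x\<bar> \<le> 2 * (int r)\<^sup>2" "\<bar>y\<bar> \<le> 2 * (int r)\<^sup>2" using x y bounds M(4,5) by linarith+
    then show ?thesis by (simp add: support_box_def xy abs_le_iff)
  qed
  then show thesis by (intro that[OF aff(1,2)]) blast
qed

text \<open>Every class is determined by the support of a representative in the box.\<close>

theorem finite_nct_classes:
  assumes r: "r > 0"
  shows "finite ((NCT r :: 'k::field laurent set) // nct_equiv r)"
proof -
  let ?E = "nct_equiv r :: ('k laurent \<times> 'k laurent) set"
  define W :: "'k laurent set" where "W = {\<psi>. is_nct r \<psi> \<and> supp \<psi> \<subseteq> support_box r}"
  have same_class: "?E `` {\<phi>} = ?E `` {\<psi>}" if "(\<phi>, \<psi>) \<in> ?E" for \<phi> \<psi>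
    by (rule equiv_class_eq[OF equiv_nct_equiv that])
  have "(NCT r :: 'k laurent set) // ?E \<subseteq> (\<lambda>S. ?E `` {SOME \<psi>. \<psi> \<in> W \<and> supp \<psi> = S}) ` Pow (support_box r)"
  proof
    fix q assume "q \<in> NCT r // ?E"
    then obtain \<phi> where \<phi>: "is_nct r \<phi>" "q = ?E `` {\<phi>}" by (auto simp: quotient_def NCT_def)
    obtain \<psi> where \<psi>: "(\<phi>, \<psi>) \<in> ?E" "is_nct r \<psi>" "supp \<psi> \<subseteq> support_box r"
      by (rule nct_normal_form[OF \<phi>(1) r])
    define \<chi>' where "\<chi>' = (SOME \<psi>'. \<psi>' \<in> W \<and> supp \<psi>' = supp \<psi>)"
    have "\<psi> \<in> W \<and> supp \<psi> = supp \<psi>" using \<psi> by (simp add: W_def)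
    then have "\<chi>' \<in> W \<and> supp \<chi>' = supp \<psi>" unfolding \<chi>'_def by (rule someI)
    then have "(\<psi>, \<chi>') \<in> ?E"
      by (intro nct_equiv_if_same_supp[OF \<psi>(2) _ _ r]) (auto simp: W_def)
    then have "q = ?E `` {\<chi>'}" using \<phi>(2) same_class[OF \<psi>(1)] same_class by simp
    then show "q \<in> (\<lambda>S. ?E `` {SOME \<psi>. \<psi> \<in> W \<and> supp \<psi> = S}) ` Pow (support_box r)"
      unfolding \<chi>'_def using \<psi>(3) by (intro image_eqI[of _ _ "supp \<psi>"]) auto
  qed
  moreover have "finite (Pow (support_box r))" by (simp add: support_box_def)
  ultimately show ?thesis by (meson finite_imageI finite_subset)
qed

section \<open>The theorem\<close>

theorem proposition3p4:
  fixes r :: nat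
  assumes "r > 0"
  shows
    \<comment> \<open>(1)\<close>
    "(\<forall>u :: ('k::field) laurent.
        u dvd 1 \<longleftrightarrow> (\<exists>c \<alpha> \<beta>. c \<noteq> 0 \<and> u = laurent_const c * laurent_monom (\<alpha>, \<beta>))) \<and>
     (\<forall>u \<phi> :: 'k laurent. u dvd 1 \<longrightarrow> is_nct r \<phi> \<longrightarrow> is_nct r (u * \<phi>)) \<and>
     (\<forall>\<xi> :: 'k laurent \<Rightarrow> 'k laurent. p_preserving_iso \<xi> \<longrightarrow>
        (\<exists>a :: int^2^2. invertible a \<and>
           \<xi> var_v = laurent_monom (a $ 1 $ 1, a $ 1 $ 2) \<and>
           \<xi> var_w = laurent_monom (a $ 2 $ 1, a $ 2 $ 2)) \<and>
        (\<forall>\<phi>. is_nct r \<phi> \<longrightarrow> is_nct r (\<xi> \<phi>))) \<and>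
     \<comment> \<open>(2)\<close>
     (\<forall>\<phi> :: 'k laurent. is_nct r \<phi> \<longrightarrow>
        ideal_power ideal_p r \<inter>
          module.span laurent_scale (laurent_monom ` newton_lattice_points \<phi>)
          = {laurent_scale c \<phi> | c. True} \<and>
        (finite (newton_lattice_points \<phi>) \<and>
           card (newton_lattice_points \<phi>) \<le> r * (r + 1) div 2 + 1) \<and>
        (\<forall>\<zeta> :: 'k laurent. is_reducible \<zeta> \<longrightarrow> \<zeta> \<in> ideal_power ideal_p r \<longrightarrow>
           \<not> lattice_point ` Poly_Mapping.keys \<zeta> \<subseteq> newton_polygon \<phi>) \<and>
        (r \<ge> 2 \<longrightarrow>
           \<not> (\<exists>S. S \<subseteq> newton_lattice_points \<phi> \<and> card S = r + 1 \<and>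
                  collinear (lattice_point ` S)))) \<and>
     \<comment> \<open>(3)\<close>
     (\<forall>\<phi> :: 'k laurent. is_nct r \<phi> \<longrightarrow>
        (\<exists>c. c \<noteq> 0 \<and>
           (\<forall>m. Poly_Mapping.lookup (laurent_scale c \<phi>) m \<in> prime_field))) \<and>
     \<comment> \<open>(4)\<close>
     (\<forall>\<phi> :: 'k laurent. is_nct r \<phi> \<longrightarrow> \<phi> \<notin> ideal_power ideal_p (r + 1)) \<and>
     \<comment> \<open>(5)\<close>
     (\<forall>(\<phi> :: 'k laurent) (h :: 'k \<Rightarrow> 'l::field).
        is_nct r \<phi> \<longrightarrow> is_ring_hom h \<longrightarrow> is_nct r (Poly_Mapping.map h \<phi>)) \<and>
     \<comment> \<open>(6)\<close>
     (NCT r :: 'k laurent set) // nct_equiv r \<noteq> {} \<and>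
     finite ((NCT r :: 'k laurent set) // nct_equiv r)"
proof (intro conjI allI impI)
  fix u \<phi> :: "'k laurent"
  show "u dvd 1 \<longleftrightarrow> (\<exists>c \<alpha> \<beta>. c \<noteq> 0 \<and> u = laurent_const c * laurent_monom (\<alpha>, \<beta>))"
    unfolding laurent_unit_eq_term term_eq_scale_monom laurent_scale_def split_paired_Ex ..
  show "is_nct r (u * \<phi>)" if "u dvd 1" "is_nct r \<phi>" by (rule nct_unit_mult[OF that])
next
  fix \<xi> :: "'k laurent \<Rightarrow> 'k laurent" and \<phi> :: "'k laurent"
  assume \<xi>: "p_preserving_iso \<xi>"
  show "\<exists>a :: int^2^2. invertible a \<and> \<xi> var_v = laurent_monom (a $ 1 $ 1, a $ 1 $ 2) \<and>
      \<xi> var_w = laurent_monom (a $ 2 $ 1, a $ 2 $ 2)"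
    by (rule p_preserving_iso_matrix[OF \<xi>])
  show "is_nct r (\<xi> \<phi>)" if "is_nct r \<phi>" by (rule nct_iso[OF \<xi> that])
next
  fix \<phi> :: "'k laurent"
  assume nct: "is_nct r \<phi>"
  show "pow_p r \<inter> laurent.span (laurent_monom ` newton_lattice_points \<phi>) = {laurent_scale c \<phi> | c. True}"
    by (rule nct_linear_system[OF nct assms])
  show "finite (newton_lattice_points \<phi>)" by (rule finite_newton_lattice_points)
  show "card (newton_lattice_points \<phi>) \<le> r * (r + 1) div 2 + 1" by (rule nct_card_lattice_points[OF nct assms])
  show "\<not> lattice_point ` supp \<zeta> \<subseteq> newton_polygon \<phi>"
    if "is_reducible \<zeta>" "\<zeta> \<in> pow_p r" for \<zeta> :: "'k laurent"
    by (rule nct_no_reducible[OF nct assms that])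
  show "\<not> (\<exists>S. S \<subseteq> newton_lattice_points \<phi> \<and> card S = r + 1 \<and> collinear (lattice_point ` S))" if "r \<ge> 2"
    using nct_no_long_line[OF nct that] by blast
  show "\<exists>c. c \<noteq> 0 \<and> (\<forall>m. coef (laurent_scale c \<phi>) m \<in> prime_field)"
    by (rule nct_defined_over_subfield[OF nct assms is_subfield_prime_field]) blast
  show "\<phi> \<notin> pow_p (r + 1)" by (rule nct_order_exact[OF nct assms])
  show "is_nct r (Poly_Mapping.map h \<phi>)" if "is_ring_hom h" for h :: "'k \<Rightarrow> 'l"
    by (rule nct_base_change[OF that nct assms])
next
  obtain \<phi> :: "'k laurent" where "\<phi> \<in> NCT r" using nct_exists[OF assms] by (auto simp: NCT_def)
  then have "nct_equiv r `` {\<phi>} \<in> NCT r // nct_equiv r" by (rule quotientI)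
  then show "(NCT r :: 'k laurent set) // nct_equiv r \<noteq> {}" unfolding ex_in_conv[symmetric] by (rule exI)
  show "finite ((NCT r :: 'k laurent set) // nct_equiv r)" by (rule finite_nct_classes[OF assms])
qed

end
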